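(* There is a constant $C_1$, independent of the diffusion coefficient $\epsilon$ and of the mesh size, such that $$\eta_F^0\le C_1\big(\epsilon^{-1/2}\alpha_F\|[[(\boldsymbol{q}-\boldsymbol{q}_h)\cdot\boldsymbol{n}]]\|_{0,F}^2+\gamma_F\|[[u-u_h]]\|_{0,F}^2\big)^{1/2}\quad\forall F\in\mathcal{E}_h^0,$$ $$\eta_F^\partial\le C_1\big(\gamma_F\|g-u_h\|_{0,F}^2\big)^{1/2}\quad\forall F\in\mathcal{E}_h^\partial,$$ $$\eta_T\le C_1\big(\epsilon^{-1}\|\boldsymbol{q}-\boldsymbol{q}_h\|_{0,T}^2+\|u-u_h\|_{0,T}^2+\epsilon\|\nabla(u-u_h)\|_{0,T}^2+\alpha_T^2\|\mathrm{div}(\boldsymbol{q}-\boldsymbol{q}_h)+\boldsymbol{\beta}\cdot\nabla(u-u_h)\|_{0,T}^2+osc_h^2(R_h,T)\big)^{1/2}\quad\forall T\in\mathcal{T}_h,$$ where $osc_h^2(R_h,T):=\alpha_T^2\|R_h-P_WR_h\|_{0,T}^2$ and $P_W$ is the $L^2$-orthogonal projection onto $W_h$.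
   Context: Problem. $\Omega\subset\mathbb{R}^d$ ($d=2,3$) is a bounded polyhedral domain, and $u\in H^1(\Omega)$ is the weak solution of $-\epsilon\Delta u+\boldsymbol{\beta}\cdot\nabla u+cu=f$ in $\Omega$, $u=g$ on $\partial\Omega$. Assumptions: (i) $0<\epsilon\le 1$; (ii) $\boldsymbol{\beta}\in W^{1,\infty}(\Omega)^d$, $c\in L^\infty(\Omega)$, $f\in L^2(\Omega)$, $g\in H^{1/2}(\partial\Omega)$; (iii) $c-\frac12\mathrm{div}\,\boldsymbol{\beta}\ge0$; (iv) there are $\psi\in W^{1,\infty}(\Omega)$ and a constant $b_0>0$ with $\boldsymbol{\beta}\cdot\nabla\psi\ge b_0$. Put $\boldsymbol{q}=-\epsilon\nabla u$, so that $\mathrm{div}\,\boldsymbol{q}+\boldsymbol{\beta}\cdot\nabla u+cu=f$. Mesh. $\mathcal{T}_h$ is a conforming, shape-regular simplicial triangulation of $\Omega$; "faces" are edges if $d=2$ and faces if $d=3$. $\mathcal{E}_h$, $\mathcal{E}_h^0$, $\mathcal{E}_h^\partial$ are the sets of all, interior, and boundary faces; $\partial\mathcal{T}_h=\{\partial T:T\in\mathcal{T}_h\}$; $h_T$, $h_F$ are the diameters of $T$, $F$; $\boldsymbol{n}$ is the outward unit normal on $\partial T$. $(\eta,\zeta)_{\mathcal{T}_h}=\sum_{T}\int_T\eta\zeta\,dx$, $\langle\eta,\zeta\rangle_{\partial\mathcal{T}_h}=\sum_T\int_{\partial T}\eta\zeta\,ds$. $\|\cdot\|_{0,D}$ is the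 $L^2(D)$ norm. HDG method. Fix $p\ge1$; $\mathcal{P}_p(S)$ is the space of polynomials of total degree at most $p$ on $S$. $\boldsymbol{V}_h=\{\boldsymbol{v}\in L^2(\Omega)^d:\boldsymbol{v}|_T\in\mathcal{P}_p(T)^d\ \forall T\}$, $W_h=\{w\in L^2(\Omega):w|_T\in\mathcal{P}_p(T)\ \forall T\}$, $M_h=\{\mu\in L^2(\mathcal{E}_h):\mu|_F\in\mathcal{P}_p(F)\ \forall F\in\mathcal{E}_h\}$. $(\boldsymbol{q}_h,u_h,\widehat u_h)\in\boldsymbol{V}_h\times W_h\times M_h$ is the unique solution of, for all $(\boldsymbol{r},w,\mu)\in\boldsymbol{V}_h\times W_h\times M_h$, $(\epsilon^{-1}\boldsymbol{q}_h,\boldsymbol{r})_{\mathcal{T}_h}-(u_h,\mathrm{div}\,\boldsymbol{r})_{\mathcal{T}_h}+\langle\widehat u_h,\boldsymbol{r}\cdot\boldsymbol{n}\rangle_{\partial\mathcal{T}_h}=0$; $-(\boldsymbol{q}_h+\boldsymbol{\beta}u_h,\nabla w)_{\mathcal{T}_h}+((c-\mathrm{div}\,\boldsymbol{\beta})u_h,w)_{\mathcal{T}_h}+\langle(\widehat{\boldsymbol{q}}_h+\widehat{\boldsymbol{\beta}u_h})\cdot\boldsymbol{n},w\rangle_{\partial\mathcal{T}_h}=(f,w)_{\mathcal{T}_h}$; $\langle\widehat u_h,\mu\rangle_{\partial\Omega}=\langle g,\mu\rangle_{\partial\Omega}$; $\langle(\widehat{\boldsymbol{q}}_h+\widehat{\boldsymbol{\beta}u_h})\cdot\boldsymbol{n},\mu\rangle_{\partial\mathcal{T}_h\setminus\partial\Omega}=0$;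 where on $\partial\mathcal{T}_h$, $(\widehat{\boldsymbol{q}}_h+\widehat{\boldsymbol{\beta}u_h})\cdot\boldsymbol{n}=\boldsymbol{q}_h\cdot\boldsymbol{n}+(\boldsymbol{\beta}\cdot\boldsymbol{n})\widehat u_h+\tau(u_h-\widehat u_h)$, and, for $T\in\mathcal{T}_h$ and each face $F$ of $T$, $\tau|_F=\max(\sup_{x\in F}\boldsymbol{\beta}(x)\cdot\boldsymbol{n},0)+\min(\rho_0\epsilon/h_T,1)$ with a fixed $0<\rho_0\le1$. Estimator. $R_h|_T=f-\mathrm{div}\,\boldsymbol{q}_h-\boldsymbol{\beta}\cdot\nabla u_h-cu_h$ for $T\in\mathcal{T}_h$; $\alpha_S=\min\{h_S\epsilon^{-1/2},1\}$ for $S$ an element or a face; for $F\in\mathcal{E}_h$, $$\gamma_F=\min\Big\{\frac{\epsilon}{h_F}+\Big(\frac{h_F}{\epsilon}+\epsilon^{-1/2}\alpha_F\Big)\|\boldsymbol{\beta}\|_{L^\infty(F)}+h_F,\ \frac{\epsilon+\|\boldsymbol{\beta}\|_{L^\infty(F)}}{h_F}+h_F\Big\}.$$ On an interior face $F=\partial T^+\cap\partial T^-$ the jumps are $[[\phi]]=\phi^+-\phi^-$ and $[[\boldsymbol{\sigma}\cdot\boldsymbol{n}]]=\boldsymbol{\sigma}^+\cdot\boldsymbol{n}^++\boldsymbol{\sigma}^-\cdot\boldsymbol{n}^-$; the jumps of $\boldsymbol{q}\cdot\boldsymbol{n}$ and $u$ across interior faces are zero. Then $\eta_T^2=\alpha_T^2\|R_h\|_{0,T}^2+\epsilon^{-1}\|\boldsymbol{q}_h+\epsilon\nabla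 u_h\|_{0,T}^2$ for $T\in\mathcal{T}_h$; $(\eta_F^0)^2=\epsilon^{-1/2}\alpha_F\|[[\boldsymbol{q}_h\cdot\boldsymbol{n}]]\|_{0,F}^2+\gamma_F\|[[u_h]]\|_{0,F}^2$ for $F\in\mathcal{E}_h^0$; $\eta_F^\partial=\gamma_F^{1/2}\|u_h-g\|_{0,F}$ for $F\in\mathcal{E}_h^\partial$ (all square roots nonnegative). Constants "independent of $\epsilon$ and the mesh size" may depend only on $d$, $\Omega$, $p$, $\rho_0$, the shape-regularity of the mesh, $\boldsymbol{\beta}$, $c$, $\psi$, $b_0$ (not on $f$, $g$). *)

theory Defs
  imports "HOL-Analysis.Analysis"
begin

text \<open>
  Classes of functions modulo null sets are represented by arbitrary representatives: Lebesgue
  measurable ones on open sets, Borel measurable ones on surfaces.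
\<close>

text \<open>
  For a unit vector \<open>n\<close>, the \<open>(d-1)\<close>-dimensional Lebesgue measure on the hyperplane
  \<open>{x. n \<bullet> x = b}\<close>: a subset is measured by the volume of the right cylinder of height one over it.
\<close>
definition hyperplane_measure :: "'a::euclidean_space \<Rightarrow> real \<Rightarrow> 'a measure" where
  "hyperplane_measure n b =
     distr (restrict_space lborel {x. b \<le> n \<bullet> x \<and> n \<bullet> x \<le> b + 1}) borel
       (\<lambda>x. x - (n \<bullet> x - b) *\<^sub>R n)"

text \<open>
  The sum of the measures of all hyperplanes. Every hyperplane has the two representations
  \<open>(n, b)\<close> and \<open>(- n, - b)\<close>, whence the factor \<open>1/2\<close>. On a set covered by finitely many
  hyperplanes (a face of a simplex, the boundary of a polyhedral domain) two different hyperplanes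
  meet in a null set, only finitely many summands do not vanish, and the result is the usual
  surface measure \<open>ds\<close>.
\<close>
definition surface_measure :: "'a::euclidean_space measure" where
  "surface_measure = measure_of UNIV (sets borel)
     (\<lambda>A. (\<integral>\<^sup>+ (n, b). emeasure (hyperplane_measure n b) A \<partial>count_space {(n, b). norm n = 1}) / 2)"

lemma emeasure_surface_measure:
  fixes A :: "'a::euclidean_space set"
  assumes "A \<in> sets borel"
  shows "emeasure surface_measure A =
    (\<integral>\<^sup>+ (n, b). emeasure (hyperplane_measure n b) A \<partial>count_space {(n, b). norm n = 1}) / 2"
proof -
  let ?C = "count_space {(n :: 'a, b :: real). norm n = 1}"
  let ?\<mu> = "\<lambda>A. (\<integral>\<^sup>+ (n, b). emeasure (hyperplane_measure n b) A \<partial>?C) / (2::ennreal)"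
  have "countably_additive (sets (borel :: 'a measure)) ?\<mu>"
  proof (rule countably_additiveI)
    fix A :: "nat \<Rightarrow> 'a set"
    assume A: "range A \<subseteq> sets borel" "disjoint_family A"
    have sum: "(\<Sum>i. emeasure (hyperplane_measure n b) (A i)) =
        emeasure (hyperplane_measure n b) (\<Union> (range A))" for n b
      using A by (intro suminf_emeasure) (auto simp: hyperplane_measure_def)
    have "(\<Sum>i. ?\<mu> (A i)) = (\<Sum>i. \<integral>\<^sup>+ (n, b). emeasure (hyperplane_measure n b) (A i) \<partial>?C) / 2"
      by (simp add: divide_ennreal_def)
    also have "\<dots> = (\<integral>\<^sup>+ x. (\<Sum>i. case x of (n, b) \<Rightarrow> emeasure (hyperplane_measure n b) (A i)) \<partial>?C) / 2"
      by (subst nn_integral_suminf) auto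
    also have "\<dots> = ?\<mu> (\<Union> (range A))"
      by (simp add: sum case_prod_unfold)
    finally show "(\<Sum>i. ?\<mu> (A i)) = ?\<mu> (\<Union> (range A))" .
  qed
  moreover have "positive (sets (borel :: 'a measure)) ?\<mu>"
    by (simp add: positive_def case_prod_unfold)
  ultimately have "measure_space UNIV (sets (borel :: 'a measure)) ?\<mu>"
    using sets.sigma_algebra_axioms[of "borel :: 'a measure"] by (auto simp: measure_space_def)
  then show ?thesis
    unfolding surface_measure_def
    using assms by (intro emeasure_measure_of_sigma)
      (auto simp: measure_space_def)
qed

abbreviation surface_on :: "'a::euclidean_space set \<Rightarrow> 'a measure" where
  "surface_on S \<equiv> restrict_space surface_measure S"

definition L2 :: "'a measure \<Rightarrow> ('a \<Rightarrow> 'b::euclidean_space) \<Rightarrow> bool" where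
  "L2 M f \<longleftrightarrow> f \<in> borel_measurable M \<and> integrable M (\<lambda>x. (norm (f x))\<^sup>2)"

definition L2norm :: "'a measure \<Rightarrow> ('a \<Rightarrow> 'b::euclidean_space) \<Rightarrow> real" where
  "L2norm M f = sqrt (\<integral>x. (norm (f x))\<^sup>2 \<partial>M)"

definition Linf :: "'a measure \<Rightarrow> ('a \<Rightarrow> 'b::euclidean_space) \<Rightarrow> bool" where
  "Linf M f \<longleftrightarrow> f \<in> borel_measurable M \<and> (\<exists>K. AE x in M. norm (f x) \<le> K)"

text \<open>\<open>C\<^sup>\<infinity>\<close> on the whole space: differentiable, and so are all iterated directional derivatives.\<close>
coinductive smooth :: "('a::real_normed_vector \<Rightarrow> real) \<Rightarrow> bool" where
  "(\<And>x. (f has_derivative f' x) (at x)) \<Longrightarrow> (\<And>v. smooth (\<lambda>x. f' x v)) \<Longrightarrow> smooth f"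

definition test_fun :: "'a::real_normed_vector set \<Rightarrow> ('a \<Rightarrow> real) \<Rightarrow> bool" where
  "test_fun D \<phi> \<longleftrightarrow> smooth \<phi> \<and> compact (closure {x. \<phi> x \<noteq> 0}) \<and> closure {x. \<phi> x \<noteq> 0} \<subseteq> D"

definition grad :: "(real^'n \<Rightarrow> real) \<Rightarrow> real^'n \<Rightarrow> real^'n" where
  "grad v x = (\<chi> i. frechet_derivative v (at x) (axis i 1))"

definition divg :: "(real^'n \<Rightarrow> real^'n) \<Rightarrow> real^'n \<Rightarrow> real" where
  "divg \<sigma> x = (\<Sum>i\<in>UNIV. frechet_derivative \<sigma> (at x) (axis i 1) $ i)"

definition weak_grad :: "(real^'n) set \<Rightarrow> (real^'n \<Rightarrow> real) \<Rightarrow> (real^'n \<Rightarrow> real^'n) \<Rightarrow> bool" where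
  "weak_grad D v G \<longleftrightarrow> L2 (lebesgue_on D) v \<and> L2 (lebesgue_on D) G \<and>
     (\<forall>\<phi>. test_fun D \<phi> \<longrightarrow>
       (\<integral>x. v x *\<^sub>R grad \<phi> x \<partial>lebesgue_on D) = - (\<integral>x. \<phi> x *\<^sub>R G x \<partial>lebesgue_on D))"

definition weak_div :: "(real^'n) set \<Rightarrow> (real^'n \<Rightarrow> real^'n) \<Rightarrow> (real^'n \<Rightarrow> real) \<Rightarrow> bool" where
  "weak_div D \<sigma> \<delta> \<longleftrightarrow> L2 (lebesgue_on D) \<sigma> \<and> L2 (lebesgue_on D) \<delta> \<and>
     (\<forall>\<phi>. test_fun D \<phi> \<longrightarrow>
       (\<integral>x. \<sigma> x \<bullet> grad \<phi> x \<partial>lebesgue_on D) = - (\<integral>x. \<delta> x * \<phi> x \<partial>lebesgue_on D))"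

text \<open>Weak derivatives are unique up to null sets; the operators pick a representative.\<close>
definition wgrad :: "(real^'n) set \<Rightarrow> (real^'n \<Rightarrow> real) \<Rightarrow> real^'n \<Rightarrow> real^'n" where
  "wgrad D v = (SOME G. weak_grad D v G)"

definition wdiv :: "(real^'n) set \<Rightarrow> (real^'n \<Rightarrow> real^'n) \<Rightarrow> real^'n \<Rightarrow> real" where
  "wdiv D \<sigma> = (SOME \<delta>. weak_div D \<sigma> \<delta>)"

definition H1 :: "(real^'n) set \<Rightarrow> (real^'n \<Rightarrow> real) \<Rightarrow> bool" where
  "H1 D v \<longleftrightarrow> (\<exists>G. weak_grad D v G)"

definition Hdiv :: "(real^'n) set \<Rightarrow> (real^'n \<Rightarrow> real^'n) \<Rightarrow> bool" where
  "Hdiv D \<sigma> \<longleftrightarrow> (\<exists>\<delta>. weak_div D \<sigma> \<delta>)"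

text \<open>For bounded \<open>D\<close>, where bounded functions are square integrable.\<close>
definition W1inf :: "(real^'n) set \<Rightarrow> (real^'n \<Rightarrow> real) \<Rightarrow> bool" where
  "W1inf D v \<longleftrightarrow> Linf (lebesgue_on D) v \<and> (\<exists>G. weak_grad D v G \<and> Linf (lebesgue_on D) G)"

definition H1_lim :: "(real^'n) set \<Rightarrow> (nat \<Rightarrow> real^'n \<Rightarrow> real) \<Rightarrow> (real^'n \<Rightarrow> real) \<Rightarrow> bool" where
  "H1_lim D \<phi> v \<longleftrightarrow>
     (\<lambda>k. L2norm (lebesgue_on D) (\<lambda>x. \<phi> k x - v x)) \<longlonglongrightarrow> 0 \<and>
     (\<lambda>k. L2norm (lebesgue_on D) (\<lambda>x. grad (\<phi> k) x - wgrad D v x)) \<longlonglongrightarrow> 0"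

definition H10 :: "(real^'n) set \<Rightarrow> (real^'n \<Rightarrow> real) \<Rightarrow> bool" where
  "H10 D v \<longleftrightarrow> H1 D v \<and> (\<exists>\<phi>. (\<forall>k. test_fun D (\<phi> k)) \<and> H1_lim D \<phi> v)"

text \<open>
  \<open>t\<close> is the trace on \<open>S \<subseteq> \<partial>D\<close> of \<open>v \<in> H\<^sup>1(D)\<close>, i.e. the value at \<open>v\<close> of the continuous extension
  of the restriction of smooth functions to \<open>S\<close>.
\<close>
definition has_trace :: "(real^'n) set \<Rightarrow> (real^'n) set \<Rightarrow> (real^'n \<Rightarrow> real) \<Rightarrow> (real^'n \<Rightarrow> real) \<Rightarrow> bool" where
  "has_trace D S v t \<longleftrightarrow> H1 D v \<and> L2 (surface_on S) t \<and>
     (\<exists>\<phi>. (\<forall>k. smooth (\<phi> k)) \<and> H1_lim D \<phi> v \<and>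
       (\<lambda>k. L2norm (surface_on S) (\<lambda>x. \<phi> k x - t x)) \<longlonglongrightarrow> 0)"

text \<open>\<open>H\<^sup>1\<^sup>/\<^sup>2(S)\<close> for a \<open>(d-1)\<close>-dimensional \<open>S\<close>, by the Sobolev--Slobodeckij seminorm.\<close>
definition Hhalf :: "(real^'n) set \<Rightarrow> (real^'n \<Rightarrow> real) \<Rightarrow> bool" where
  "Hhalf S g \<longleftrightarrow> L2 (surface_on S) g \<and>
     (\<integral>\<^sup>+x. (\<integral>\<^sup>+y. ennreal ((g x - g y)\<^sup>2 / norm (x - y) ^ CARD('n)) \<partial>surface_on S) \<partial>surface_on S) < \<infinity>"

text \<open>The condition \<open>interior (closure \<Omega>) = \<Omega>\<close> excludes cracks; Lipschitz domains satisfy it.\<close>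
definition polyhedral_domain :: "(real^'n) set \<Rightarrow> bool" where
  "polyhedral_domain \<Omega> \<longleftrightarrow> open \<Omega> \<and> connected \<Omega> \<and> bounded \<Omega> \<and> \<Omega> \<noteq> {} \<and>
     interior (closure \<Omega>) = \<Omega> \<and> (\<exists>\<P>. finite \<P> \<and> (\<forall>P\<in>\<P>. polytope P) \<and> \<Union>\<P> = closure \<Omega>)"

definition weak_solution :: "(real^'n) set \<Rightarrow> real \<Rightarrow> (real^'n \<Rightarrow> real^'n) \<Rightarrow> (real^'n \<Rightarrow> real) \<Rightarrow>
    (real^'n \<Rightarrow> real) \<Rightarrow> (real^'n \<Rightarrow> real) \<Rightarrow> (real^'n \<Rightarrow> real) \<Rightarrow> bool" where
  "weak_solution \<Omega> \<epsilon> \<beta> c f g u \<longleftrightarrow> has_trace \<Omega> (frontier \<Omega>) u g \<and>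
     (\<forall>v. H10 \<Omega> v \<longrightarrow>
       (\<integral>x. \<epsilon> * (wgrad \<Omega> u x \<bullet> wgrad \<Omega> v x) + (\<beta> x \<bullet> wgrad \<Omega> u x + c x * u x) * v x \<partial>lebesgue_on \<Omega>) =
       (\<integral>x. f x * v x \<partial>lebesgue_on \<Omega>))"

text \<open>Elements are closed simplices; the library's \<^const>\<open>triangulation\<close> contains conformity.\<close>
definition conforming_mesh :: "(real^'n) set \<Rightarrow> (real^'n) set set \<Rightarrow> bool" where
  "conforming_mesh \<Omega> \<T> \<longleftrightarrow>
     triangulation \<T> \<and> (\<forall>T\<in>\<T>. int CARD('n) simplex T) \<and> \<Union>\<T> = closure \<Omega>"

definition shape_regular :: "real \<Rightarrow> (real^'n) set set \<Rightarrow> bool" where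
  "shape_regular \<kappa> \<T> \<longleftrightarrow> (\<forall>T\<in>\<T>. \<exists>z r. r > 0 \<and> cball z r \<subseteq> T \<and> diameter T \<le> \<kappa> * (2 * r))"

definition faces :: "(real^'n) set set \<Rightarrow> (real^'n) set set" where
  "faces \<T> = {F. \<exists>T\<in>\<T>. F facet_of T}"

definition boundary_faces :: "(real^'n) set \<Rightarrow> (real^'n) set set \<Rightarrow> (real^'n) set set" where
  "boundary_faces \<Omega> \<T> = {F \<in> faces \<T>. F \<subseteq> frontier \<Omega>}"

definition interior_faces :: "(real^'n) set \<Rightarrow> (real^'n) set set \<Rightarrow> (real^'n) set set" where
  "interior_faces \<Omega> \<T> = faces \<T> - boundary_faces \<Omega> \<T>"

definition outer_normal :: "(real^'n) set \<Rightarrow> (real^'n) set \<Rightarrow> real^'n" where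
  "outer_normal T F = (THE n. norm n = 1 \<and> (\<exists>b. F \<subseteq> {x. n \<bullet> x = b} \<and> T \<subseteq> {x. n \<bullet> x \<le> b}))"

definition poly_le :: "nat \<Rightarrow> (real^'n \<Rightarrow> real) \<Rightarrow> bool" where
  "poly_le p P \<longleftrightarrow> (\<exists>a :: ('n \<Rightarrow> nat) \<Rightarrow> real. \<forall>x.
     P x = (\<Sum>k | sum k UNIV \<le> p. a k * (\<Prod>i\<in>UNIV. (x $ i) ^ k i)))"

text \<open>
  Discrete functions are represented by functions that are polynomial in the interior of every
  element (face); the values on the remaining null set are irrelevant, see \<open>trace_from\<close> below.
\<close>
definition Wh :: "(real^'n) set \<Rightarrow> (real^'n) set set \<Rightarrow> nat \<Rightarrow> (real^'n \<Rightarrow> real) set" where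
  "Wh \<Omega> \<T> p = {w. L2 (lebesgue_on \<Omega>) w \<and>
     (\<forall>T\<in>\<T>. \<exists>P. poly_le p P \<and> (\<forall>x\<in>interior T. w x = P x))}"

definition Vh :: "(real^'n) set \<Rightarrow> (real^'n) set set \<Rightarrow> nat \<Rightarrow> (real^'n \<Rightarrow> real^'n) set" where
  "Vh \<Omega> \<T> p = {v. L2 (lebesgue_on \<Omega>) v \<and>
     (\<forall>T\<in>\<T>. \<forall>i. \<exists>P. poly_le p P \<and> (\<forall>x\<in>interior T. v x $ i = P x))}"

definition Mh :: "(real^'n) set set \<Rightarrow> nat \<Rightarrow> (real^'n \<Rightarrow> real) set" where
  "Mh \<T> p = {\<mu>. L2 (surface_on (\<Union>(faces \<T>))) \<mu> \<and>
     (\<forall>F\<in>faces \<T>. \<exists>P. poly_le p P \<and> (\<forall>x\<in>rel_interior F. \<mu> x = P x))}"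

text \<open>The value on \<open>\<partial>T\<close> of a function that is polynomial in the interior of \<open>T\<close>.\<close>
definition trace_from :: "(real^'n) set \<Rightarrow> (real^'n \<Rightarrow> 'b::t2_space) \<Rightarrow> real^'n \<Rightarrow> 'b" where
  "trace_from T v x = Lim (at x within interior T) v"

definition proj_Wh :: "(real^'n) set \<Rightarrow> (real^'n) set set \<Rightarrow> nat \<Rightarrow> (real^'n \<Rightarrow> real) \<Rightarrow> real^'n \<Rightarrow> real" where
  "proj_Wh \<Omega> \<T> p R = (SOME P. P \<in> Wh \<Omega> \<T> p \<and>
     (\<forall>w\<in>Wh \<Omega> \<T> p. (\<integral>x. (R x - P x) * w x \<partial>lebesgue_on \<Omega>) = 0))"

definition int_mesh :: "(real^'n) set set \<Rightarrow> (real^'n \<Rightarrow> real) \<Rightarrow> real" where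
  "int_mesh \<T> \<eta> = (\<Sum>T\<in>\<T>. \<integral>x. \<eta> x \<partial>lebesgue_on T)"

text \<open>
  The integral over the boundaries of all elements without the faces inside \<open>S\<close>; the integrand may
  depend on the element and the face, as the outward normal and one-sided values do.
\<close>
definition int_bdry :: "(real^'n) set set \<Rightarrow> (real^'n) set \<Rightarrow>
    ((real^'n) set \<Rightarrow> (real^'n) set \<Rightarrow> real^'n \<Rightarrow> real) \<Rightarrow> real" where
  "int_bdry \<T> S \<eta> =
     (\<Sum>T\<in>\<T>. \<Sum>F | F facet_of T \<and> \<not> F \<subseteq> S. \<integral>x. \<eta> T F x \<partial>surface_on F)"

definition tau :: "real \<Rightarrow> real \<Rightarrow> (real^'n \<Rightarrow> real^'n) \<Rightarrow> (real^'n) set \<Rightarrow> (real^'n) set \<Rightarrow> real" where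
  "tau \<rho>\<^sub>0 \<epsilon> \<beta> T F =
     max (SUP x\<in>F. \<beta> x \<bullet> outer_normal T F) 0 + min (\<rho>\<^sub>0 * \<epsilon> / diameter T) 1"

definition num_flux :: "real \<Rightarrow> real \<Rightarrow> (real^'n \<Rightarrow> real^'n) \<Rightarrow>
    (real^'n \<Rightarrow> real^'n) \<Rightarrow> (real^'n \<Rightarrow> real) \<Rightarrow> (real^'n \<Rightarrow> real) \<Rightarrow>
    (real^'n) set \<Rightarrow> (real^'n) set \<Rightarrow> real^'n \<Rightarrow> real" where
  "num_flux \<rho>\<^sub>0 \<epsilon> \<beta> q\<^sub>h u\<^sub>h uhat T F x =
     trace_from T q\<^sub>h x \<bullet> outer_normal T F + (\<beta> x \<bullet> outer_normal T F) * uhat x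
     + tau \<rho>\<^sub>0 \<epsilon> \<beta> T F * (trace_from T u\<^sub>h x - uhat x)"

definition hdg_solution :: "(real^'n) set \<Rightarrow> (real^'n) set set \<Rightarrow> nat \<Rightarrow> real \<Rightarrow> real \<Rightarrow>
    (real^'n \<Rightarrow> real^'n) \<Rightarrow> (real^'n \<Rightarrow> real) \<Rightarrow> (real^'n \<Rightarrow> real) \<Rightarrow> (real^'n \<Rightarrow> real) \<Rightarrow>
    (real^'n \<Rightarrow> real^'n) \<Rightarrow> (real^'n \<Rightarrow> real) \<Rightarrow> (real^'n \<Rightarrow> real) \<Rightarrow> bool" where
  "hdg_solution \<Omega> \<T> p \<rho>\<^sub>0 \<epsilon> \<beta> c f g q\<^sub>h u\<^sub>h uhat \<longleftrightarrow>
     q\<^sub>h \<in> Vh \<Omega> \<T> p \<and> u\<^sub>h \<in> Wh \<Omega> \<T> p \<and> uhat \<in> Mh \<T> p \<and>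
     (\<forall>r\<in>Vh \<Omega> \<T> p.
        int_mesh \<T> (\<lambda>x. inverse \<epsilon> * (q\<^sub>h x \<bullet> r x)) - int_mesh \<T> (\<lambda>x. u\<^sub>h x * divg r x)
        + int_bdry \<T> {} (\<lambda>T F x. uhat x * (trace_from T r x \<bullet> outer_normal T F)) = 0) \<and>
     (\<forall>w\<in>Wh \<Omega> \<T> p.
        - int_mesh \<T> (\<lambda>x. (q\<^sub>h x + u\<^sub>h x *\<^sub>R \<beta> x) \<bullet> grad w x)
        + int_mesh \<T> (\<lambda>x. (c x - wdiv \<Omega> \<beta> x) * u\<^sub>h x * w x)
        + int_bdry \<T> {} (\<lambda>T F x. num_flux \<rho>\<^sub>0 \<epsilon> \<beta> q\<^sub>h u\<^sub>h uhat T F x * trace_from T w x)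
        = int_mesh \<T> (\<lambda>x. f x * w x)) \<and>
     (\<forall>\<mu>\<in>Mh \<T> p.
        (\<integral>x. uhat x * \<mu> x \<partial>surface_on (frontier \<Omega>)) = (\<integral>x. g x * \<mu> x \<partial>surface_on (frontier \<Omega>))) \<and>
     (\<forall>\<mu>\<in>Mh \<T> p.
        int_bdry \<T> (frontier \<Omega>) (\<lambda>T F x. num_flux \<rho>\<^sub>0 \<epsilon> \<beta> q\<^sub>h u\<^sub>h uhat T F x * \<mu> x) = 0)"

definition jump :: "(real^'n) set \<Rightarrow> (real^'n) set \<Rightarrow> (real^'n \<Rightarrow> real) \<Rightarrow> real^'n \<Rightarrow> real" where
  "jump Tp Tm v x = trace_from Tp v x - trace_from Tm v x"

definition normal_jump :: "(real^'n) set \<Rightarrow> (real^'n) set \<Rightarrow> (real^'n) set \<Rightarrow>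
    (real^'n \<Rightarrow> real^'n) \<Rightarrow> real^'n \<Rightarrow> real" where
  "normal_jump Tp Tm F \<sigma> x =
     trace_from Tp \<sigma> x \<bullet> outer_normal Tp F + trace_from Tm \<sigma> x \<bullet> outer_normal Tm F"

text \<open>
  The jump of \<open>v\<close>, with \<open>v \<in> H\<^sup>1\<close> on either side of the face \<open>F\<close>, is the difference of the two traces.
\<close>
definition has_jump :: "(real^'n) set \<Rightarrow> (real^'n) set \<Rightarrow> (real^'n) set \<Rightarrow>
    (real^'n \<Rightarrow> real) \<Rightarrow> (real^'n \<Rightarrow> real) \<Rightarrow> bool" where
  "has_jump Tp Tm F v j \<longleftrightarrow> (\<exists>tp tm.
     has_trace (interior Tp) F v tp \<and> has_trace (interior Tm) F v tm \<and> j = (\<lambda>x. tp x - tm x))"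

text \<open>
  The normal trace \<open>\<sigma> \<bullet> n\<close> on \<open>\<partial>T\<close> of \<open>\<sigma> \<in> H(div, T)\<close> is the functional
  \<open>\<phi> \<mapsto> \<langle>\<sigma> \<bullet> n, \<phi>\<rangle>\<close> given by Green's formula; in general it is no function.
  The jump on a face \<open>F = \<partial>Tp \<inter> \<partial>Tm\<close> is the sum of the two functionals on test functions that vanish
  on the other faces; \<open>j \<in> L\<^sup>2(F)\<close> represents it.
\<close>
definition normal_trace :: "(real^'n) set \<Rightarrow> (real^'n \<Rightarrow> real^'n) \<Rightarrow> (real^'n \<Rightarrow> real) \<Rightarrow> real" where
  "normal_trace T \<sigma> \<phi> = (\<integral>x. \<sigma> x \<bullet> grad \<phi> x + wdiv (interior T) \<sigma> x * \<phi> x \<partial>lebesgue_on T)"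

definition has_normal_jump :: "(real^'n) set \<Rightarrow> (real^'n) set \<Rightarrow> (real^'n) set \<Rightarrow>
    (real^'n \<Rightarrow> real^'n) \<Rightarrow> (real^'n \<Rightarrow> real) \<Rightarrow> bool" where
  "has_normal_jump Tp Tm F \<sigma> j \<longleftrightarrow>
     Hdiv (interior Tp) \<sigma> \<and> Hdiv (interior Tm) \<sigma> \<and> L2 (surface_on F) j \<and>
     (\<forall>\<phi>. test_fun (interior (Tp \<union> Tm)) \<phi> \<longrightarrow>
       normal_trace Tp \<sigma> \<phi> + normal_trace Tm \<sigma> \<phi> = (\<integral>x. j x * \<phi> x \<partial>surface_on F))"

definition residual :: "(real^'n \<Rightarrow> real^'n) \<Rightarrow> (real^'n \<Rightarrow> real) \<Rightarrow> (real^'n \<Rightarrow> real) \<Rightarrow>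
    (real^'n \<Rightarrow> real^'n) \<Rightarrow> (real^'n \<Rightarrow> real) \<Rightarrow> real^'n \<Rightarrow> real" where
  "residual \<beta> c f q\<^sub>h u\<^sub>h x = f x - divg q\<^sub>h x - \<beta> x \<bullet> grad u\<^sub>h x - c x * u\<^sub>h x"

definition alpha :: "real \<Rightarrow> (real^'n) set \<Rightarrow> real" where
  "alpha \<epsilon> S = min (diameter S * \<epsilon> powr (-1/2)) 1"

text \<open>
  As in \<open>tau\<close>, \<open>\<beta>\<close> is meant to be the continuous representative of a \<open>W\<^sup>1\<^sup>,\<^sup>\<infinity>\<close> field, whose
  \<open>L\<^sup>\<infinity>(F)\<close> norm is the supremum over \<open>F\<close>.
\<close>
definition gamma :: "real \<Rightarrow> (real^'n \<Rightarrow> real^'n) \<Rightarrow> (real^'n) set \<Rightarrow> real" where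
  "gamma \<epsilon> \<beta> F = (let h = diameter F; B = (SUP x\<in>F. norm (\<beta> x)) in
     min (\<epsilon> / h + (h / \<epsilon> + \<epsilon> powr (-1/2) * alpha \<epsilon> F) * B + h) ((\<epsilon> + B) / h + h))"

definition eta_elem :: "real \<Rightarrow> (real^'n \<Rightarrow> real^'n) \<Rightarrow> (real^'n \<Rightarrow> real) \<Rightarrow> (real^'n \<Rightarrow> real) \<Rightarrow>
    (real^'n \<Rightarrow> real^'n) \<Rightarrow> (real^'n \<Rightarrow> real) \<Rightarrow> (real^'n) set \<Rightarrow> real" where
  "eta_elem \<epsilon> \<beta> c f q\<^sub>h u\<^sub>h T = sqrt (
     (alpha \<epsilon> T)\<^sup>2 * (L2norm (lebesgue_on T) (residual \<beta> c f q\<^sub>h u\<^sub>h))\<^sup>2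
     + inverse \<epsilon> * (L2norm (lebesgue_on T) (\<lambda>x. q\<^sub>h x + \<epsilon> *\<^sub>R grad u\<^sub>h x))\<^sup>2)"

definition eta_int :: "real \<Rightarrow> (real^'n \<Rightarrow> real^'n) \<Rightarrow> (real^'n \<Rightarrow> real^'n) \<Rightarrow> (real^'n \<Rightarrow> real) \<Rightarrow>
    (real^'n) set \<Rightarrow> (real^'n) set \<Rightarrow> (real^'n) set \<Rightarrow> real" where
  "eta_int \<epsilon> \<beta> q\<^sub>h u\<^sub>h Tp Tm F = sqrt (
     \<epsilon> powr (-1/2) * alpha \<epsilon> F * (L2norm (surface_on F) (normal_jump Tp Tm F q\<^sub>h))\<^sup>2
     + gamma \<epsilon> \<beta> F * (L2norm (surface_on F) (jump Tp Tm u\<^sub>h))\<^sup>2)"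

definition eta_bdry :: "real \<Rightarrow> (real^'n \<Rightarrow> real^'n) \<Rightarrow> (real^'n \<Rightarrow> real) \<Rightarrow> (real^'n \<Rightarrow> real) \<Rightarrow>
    (real^'n) set \<Rightarrow> (real^'n) set \<Rightarrow> real" where
  "eta_bdry \<epsilon> \<beta> g u\<^sub>h T F =
     sqrt (gamma \<epsilon> \<beta> F) * L2norm (surface_on F) (\<lambda>x. trace_from T u\<^sub>h x - g x)"

definition osc :: "(real^'n) set \<Rightarrow> (real^'n) set set \<Rightarrow> nat \<Rightarrow> real \<Rightarrow> (real^'n \<Rightarrow> real) \<Rightarrow>
    (real^'n) set \<Rightarrow> real" where
  "osc \<Omega> \<T> p \<epsilon> R T = alpha \<epsilon> T * L2norm (lebesgue_on T) (\<lambda>x. R x - proj_Wh \<Omega> \<T> p R x)"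

end

theory Submission
  imports Defs
begin

text \<open>
  The first two estimates are equalities. For a boundary face both sides contain the same norm. For
  an interior face, \<open>u \<in> H\<^sup>1(\<Omega>)\<close> and \<open>q = - \<epsilon> \<nabla>u \<in> H(div, \<Omega>)\<close> have no jumps, so that the jumps of the
  errors are the negatives of the jumps of the discrete functions (\<open>jump_of_error\<close>,
  \<open>normal_jump_of_error\<close>).
  
  For an element \<open>T\<close>, testing the weak formulation with smooth functions of compact support yields
  \<open>div q + \<beta> \<bullet> \<nabla>u + c u = f\<close> almost everywhere (\<open>weak_solution_weak_div\<close>). Hence
  \<open>R\<^sub>h = div (q - q\<^sub>h) + \<beta> \<bullet> \<nabla>(u - u\<^sub>h) + c (u - u\<^sub>h)\<close> and
  \<open>q\<^sub>h + \<epsilon> \<nabla>u\<^sub>h = - (q - q\<^sub>h) - \<epsilon> \<nabla>(u - u\<^sub>h)\<close> on \<open>T\<close>, and the triangle inequality concludes: since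
  \<open>\<alpha>\<^sub>T \<le> 1\<close>, the constant \<open>\<surd>(2 (1 + K\<^sup>2))\<close> with a bound \<open>K\<close> of \<open>\<bar>c\<bar>\<close> suffices. In other words, the
  residual of the discrete solution is itself one of the error terms, up to \<open>c (u - u\<^sub>h)\<close>.
  
  The substance lies in these pointwise identities, because weak derivatives, traces and normal
  traces are known only through their action on test functions. Two tools provide them.
  The first is the fundamental lemma of the calculus of variations, for an arbitrary Borel measure
  (\<open>fundamental_lemma\<close>); it serves volumes and faces alike. Bump functions that converge to indicator
  functions of boxes are built from \<open>exp (- 1 / s)\<close>.
  The second is Green's formula. A test function \<open>\<theta>\<close> supported in the interior of the union of two
  elements with the common face \<open>F\<close> sees of either element only a half space bounded by the
  hyperplane of \<open>F\<close>. For half spaces the formula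
  follows from Fubini's theorem along the lines orthogonal to the hyperplane
  (\<open>distr_hyperplane_fibres\<close>, \<open>integral_grad_halfspace\<close>), and passing to the limit carries it over to
  traces (\<open>green_trace\<close>).
\<close>

section \<open>Smooth functions and test functions\<close>

text \<open>
  The functions \<open>exp (- 1 / s) / s ^ m\<close>, continued by zero. Unlike \<open>exp (- 1 / s)\<close> alone they form a
  family whose linear span is closed under differentiation, which the coinductive notion of
  smoothness asks for.
\<close>
definition flat :: "nat \<Rightarrow> real \<Rightarrow> real" where
  "flat m s = (if s > 0 then exp (- (1 / s)) / s ^ m else 0)"

lemma flat_tendsto_0: "(flat m \<longlongrightarrow> 0) (at 0)"
proof -
  have r: "(flat m \<longlongrightarrow> 0) (at_right 0)"
  proof -
    have "((\<lambda>y::real. y ^ m / exp y) \<longlongrightarrow> 0) at_top"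
      by (rule tendsto_power_div_exp_0)
    then have "((\<lambda>s::real. (inverse s) ^ m / exp (inverse s)) \<longlongrightarrow> 0) (at_right 0)"
      using filterlim_inverse_at_top_right by (rule filterlim_compose)
    moreover have "\<forall>\<^sub>F s::real in at_right 0. (inverse s) ^ m / exp (inverse s) = flat m s"
      unfolding eventually_at_filter
      by (rule always_eventually) (simp add: flat_def exp_minus field_simps power_inverse)
    ultimately show ?thesis by (rule Lim_transform_eventually)
  qed
  have l: "(flat m \<longlongrightarrow> 0) (at_left 0)"
    by (rule Lim_transform_eventually[OF tendsto_const[of 0]])
      (auto simp: eventually_at_filter flat_def)
  from l r show ?thesis by (simp add: filterlim_at_split)
qed

lemma flat_deriv: "(flat m has_real_derivative flat (m + 2) s - real m * flat (m + 1) s) (at s)"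
proof -
  consider "s > 0" | "s < 0" | "s = 0" by linarith
  then show ?thesis
  proof cases
    case 1
    have "((\<lambda>s. exp (- (1 / s)) / s ^ m) has_real_derivative flat (m + 2) s - real m * flat (m + 1) s) (at s)"
      using 1
      by (auto intro!: derivative_eq_intros simp: flat_def)
        (cases m; simp add: field_simps power2_eq_square power_add)
    then show ?thesis
      by (rule has_field_derivative_transform_within_open[where S = "{0<..}"])
        (use 1 in \<open>auto simp: flat_def\<close>)
  next
    case 2
    have "((\<lambda>s. 0) has_real_derivative flat (m + 2) s - real m * flat (m + 1) s) (at s)"
      using 2 by (auto simp: flat_def)
    then show ?thesis
      by (rule has_field_derivative_transform_within_open[where S = "{..<0}"])
        (use 2 in \<open>auto simp: flat_def\<close>)
  next
    case 3
    have "((\<lambda>h. (flat m (0 + h) - flat m 0) / h) \<longlongrightarrow> 0) (at 0)"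
      by (rule Lim_transform_eventually[OF flat_tendsto_0[of "m + 1"]])
        (auto simp: eventually_at_filter flat_def)
    then show ?thesis
      using 3 by (simp add: DERIV_def flat_def)
  qed
qed

lemma smoothE:
  assumes "smooth f"
  obtains f' where "\<And>x. (f has_derivative f' x) (at x)" "\<And>v. smooth (\<lambda>x. f' x v)"
  proof -
  from assms show thesis
    by (cases rule: smooth.cases) (rule that)
qed

text \<open>
  All closure properties of \<open>smooth\<close> at once: the expressions below are differentiable with
  directional derivatives that are again such expressions, so that a single coinduction shows them
  to be smooth. Doing sums, products and compositions one by one would need a separate
  generalisation for each coinduction.
\<close>
inductive smooth_expr :: "('a::euclidean_space \<Rightarrow> real) \<Rightarrow> bool" where
  smooth: "smooth f \<Longrightarrow> smooth_expr f"
| const: "smooth_expr (\<lambda>x. r)"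
| inner: "smooth_expr (\<lambda>x. x \<bullet> v)"
| add: "smooth_expr f \<Longrightarrow> smooth_expr g \<Longrightarrow> smooth_expr (\<lambda>x. f x + g x)"
| mult: "smooth_expr f \<Longrightarrow> smooth_expr g \<Longrightarrow> smooth_expr (\<lambda>x. f x * g x)"
| flat_comp: "smooth_expr f \<Longrightarrow> smooth_expr (\<lambda>x. flat m (f x))"

lemma smooth_expr_deriv:
  assumes "smooth_expr f"
  shows "\<exists>f'. (\<forall>x. (f has_derivative f' x) (at x)) \<and> (\<forall>v. smooth_expr (\<lambda>x. f' x v))"
  using assms
proof induction
  case (smooth f)
  then show ?case by (metis smoothE smooth_expr.smooth)
next
  case (const r)
  then show ?case
    by (intro exI[of _ "\<lambda>x v. 0"]) (auto intro: smooth_expr.const)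
next
  case (inner w)
  then show ?case
    by (intro exI[of _ "\<lambda>x v. v \<bullet> w"])
      (auto intro!: smooth_expr.const bounded_linear_imp_has_derivative bounded_linear_inner_left)
next
  case (add f g)
  then obtain f' g' where "\<And>x. (f has_derivative f' x) (at x)" "\<And>v. smooth_expr (\<lambda>x. f' x v)"
    "\<And>x. (g has_derivative g' x) (at x)" "\<And>v. smooth_expr (\<lambda>x. g' x v)" by auto
  then show ?case
    by (intro exI[of _ "\<lambda>x v. f' x v + g' x v"])
      (auto intro!: has_derivative_add smooth_expr.add)
next
  case (mult f g)
  then obtain f' g' where "\<And>x. (f has_derivative f' x) (at x)" "\<And>v. smooth_expr (\<lambda>x. f' x v)"
    "\<And>x. (g has_derivative g' x) (at x)" "\<And>v. smooth_expr (\<lambda>x. g' x v)" by auto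
  with mult.hyps show ?case
    by (intro exI[of _ "\<lambda>x v. f x * g' x v + f' x v * g x"])
      (auto intro!: has_derivative_mult smooth_expr.add smooth_expr.mult)
next
  case (flat_comp f m)
  then obtain f' where f': "\<And>x. (f has_derivative f' x) (at x)" "\<And>v. smooth_expr (\<lambda>x. f' x v)"
    by auto
  let ?d = "\<lambda>s. flat (m + 2) s + (- real m) * flat (m + 1) s"
  have "((\<lambda>x. flat m (f x)) has_derivative (\<lambda>v. f' x v * ?d (f x))) (at x)" for x
    using DERIV_compose_FDERIV[OF flat_deriv f'(1)] by (simp add: algebra_simps)
  moreover have "smooth_expr (\<lambda>x. f' x v * ?d (f x))" for v
    by (intro smooth_expr.intros f'(2) flat_comp.hyps)
  ultimately show ?case
    by (intro exI[of _ "\<lambda>x v. f' x v * ?d (f x)"]) simp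
qed

lemma smooth_iff_smooth_expr: "smooth f \<longleftrightarrow> smooth_expr f"
proof
  assume "smooth_expr f"
  then show "smooth f"
  proof (coinduction arbitrary: f)
    case smooth
    then show ?case using smooth_expr_deriv[of f] by blast
  qed
qed (rule smooth_expr.smooth)

lemma
  shows smooth_const: "smooth (\<lambda>x::'a::euclidean_space. r)"
    and smooth_inner: "smooth (\<lambda>x::'a. x \<bullet> v)"
    and smooth_add: "smooth f \<Longrightarrow> smooth g \<Longrightarrow> smooth (\<lambda>x::'a. f x + g x)"
    and smooth_mult: "smooth f \<Longrightarrow> smooth g \<Longrightarrow> smooth (\<lambda>x::'a. f x * g x)"
    and smooth_flat: "smooth f \<Longrightarrow> smooth (\<lambda>x::'a. flat m (f x))"
  unfolding smooth_iff_smooth_expr by (auto intro: smooth_expr.intros)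

lemma smooth_sum:
  assumes "\<And>i. i \<in> I \<Longrightarrow> smooth (f i)"
  shows "smooth (\<lambda>x::'a::euclidean_space. \<Sum>i\<in>I. f i x)"
  using assms by (induction I rule: infinite_finite_induct)
    (simp_all add: smooth_const smooth_add smooth_mult)

lemma smooth_prod:
  assumes "\<And>i. i \<in> I \<Longrightarrow> smooth (f i)"
  shows "smooth (\<lambda>x::'a::euclidean_space. \<Prod>i\<in>I. f i x)"
  using assms by (induction I rule: infinite_finite_induct)
    (simp_all add: smooth_const smooth_add smooth_mult)

lemma smooth_power: "smooth f \<Longrightarrow> smooth (\<lambda>x::'a::euclidean_space. f x ^ m)"
  by (induction m) (simp_all add: smooth_const smooth_mult)

lemma smooth_nth: "smooth (\<lambda>x::real^'n. x $ i)"
  using smooth_inner[of "axis i (1::real)"] by (simp add: inner_axis)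

lemma smooth_has_derivative_frechet:
  "smooth f \<Longrightarrow> (f has_derivative frechet_derivative f (at x)) (at x)"
  by (erule smoothE) (metis frechet_derivative_at)

lemma smooth_frechet_derivative:
  assumes "smooth f" shows "smooth (\<lambda>x. frechet_derivative f (at x) v)"
proof -
  obtain f' where f': "\<And>x. (f has_derivative f' x) (at x)" "\<And>v. smooth (\<lambda>x. f' x v)"
    by (rule smoothE[OF assms]) blast
  have "frechet_derivative f (at x) = f' x" for x
    using frechet_derivative_at[OF f'(1)] by simp
  with f'(2) show ?thesis by simp
qed

lemma has_derivative_grad:
  assumes "f differentiable at x"
  shows "(f has_derivative (\<lambda>v. grad f x \<bullet> v)) (at x)"
proof -
  have D: "(f has_derivative frechet_derivative f (at x)) (at x)"
    using assms by (simp add: frechet_derivative_works)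
  have "frechet_derivative f (at x) v = grad f x \<bullet> v" for v
  proof -
    interpret linear "frechet_derivative f (at x)"
      using D has_derivative_linear by blast
    have "frechet_derivative f (at x) v = frechet_derivative f (at x) (\<Sum>i\<in>UNIV. v $ i *\<^sub>R axis i 1)"
      by (metis scalar_mult_eq_scaleR basis_expansion)
    also have "\<dots> = (\<Sum>i\<in>UNIV. v $ i * frechet_derivative f (at x) (axis i 1))"
      by (simp add: sum scaleR)
    finally show ?thesis by (simp add: grad_def inner_vec_def mult.commute)
  qed
  then have "frechet_derivative f (at x) = (\<lambda>v. grad f x \<bullet> v)" by (rule ext)
  with D show ?thesis by simp
qed

lemma grad_eqI:
  assumes "(f has_derivative (\<lambda>v. G \<bullet> v)) (at x)"
  shows "grad f x = G"
  using frechet_derivative_at[OF assms, symmetric] by (simp add: grad_def vec_eq_iff inner_axis)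

lemma smooth_differentiable: "smooth f \<Longrightarrow> f differentiable at x"
  using smooth_has_derivative_frechet differentiableI by blast

lemma smooth_has_derivative: "smooth f \<Longrightarrow> (f has_derivative (\<lambda>v. grad f x \<bullet> v)) (at x)"
  by (simp add: has_derivative_grad smooth_differentiable)

lemma smooth_grad_nth: "smooth f \<Longrightarrow> smooth (\<lambda>x. grad f x $ i)"
  by (simp add: grad_def smooth_frechet_derivative)

lemma smooth_grad_inner:
  assumes "smooth f" shows "smooth (\<lambda>x. grad f x \<bullet> v)"
proof -
  have "smooth (\<lambda>x. \<Sum>i\<in>UNIV. grad f x $ i * v $ i)"
    by (intro smooth_sum smooth_mult smooth_grad_nth assms smooth_const)
  then show ?thesis by (simp add: inner_vec_def)
qed

lemma smooth_continuous: "smooth f \<Longrightarrow> continuous_on A f"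
  by (intro continuous_at_imp_continuous_on ballI
      has_derivative_continuous[OF smooth_has_derivative_frechet])

lemma continuous_on_grad: "smooth f \<Longrightarrow> continuous_on A (grad f)"
  unfolding grad_def
  by (intro continuous_on_vec_lambda smooth_continuous smooth_frechet_derivative)

lemma grad_mult:
  assumes "smooth f" "smooth g"
  shows "grad (\<lambda>x. f x * g x) x = f x *\<^sub>R grad g x + g x *\<^sub>R grad f x"
  by (rule grad_eqI, rule has_derivative_eq_rhs,
      rule has_derivative_mult[OF smooth_has_derivative[OF assms(1)] smooth_has_derivative[OF assms(2)]])
    (auto simp: inner_add_left)

lemma poly_le_smooth: "poly_le p P \<Longrightarrow> smooth P"
proof -
  assume "poly_le p P"
  then obtain a where "P = (\<lambda>x. \<Sum>k | sum k UNIV \<le> p. a k * (\<Prod>i\<in>UNIV. (x $ i) ^ k i))"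
    by (auto simp: poly_le_def)
  then show "smooth P"
    by (simp only:) (intro smooth_sum smooth_mult smooth_prod smooth_power smooth_const smooth_nth)
qed

text \<open>
  At a point of the box the arguments of \<open>flat 0\<close> tend to infinity with \<open>k\<close>, where \<open>flat 0\<close> tends to
  \<open>1\<close>; outside, a factor vanishes. The indicator function of the box is thus a bounded pointwise
  limit of test functions, as dominated convergence requires.
\<close>
definition box_bump :: "real^'n \<Rightarrow> real^'n \<Rightarrow> nat \<Rightarrow> real^'n \<Rightarrow> real" where
  "box_bump a b k x = (\<Prod>i\<in>UNIV. flat 0 (real (Suc k) * (x $ i - a $ i)) * flat 0 (real (Suc k) * (b $ i - x $ i)))"

lemma smooth_box_bump: "smooth (box_bump a b k)"
proof -
  have lin: "smooth (\<lambda>x::real^'n. r * (x $ i - s))" for r s i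
  proof -
    have "smooth (\<lambda>x::real^'n. r * (x $ i + (- s)))" by (intro smooth_mult smooth_add smooth_const smooth_nth)
    then show ?thesis by simp
  qed
  have lin': "smooth (\<lambda>x::real^'n. r * (s - x $ i))" for r s i
  proof -
    have "smooth (\<lambda>x::real^'n. r * (s + (-1) * x $ i))" by (intro smooth_mult smooth_add smooth_const smooth_nth)
    then show ?thesis by simp
  qed
  show ?thesis
    unfolding box_bump_def[abs_def]
    by (intro smooth_prod smooth_mult smooth_flat lin lin')
qed

lemma flat_0_bounds: "0 \<le> flat 0 s" "flat 0 s \<le> 1" by (auto simp: flat_def)

lemma flat_0_eq_0_iff: "flat 0 s = 0 \<longleftrightarrow> s \<le> 0" by (auto simp: flat_def)

lemma box_bump_eq_0_iff: "box_bump a b k x = 0 \<longleftrightarrow> x \<notin> box a b"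
  by (auto simp: box_bump_def flat_0_eq_0_iff mem_box_cart mult_le_0_iff not_less)

lemma box_bump_bounds: "0 \<le> box_bump a b k x" "box_bump a b k x \<le> 1"
  unfolding box_bump_def
  by (intro prod_nonneg prod_le_1 ballI conjI mult_nonneg_nonneg mult_le_one flat_0_bounds)+

lemma box_bump_tendsto:
  fixes a b :: "real^'n"
  shows "(\<lambda>k. box_bump a b k x) \<longlonglongrightarrow> indicator (box a b) x"
proof (cases "x \<in> box a b")
  case True
  have lim: "(\<lambda>k. flat 0 (real (Suc k) * s)) \<longlonglongrightarrow> 1" if "s > 0" for s
  proof -
    have "(\<lambda>k. exp (- (inverse s * inverse (real (Suc k))))) \<longlonglongrightarrow> exp (- (inverse s * 0))"
      by (intro tendsto_intros LIMSEQ_inverse_real_of_nat)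
    moreover have "exp (- (inverse s * inverse (real (Suc k)))) = flat 0 (real (Suc k) * s)" for k
      using that by (simp add: flat_def field_simps add_pos_nonneg)
    ultimately show ?thesis by simp
  qed
  have "(\<lambda>k. box_bump a b k x) \<longlonglongrightarrow> (\<Prod>i\<in>(UNIV::'n set). 1 * 1)"
    unfolding box_bump_def
    by (intro tendsto_prod tendsto_mult lim) (use True in \<open>auto simp: mem_box_cart\<close>)
  with True show ?thesis by simp
next
  case False
  then show ?thesis using box_bump_eq_0_iff[of a b _ x] by auto
qed

lemma test_fun_box_bump:
  assumes "cbox a b \<subseteq> D"
  shows "test_fun D (box_bump a b k)"
proof -
  have sub: "closure {x. box_bump a b k x \<noteq> 0} \<subseteq> cbox a b"
    by (rule closure_minimal) (use box_subset_cbox in \<open>auto simp: box_bump_eq_0_iff\<close>)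
  have "compact (closure {x. box_bump a b k x \<noteq> 0})"
    using bounded_subset[OF bounded_cbox sub] by (simp add: compact_eq_bounded_closed)
  moreover have "closure {x. box_bump a b k x \<noteq> 0} \<subseteq> D"
    using sub assms by (rule subset_trans)
  ultimately show ?thesis
    using smooth_box_bump[of a b k] unfolding test_fun_def by simp
qed

lemma test_fun_smooth: "test_fun D \<phi> \<Longrightarrow> smooth \<phi>"
  by (simp add: test_fun_def)

lemma test_fun_mono: "test_fun D \<phi> \<Longrightarrow> D \<subseteq> E \<Longrightarrow> test_fun E \<phi>"
  by (auto simp: test_fun_def)

lemma test_fun_mult:
  fixes \<phi> :: "'a::euclidean_space \<Rightarrow> real"
  assumes "smooth w" "test_fun D \<phi>"
  shows "test_fun D (\<lambda>x. w x * \<phi> x)"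
proof -
  have sub: "closure {x. w x * \<phi> x \<noteq> 0} \<subseteq> closure {x. \<phi> x \<noteq> 0}"
    by (rule closure_mono) auto
  have "bounded (closure {x. \<phi> x \<noteq> 0})"
    using assms by (simp add: test_fun_def compact_imp_bounded)
  then have "compact (closure {x. w x * \<phi> x \<noteq> 0})"
    using bounded_subset[OF _ sub] by (simp add: compact_eq_bounded_closed)
  moreover have "smooth (\<lambda>x. w x * \<phi> x)"
    by (rule smooth_mult) (use assms in \<open>simp_all add: test_fun_def\<close>)
  moreover have "closure {x. w x * \<phi> x \<noteq> 0} \<subseteq> D"
    by (rule subset_trans[OF sub]) (use assms in \<open>simp add: test_fun_def\<close>)
  ultimately show ?thesis
    unfolding test_fun_def by simp
qed

text \<open>
  The gradient vanishes as well, since the complement of the support is open.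
\<close>
lemma outside_support:
  assumes "x \<notin> closure {x. \<phi> x \<noteq> 0}"
  shows "\<phi> x = 0" "grad \<phi> x = 0"
proof -
  define S where "S = - closure {x. \<phi> x \<noteq> 0}"
  have S: "open S" "x \<in> S" using assms by (auto simp: S_def)
  have 0: "\<phi> y = 0" if "y \<in> S" for y
    using that closure_subset[of "{x. \<phi> x \<noteq> 0}"] unfolding S_def by blast
  show "\<phi> x = 0" using 0[OF S(2)] .
  have "((\<lambda>x. 0) has_derivative (\<lambda>v. 0 \<bullet> v)) (at x)" by simp
  then have "(\<phi> has_derivative (\<lambda>v. 0 \<bullet> v)) (at x)"
    by (rule has_derivative_transform_within_open[OF _ S]) (simp add: 0)
  then show "grad \<phi> x = 0" by (rule grad_eqI)
qed

lemma test_fun_outside: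
  assumes "test_fun D \<phi>" "x \<notin> D"
  shows "\<phi> x = 0" "grad \<phi> x = 0"
proof -
  have "x \<notin> closure {x. \<phi> x \<noteq> 0}" using assms unfolding test_fun_def by blast
  then show "\<phi> x = 0" "grad \<phi> x = 0" by (rule outside_support)+
qed

section \<open>The fundamental lemma of the calculus of variations\<close>

lemma AE_zero_if_set_integrals_zero:
  fixes f :: "'a \<Rightarrow> real"
  assumes f: "integrable M f" and zero: "\<And>A. A \<in> sets M \<Longrightarrow> (\<integral>x. indicator A x * f x \<partial>M) = 0"
  shows "AE x in M. f x = 0"
proof -
  note [measurable] = borel_measurable_integrable[OF f]
  have part: "AE x in M. indicator A x * f x = 0"
    if A: "A \<in> sets M" and nonneg: "\<And>x. s * (indicator A x * f x) \<ge> 0" and s: "s \<noteq> (0::real)" for A s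
  proof -
    have "integrable M (\<lambda>x. indicator A x * f x)"
      using integrable_mult_indicator[OF A f] by simp
    then have "AE x in M. s * (indicator A x * f x) = 0"
      using zero[OF A] nonneg by (subst integral_nonneg_eq_0_iff_AE[symmetric]) auto
    then show ?thesis using s by simp
  qed
  \<comment> \<open>\<open>f\<close> has constant sign on either of the sets where it is positive and negative\<close>
  have "AE x in M. indicator {x\<in>space M. f x > 0} x * f x = 0"
    by (rule part[where s = 1]) (auto simp: indicator_def)
  moreover have "AE x in M. x \<in> space M" by simp
  moreover have "AE x in M. indicator {x\<in>space M. f x < 0} x * f x = 0"
    by (rule part[where s = "-1"]) (auto simp: indicator_def)
  ultimately show ?thesis
    by eventually_elim (auto simp: indicator_def split: if_splits)
qed

text \<open>
  Boxes form an intersection-stable generator of the Borel sets, so the integrals over all Borel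
  sets vanish.
\<close>
lemma AE_zero_if_box_integrals_zero:
  fixes f :: "'a::euclidean_space \<Rightarrow> real"
  assumes M: "sets M = sets borel" and f: "integrable M f"
    and supp: "\<And>x. x \<notin> box a b \<Longrightarrow> f x = 0"
    and zero: "\<And>c d. (\<integral>x. indicator (box c d) x * f x \<partial>M) = 0"
  shows "AE x in M. f x = 0"
proof (rule AE_zero_if_set_integrals_zero[OF f])
  fix A assume A: "A \<in> sets M"
  have sp: "space M = UNIV" using sets_eq_imp_space_eq[OF M] by simp
  have all: "(\<integral>x. f x \<partial>M) = 0"
  proof -
    have "(\<lambda>x. indicator (box a b) x * f x) = f"
      using supp by (intro ext) (metis indicator_simps mult_1 mult_zero_right)
    then show ?thesis using zero[of a b] by metis
  qed
  have int: "integrable M (\<lambda>x. indicator A x * f x)" if "A \<in> sets borel" for A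
    using integrable_mult_indicator[of A M f] f M that by simp
  have ss: "sets borel = sigma_sets UNIV (range (\<lambda>(a, b). box a b :: 'a set))"
    by (simp add: borel_eq_box)
  have "Int_stable (range (\<lambda>(a, b). box a b :: 'a set))"
    by (auto simp: Int_stable_def box_Int_box)
  moreover have "range (\<lambda>(a, b). box a b :: 'a set) \<subseteq> Pow UNIV" by simp
  moreover from A M have "A \<in> sigma_sets UNIV (range (\<lambda>(a, b). box a b :: 'a set))"
    by (simp add: ss)
  ultimately show "(\<integral>x. indicator A x * f x \<partial>M) = 0"
  proof (induction rule: sigma_sets_induct_disjoint)
    case (basic A)
    then show ?case using zero by auto
  next
    case empty
    then show ?case by simp
  next
    case (compl A)
    then have "A \<in> sets borel" by (simp add: ss)
    have "(\<integral>x. indicator (UNIV - A) x * f x \<partial>M) = (\<integral>x. f x - indicator A x * f x \<partial>M)"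
      by (rule Bochner_Integration.integral_cong) (auto simp: indicator_def)
    also have "\<dots> = 0"
      using compl int[OF \<open>A \<in> sets borel\<close>] f all by (subst Bochner_Integration.integral_diff) auto
    finally show ?case .
  next
    case (union A)
    then have A: "\<And>i. A i \<in> sets M" by (simp add: ss M image_subset_iff)
    have "set_integrable M (\<Union>i. A i) f"
      unfolding set_integrable_def using A by (intro integrable_mult_indicator f) auto
    then have "(LINT x:(\<Union>i. A i)|M. f x) = (\<Sum>i. LINT x:A i|M. f x)"
      using A union by (intro lebesgue_integral_countable_add) (auto simp: disjoint_family_on_def)
    then show ?case using union by (simp add: set_lebesgue_integral_def)
  qed
qed

text \<open>
  By dominated convergence along \<open>box_bump\<close>, the integral of \<open>h\<close> over every box with closure in \<open>D\<close>
  vanishes; countably many of these boxes cover \<open>D\<close>. The measure is arbitrary in order to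
  apply the lemma both to the volume and to the surface measure of a face.
\<close>
lemma fundamental_lemma:
  fixes h :: "real^'n \<Rightarrow> real"
  assumes M: "sets M = sets borel" and D: "open D" and h[measurable]: "h \<in> borel_measurable borel"
    and int: "\<And>a b. cbox a b \<subseteq> D \<Longrightarrow> integrable M (\<lambda>x. indicator (cbox a b) x * h x)"
    and zero: "\<And>\<phi>. test_fun D \<phi> \<Longrightarrow> (\<integral>x. h x * \<phi> x \<partial>M) = 0"
  shows "AE x in M. x \<in> D \<longrightarrow> h x = 0"
proof -
  have [measurable_cong]: "sets M = sets borel" by fact
  have box0: "(\<integral>x. indicator (box a b) x * h x \<partial>M) = 0" if "cbox a b \<subseteq> D" for a b
  proof (rule LIMSEQ_unique)
    have [measurable]: "box_bump a b k \<in> borel_measurable borel" for k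
      by (rule borel_measurable_continuous_onI) (rule smooth_continuous[OF smooth_box_bump])
    show "(\<lambda>k. \<integral>x. h x * box_bump a b k x \<partial>M) \<longlonglongrightarrow> (\<integral>x. indicator (box a b) x * h x \<partial>M)"
    proof (rule integral_dominated_convergence[where w = "\<lambda>x. norm (indicator (cbox a b) x * h x)"])
      show "integrable M (\<lambda>x. norm (indicator (cbox a b) x * h x))"
        using int[OF that] by (rule integrable_norm)
      show "AE x in M. (\<lambda>k. h x * box_bump a b k x) \<longlonglongrightarrow> indicator (box a b) x * h x"
        using tendsto_mult[OF tendsto_const box_bump_tendsto[of a b]] by (simp add: mult.commute)
      show "AE x in M. norm (h x * box_bump a b k x) \<le> norm (indicator (cbox a b) x * h x)" for k
      proof (rule AE_I2)
        fix x
        show "norm (h x * box_bump a b k x) \<le> norm (indicator (cbox a b) x * h x)"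
        proof (cases "x \<in> box a b")
          case True
          then have "x \<in> cbox a b" using box_subset_cbox by blast
          moreover have "\<bar>h x\<bar> * \<bar>box_bump a b k x\<bar> \<le> \<bar>h x\<bar> * 1"
            by (rule mult_left_mono) (simp_all add: box_bump_bounds)
          ultimately show ?thesis by (simp add: abs_mult)
        next
          case False
          then show ?thesis using box_bump_eq_0_iff[of a b k x] by simp
        qed
      qed
    qed measurable
    have "(\<integral>x. h x * box_bump a b k x \<partial>M) = 0" for k
      by (rule zero) (rule test_fun_box_bump[OF that])
    then show "(\<lambda>k. \<integral>x. h x * box_bump a b k x \<partial>M) \<longlonglongrightarrow> 0" by simp
  qed
  have AEbox: "AE x in M. x \<in> box a b \<longrightarrow> h x = 0" if ab: "cbox a b \<subseteq> D" for a b
  proof -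
    have eq: "indicator (box a b) x *\<^sub>R (indicator (cbox a b) x * h x) = indicator (box a b) x * h x" for x
      using box_subset_cbox[of a b] by (auto simp: indicator_def)
    have "integrable M (\<lambda>x. indicator (box a b) x *\<^sub>R (indicator (cbox a b) x * h x))"
      by (rule integrable_mult_indicator) (use int[OF ab] in auto)
    then have "integrable M (\<lambda>x. indicator (box a b) x * h x)" unfolding eq .
    then have "AE x in M. indicator (box a b) x * h x = 0"
    proof (rule AE_zero_if_box_integrals_zero[OF M, where a = a and b = b])
      fix c d
      obtain c' d' where cd: "box c d \<inter> box a b = box c' d'"
        by (rule that[OF box_Int_box])
      have "cbox c' d' \<subseteq> D \<or> box c' d' = {}"
      proof (cases "box c' d' = {}")
        case False
        have "cbox c' d' = closure (box c' d')" using False by (simp add: closure_box)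
        also have "\<dots> \<subseteq> closure (box a b)" using cd by (intro closure_mono) auto
        also have "\<dots> \<subseteq> cbox a b" by (rule closure_minimal) (auto simp: box_subset_cbox)
        finally show ?thesis using ab by blast
      qed simp
      then have "(\<integral>x. indicator (box c' d') x * h x \<partial>M) = 0"
        using box0[of c' d'] by auto
      moreover have "indicator (box c' d') x * h x = indicator (box c d) x * (indicator (box a b) x * h x)" for x
        unfolding cd[symmetric] by (simp add: indicator_inter_arith)
      ultimately show "(\<integral>x. indicator (box c d) x * (indicator (box a b) x * h x) \<partial>M) = 0" by simp
    qed auto
    then show ?thesis by eventually_elim (auto simp: indicator_def)
  qed
  define \<F> where "\<F> = {box a b |a b. cbox a b \<subseteq> D}"
  obtain \<D> where \<D>: "\<D> \<subseteq> \<F>" "countable \<D>" "\<Union>\<D> = \<Union>\<F>"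
    by (rule Lindelof[of \<F>]) (auto simp: \<F>_def open_box)
  have "D \<subseteq> \<Union>\<F>"
  proof
    fix x assume "x \<in> D"
    with D obtain a b where "x \<in> box a b" "cbox a b \<subseteq> D"
      by (meson open_contains_cbox)
    then show "x \<in> \<Union>\<F>" by (auto simp: \<F>_def)
  qed
  moreover have "AE x in M. \<forall>B\<in>\<D>. x \<in> B \<longrightarrow> h x = 0"
    using \<D>(1,2) AEbox by (subst AE_ball_countable) (auto simp: \<F>_def)
  ultimately show ?thesis
    by (auto simp: \<D>(3)[symmetric] elim!: eventually_mono)
qed

section \<open>Fubini along the normals of a hyperplane and Green's formula on half spaces\<close>

lemma sets_hyperplane_measure [simp, measurable_cong]: "sets (hyperplane_measure n b) = sets borel"
  by (simp add: hyperplane_measure_def)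

lemma space_hyperplane_measure [simp]: "space (hyperplane_measure n b) = UNIV"
  by (simp add: hyperplane_measure_def)

lemma foot_in_hyperplane:
  fixes n :: "'a::euclidean_space"
  assumes "norm n = 1" shows "n \<bullet> (x - (n \<bullet> x - b) *\<^sub>R n) = b"
  using assms by (simp add: inner_diff_right dot_square_norm)

lemma AE_hyperplane_measure:
  fixes n :: "'a::euclidean_space"
  assumes "norm n = 1" shows "AE x in hyperplane_measure n b. n \<bullet> x = b"
  unfolding hyperplane_measure_def
  by (subst AE_distr_iff) (auto simp: foot_in_hyperplane[OF assms] intro!: measurable_restrict_space1)

text \<open>
  Every point is \<open>y + t n\<close> with a unique foot \<open>y\<close> in the hyperplane and \<open>t \<in> \<real>\<close>, and the volume is the
  product of the hyperplane measure and the length. In terms of the slab \<open>S\<close> of height one that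
  defines the hyperplane measure, shifting \<open>t\<close> turns the left-hand side into the integral of
  \<open>1\<^sub>A(x + t n) 1\<^sub>S(x)\<close> over \<open>x\<close> and \<open>t\<close>, shifting \<open>x\<close> turns this into the integral of
  \<open>1\<^sub>A(x) 1\<^sub>S(x - t n)\<close>, and for fixed \<open>x\<close> the values \<open>t\<close> with \<open>x - t n \<in> S\<close> form an interval of length one.
\<close>
lemma distr_hyperplane_fibres:
  fixes n :: "'a::euclidean_space"
  assumes n: "norm n = 1"
  shows "distr (restrict_space lborel {x. b \<le> n \<bullet> x \<and> n \<bullet> x \<le> b + 1} \<Otimes>\<^sub>M lborel) borel
      (\<lambda>(x, t). x - (n \<bullet> x - b) *\<^sub>R n + t *\<^sub>R n) = lborel"
    (is "distr (?P \<Otimes>\<^sub>M _) _ ?T = _")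
proof (rule measure_eqI)
  fix A :: "'a set"
  assume "A \<in> sets (distr (?P \<Otimes>\<^sub>M lborel) borel ?T)"
  then have A[measurable]: "A \<in> sets borel" by simp
  let ?S = "{x. b \<le> n \<bullet> x \<and> n \<bullet> x \<le> b + 1}"
  have nn: "n \<bullet> n = 1" using n by (simp add: dot_square_norm)
  have T[measurable]: "?T \<in> measurable (?P \<Otimes>\<^sub>M lborel) borel"
  proof -
    have [measurable]: "(\<lambda>x. x) \<in> measurable ?P borel"
      by (rule measurable_restrict_space1) auto
    show ?thesis by measurable
  qed
  have "emeasure (distr (?P \<Otimes>\<^sub>M lborel) borel ?T) A = (\<integral>\<^sup>+z. indicator A z \<partial>distr (?P \<Otimes>\<^sub>M lborel) borel ?T)"
    by simp
  also have "\<dots> = (\<integral>\<^sup>+z. indicator A (?T z) \<partial>(?P \<Otimes>\<^sub>M lborel))"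
    by (subst nn_integral_distr) auto
  also have "\<dots> = (\<integral>\<^sup>+x. (\<integral>\<^sup>+t. indicator A (?T (x, t)) \<partial>lborel) \<partial>?P)"
    by (subst lborel.nn_integral_fst[symmetric]) auto
  also have "\<dots> = (\<integral>\<^sup>+x. (\<integral>\<^sup>+t. indicator A (x - (n \<bullet> x - b) *\<^sub>R n + t *\<^sub>R n) \<partial>lborel) * indicator ?S x \<partial>lborel)"
    by (subst nn_integral_restrict_space) auto
  also have "\<dots> = (\<integral>\<^sup>+x. (\<integral>\<^sup>+t. indicator A (x + t *\<^sub>R n) * indicator ?S x \<partial>lborel) \<partial>lborel)"
  proof (rule nn_integral_cong)
    fix x
    have "(\<integral>\<^sup>+t. indicator A (x - (n \<bullet> x - b) *\<^sub>R n + t *\<^sub>R n) \<partial>lborel) =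
        (\<integral>\<^sup>+t. indicator A (x - (n \<bullet> x - b) *\<^sub>R n + ((n \<bullet> x - b) + t) *\<^sub>R n) \<partial>lborel :: ennreal)"
      by (subst nn_integral_real_affine[where c = 1 and t = "n \<bullet> x - b"]) auto
    also have "\<dots> = (\<integral>\<^sup>+t. indicator A (x + t *\<^sub>R n) \<partial>lborel)"
      by (simp add: algebra_simps)
    finally show "(\<integral>\<^sup>+t. indicator A (x - (n \<bullet> x - b) *\<^sub>R n + t *\<^sub>R n) \<partial>lborel) * indicator ?S x =
        (\<integral>\<^sup>+t. indicator A (x + t *\<^sub>R n) * indicator ?S x \<partial>lborel :: ennreal)"
      by (simp add: nn_integral_multc)
  qed
  also have "\<dots> = (\<integral>\<^sup>+t. (\<integral>\<^sup>+x. indicator A (x + t *\<^sub>R n) * indicator ?S x \<partial>lborel) \<partial>lborel)"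
    by (rule lborel_pair.Fubini') measurable
  also have "\<dots> = (\<integral>\<^sup>+t. (\<integral>\<^sup>+x. indicator A x * indicator ?S (x - t *\<^sub>R n) \<partial>lborel) \<partial>lborel)"
  proof (rule nn_integral_cong)
    fix t :: real
    have "(\<integral>\<^sup>+x. indicator A x * indicator ?S (x - t *\<^sub>R n) \<partial>lborel) =
       (\<integral>\<^sup>+x. indicator A x * indicator ?S (x - t *\<^sub>R n) \<partial>distr lborel borel ((+) (t *\<^sub>R n)) :: ennreal)"
      by (simp add: lborel_distr_plus)
    also have "\<dots> = (\<integral>\<^sup>+x. indicator A (t *\<^sub>R n + x) * indicator ?S (t *\<^sub>R n + x - t *\<^sub>R n) \<partial>lborel)"
      by (subst nn_integral_distr) auto
    finally show "(\<integral>\<^sup>+x. indicator A (x + t *\<^sub>R n) * indicator ?S x \<partial>lborel) =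
      (\<integral>\<^sup>+x. indicator A x * indicator ?S (x - t *\<^sub>R n) \<partial>lborel :: ennreal)"
      by (simp add: add.commute)
  qed
  also have "\<dots> = (\<integral>\<^sup>+x. (\<integral>\<^sup>+t. indicator A x * indicator ?S (x - t *\<^sub>R n) \<partial>lborel) \<partial>lborel)"
    by (rule lborel_pair.Fubini'[symmetric]) measurable
  also have "\<dots> = (\<integral>\<^sup>+x. indicator A x \<partial>lborel)"
  proof (rule nn_integral_cong)
    fix x
    have "(\<integral>\<^sup>+t. indicator ?S (x - t *\<^sub>R n) \<partial>lborel) = (\<integral>\<^sup>+t. indicator {n \<bullet> x - b - 1 .. n \<bullet> x - b} t \<partial>lborel :: ennreal)"
      by (rule nn_integral_cong) (auto simp: indicator_def inner_diff_right nn)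
    also have "\<dots> = 1" by simp
    finally show "(\<integral>\<^sup>+t. indicator A x * indicator ?S (x - t *\<^sub>R n) \<partial>lborel) = (indicator A x :: ennreal)"
      by (simp add: nn_integral_cmult)
  qed
  finally show "emeasure (distr (?P \<Otimes>\<^sub>M lborel) borel ?T) A = emeasure lborel A" by simp
qed simp

lemma integral_hyperplane_fibres:
  fixes n :: "'a::euclidean_space" and g :: "'a \<Rightarrow> real"
  assumes n: "norm n = 1" and g: "integrable lborel g"
  shows "(\<integral>x. g x \<partial>lborel) = (\<integral>y. (\<integral>t. g (y + t *\<^sub>R n) \<partial>lborel) \<partial>hyperplane_measure n b)"
proof -
  let ?P = "restrict_space lborel {x. b \<le> n \<bullet> x \<and> n \<bullet> x \<le> b + 1}"
  let ?T = "\<lambda>(x, t). x - (n \<bullet> x - b) *\<^sub>R n + t *\<^sub>R n"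
  have [measurable]: "g \<in> borel_measurable borel" using borel_measurable_integrable[OF g] by simp
  have [measurable]: "(\<lambda>x. x) \<in> measurable ?P borel"
    by (rule measurable_restrict_space1) auto
  have [measurable]: "?T \<in> measurable (?P \<Otimes>\<^sub>M lborel) borel" by measurable
  interpret P: sigma_finite_measure ?P
    by (rule sigma_finite_measure_restrict_space) (auto intro: lborel.sigma_finite_measure_axioms)
  interpret pair_sigma_finite ?P "lborel :: real measure" ..
  have "(\<integral>x. g x \<partial>lborel) = (\<integral>x. g x \<partial>distr (?P \<Otimes>\<^sub>M lborel) borel ?T)"
    by (simp add: distr_hyperplane_fibres[OF n])
  also have "\<dots> = (\<integral>z. g (?T z) \<partial>(?P \<Otimes>\<^sub>M lborel))"
    by (rule integral_distr) auto
  also have "\<dots> = (\<integral>x. (\<integral>t. g (?T (x, t)) \<partial>lborel) \<partial>?P)"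
  proof (rule integral_fst'[symmetric])
    have "integrable (distr (?P \<Otimes>\<^sub>M lborel) borel ?T) g"
      using g by (simp add: distr_hyperplane_fibres[OF n])
    then show "integrable (?P \<Otimes>\<^sub>M lborel) (\<lambda>z. g (?T z))"
      by (subst (asm) integrable_distr_eq) auto
  qed
  also have "\<dots> = (\<integral>y. (\<integral>t. g (y + t *\<^sub>R n) \<partial>lborel) \<partial>hyperplane_measure n b)"
    unfolding hyperplane_measure_def by (subst integral_distr) auto
  finally show ?thesis .
qed

lemma integral_deriv_compact_support:
  fixes F f :: "real \<Rightarrow> real"
  assumes F: "\<And>t. (F has_real_derivative f t) (at t)" and f: "continuous_on UNIV f"
    and R: "R \<ge> 0" "\<And>t. \<bar>t\<bar> \<ge> R \<Longrightarrow> F t = 0" "\<And>t. \<bar>t\<bar> \<ge> R \<Longrightarrow> f t = 0"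
  shows "(\<integral>t. f t \<partial>lborel) = 0" "(\<integral>t. indicator {..0} t * f t \<partial>lborel) = F 0"
proof -
  have FTC: "(\<integral>t. indicator {a..b} t *\<^sub>R f t \<partial>lborel) = F b - F a" if "a \<le> b" for a b
  proof (rule integral_FTC_atLeastAtMost[OF that])
    show "(F has_vector_derivative f t) (at t within {a..b})" for t
      by (rule has_vector_derivative_at_within)
        (rule F[unfolded has_real_derivative_iff_has_vector_derivative])
    show "continuous_on {a..b} f" by (rule continuous_on_subset[OF f]) simp
  qed
  have out: "- R \<le> t \<and> t \<le> R" if "f t \<noteq> 0" for t
    using R(3)[of t] R(1) that by linarith
  have "(\<integral>t. f t \<partial>lborel) = (\<integral>t. indicator {-R..R} t *\<^sub>R f t \<partial>lborel)"
    by (rule Bochner_Integration.integral_cong) (use out in \<open>auto simp: indicator_def\<close>)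
  also have "\<dots> = 0" using FTC[of "-R" R] R by simp
  finally show "(\<integral>t. f t \<partial>lborel) = 0" .
  have "(\<integral>t. indicator {..0} t * f t \<partial>lborel) = (\<integral>t. indicator {-R..0} t *\<^sub>R f t \<partial>lborel)"
    by (rule Bochner_Integration.integral_cong) (use out in \<open>auto simp: indicator_def\<close>)
  also have "\<dots> = F 0" using FTC[of "-R" 0] R by simp
  finally show "(\<integral>t. indicator {..0} t * f t \<partial>lborel) = F 0" .
qed

lemma test_fun_UNIV_bound:
  fixes w :: "real^'n \<Rightarrow> real"
  assumes "test_fun D w"
  obtains R where "R > 0" "\<And>x. norm x \<ge> R \<Longrightarrow> w x = 0 \<and> grad w x = 0"
proof -
  have "bounded (closure {x. w x \<noteq> 0})"
    using assms by (simp add: test_fun_def compact_imp_bounded)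
  then obtain R where R: "R > 0" "\<And>x. x \<in> closure {x. w x \<noteq> 0} \<Longrightarrow> norm x < R"
    unfolding bounded_pos_less by blast
  show thesis
  proof (rule that[OF R(1)])
    fix x :: "real^'n" assume "norm x \<ge> R"
    then have "x \<notin> closure {x. w x \<noteq> 0}" using R(2)[of x] by auto
    then show "w x = 0 \<and> grad w x = 0" by (intro conjI outside_support)
  qed
qed

lemma integrable_continuous_bounded_support:
  fixes f :: "'a::euclidean_space \<Rightarrow> 'b::euclidean_space"
  assumes "continuous_on UNIV f" "\<And>x. norm x \<ge> R \<Longrightarrow> f x = 0"
  shows "integrable lborel f"
proof -
  have "integrable lborel (\<lambda>x. indicator (cball 0 R) x *\<^sub>R f x)"
    using assms by (intro borel_integrable_compact) (auto intro: continuous_on_subset)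
  moreover have "(\<lambda>x. indicator (cball 0 R) x *\<^sub>R f x) = f"
    by (rule ext) (use assms(2) in \<open>auto simp: indicator_def not_le\<close>)
  ultimately show ?thesis by simp
qed

lemma
  fixes w :: "real^'n \<Rightarrow> real"
  assumes "test_fun D w"
  shows integrable_test_fun: "integrable lborel w"
    and integrable_grad_test_fun: "integrable lborel (\<lambda>x. grad w x \<bullet> v)"
proof -
  obtain R where R: "R > 0" "\<And>x. norm x \<ge> R \<Longrightarrow> w x = 0 \<and> grad w x = 0"
    using test_fun_UNIV_bound[OF assms] by blast
  note sm = test_fun_smooth[OF assms]
  show "integrable lborel w"
    by (rule integrable_continuous_bounded_support[where R = R]) (use R smooth_continuous[OF sm] in auto)
  show "integrable lborel (\<lambda>x. grad w x \<bullet> v)"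
    by (rule integrable_continuous_bounded_support[where R = R])
      (use R continuous_on_grad[OF sm] in \<open>auto intro!: continuous_intros\<close>)
qed

lemma has_real_derivative_line:
  fixes w :: "real^'n \<Rightarrow> real"
  assumes "smooth w"
  shows "((\<lambda>t. w (y + t *\<^sub>R v)) has_real_derivative grad w (y + t *\<^sub>R v) \<bullet> v) (at t)"
proof -
  have "((\<lambda>t. y + t *\<^sub>R v) has_derivative (\<lambda>s. s *\<^sub>R v)) (at t)"
    by (auto intro!: derivative_eq_intros)
  from has_derivative_compose[OF this smooth_has_derivative[OF assms]]
  have "((\<lambda>t. w (y + t *\<^sub>R v)) has_derivative (\<lambda>s. grad w (y + t *\<^sub>R v) \<bullet> (s *\<^sub>R v))) (at t)" .
  then show ?thesis
    unfolding has_field_derivative_def by (rule has_derivative_eq_rhs) (simp add: fun_eq_iff mult.commute)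
qed

lemma line_integral_test_fun:
  fixes w :: "real^'n \<Rightarrow> real"
  assumes w: "test_fun D w" and v: "norm v = 1"
  shows "(\<integral>t. grad w (y + t *\<^sub>R v) \<bullet> v \<partial>lborel) = 0"
    and "(\<integral>t. indicator {..0} t * (grad w (y + t *\<^sub>R v) \<bullet> v) \<partial>lborel) = w y"
proof -
  obtain R where R: "R > 0" "\<And>x. norm x \<ge> R \<Longrightarrow> w x = 0 \<and> grad w x = 0"
    using test_fun_UNIV_bound[OF w] by blast
  have far: "norm (y + t *\<^sub>R v) \<ge> R" if "\<bar>t\<bar> \<ge> R + norm y" for t
    using norm_triangle_ineq2[of "t *\<^sub>R v" "- y"] that v by (simp add: add.commute)
  note d = has_real_derivative_line[OF test_fun_smooth[OF w], of y v]
  have c: "continuous_on UNIV (\<lambda>t. grad w (y + t *\<^sub>R v) \<bullet> v)"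
    by (rule continuous_on_inner[OF continuous_on_compose2[OF continuous_on_grad[OF test_fun_smooth[OF w], of UNIV]]])
      (auto intro!: continuous_intros)
  show "(\<integral>t. grad w (y + t *\<^sub>R v) \<bullet> v \<partial>lborel) = 0"
    by (rule integral_deriv_compact_support(1)[OF d c, of "R + norm y"]) (use R far in auto)
  show "(\<integral>t. indicator {..0} t * (grad w (y + t *\<^sub>R v) \<bullet> v) \<partial>lborel) = w y"
    using integral_deriv_compact_support(2)[OF d c, of "R + norm y"] R far by simp
qed

text \<open>
  Along the lines in direction \<open>v\<close> the indicator function of \<open>H\<close> is constant, and the derivative of a
  function of compact support integrates to zero.
\<close>
lemma integral_directional_deriv_invariant:
  fixes w :: "real^'n \<Rightarrow> real"
  assumes w: "test_fun D w" and H[measurable]: "H \<in> sets borel"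
    and inv: "\<And>x t. x + t *\<^sub>R v \<in> H \<longleftrightarrow> x \<in> H"
  shows "(\<integral>x. indicator H x * (grad w x \<bullet> v) \<partial>lborel) = 0"
proof -
  have unit: "(\<integral>x. indicator H x * (grad w x \<bullet> v) \<partial>lborel) = 0"
    if v: "norm v = 1" and inv: "\<And>x t. x + t *\<^sub>R v \<in> H \<longleftrightarrow> x \<in> H" for v
  proof -
    have "integrable lborel (\<lambda>x. indicator H x *\<^sub>R (grad w x \<bullet> v))"
      by (intro integrable_mult_indicator integrable_grad_test_fun[OF w]) auto
    then have "(\<integral>x. indicator H x * (grad w x \<bullet> v) \<partial>lborel) =
        (\<integral>y. (\<integral>t. indicator H (y + t *\<^sub>R v) * (grad w (y + t *\<^sub>R v) \<bullet> v) \<partial>lborel) \<partial>hyperplane_measure v 0)"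
      by (intro integral_hyperplane_fibres[OF v]) simp
    also have "\<dots> = (\<integral>y. indicator H y * (\<integral>t. grad w (y + t *\<^sub>R v) \<bullet> v \<partial>lborel) \<partial>hyperplane_measure v 0)"
      by (simp add: indicator_def inv)
    finally show ?thesis by (simp add: line_integral_test_fun(1)[OF w v])
  qed
  show ?thesis
  proof (cases "v = 0")
    case False
    have "x + t *\<^sub>R sgn v \<in> H \<longleftrightarrow> x \<in> H" for x t
      using inv[of x "t / norm v"] by (simp add: sgn_div_norm divide_inverse)
    with False have "(\<integral>x. indicator H x * (grad w x \<bullet> sgn v) \<partial>lborel) = 0"
      by (intro unit) (auto simp: norm_sgn)
    then have "norm v * (\<integral>x. indicator H x * (grad w x \<bullet> sgn v) \<partial>lborel) = 0" by simp
    also have "norm v * (\<integral>x. indicator H x * (grad w x \<bullet> sgn v) \<partial>lborel) =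
      (\<integral>x. indicator H x * (grad w x \<bullet> v) \<partial>lborel)"
      using False by (subst integral_mult_right_zero[symmetric])
        (intro Bochner_Integration.integral_cong refl, simp add: sgn_div_norm)
    finally show ?thesis .
  qed simp
qed

lemma integral_grad_test_fun:
  fixes w :: "real^'n \<Rightarrow> real"
  assumes "test_fun D w"
  shows "(\<integral>x. grad w x \<bullet> v \<partial>lborel) = 0"
  using integral_directional_deriv_invariant[OF assms, of UNIV v] by simp

text \<open>
  The part of \<open>v\<close> tangential to the hyperplane contributes nothing. In normal direction, the
  fundamental theorem of calculus on the half line that ends at \<open>y\<close> gives \<open>w y\<close>.
\<close>
lemma integral_grad_halfspace:
  fixes w :: "real^'n \<Rightarrow> real"
  assumes w: "test_fun D w" and n: "norm n = 1"
  shows "(\<integral>x. indicator {x. n \<bullet> x \<le> b} x * (grad w x \<bullet> v) \<partial>lborel) =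
    (n \<bullet> v) * (\<integral>x. w x \<partial>hyperplane_measure n b)"
proof -
  let ?H = "{x. n \<bullet> x \<le> b}"
  have nn: "n \<bullet> n = 1" using n by (simp add: dot_square_norm)
  have int: "integrable lborel (\<lambda>x. indicator ?H x * (grad w x \<bullet> v))" for v
    using integrable_mult_indicator[OF _ integrable_grad_test_fun[OF w], of ?H v] by simp
  let ?v = "v - (n \<bullet> v) *\<^sub>R n"
  have tang: "(\<integral>x. indicator ?H x * (grad w x \<bullet> ?v) \<partial>lborel) = 0"
    by (rule integral_directional_deriv_invariant[OF w])
      (auto simp: inner_add_right inner_diff_right nn)
  have "(\<integral>x. indicator ?H x * (grad w x \<bullet> n) \<partial>lborel) =
      (\<integral>y. (\<integral>t. indicator ?H (y + t *\<^sub>R n) * (grad w (y + t *\<^sub>R n) \<bullet> n) \<partial>lborel) \<partial>hyperplane_measure n b)"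
    by (rule integral_hyperplane_fibres[OF n int])
  also have "\<dots> = (\<integral>y. w y \<partial>hyperplane_measure n b)"
  proof (rule integral_cong_AE)
    have [measurable]: "w \<in> borel_measurable borel" "(\<lambda>x. grad w x \<bullet> n) \<in> borel_measurable borel"
      using borel_measurable_integrable[OF integrable_test_fun[OF w]]
        borel_measurable_integrable[OF integrable_grad_test_fun[OF w]] by auto
    show "(\<lambda>y. \<integral>t. indicator ?H (y + t *\<^sub>R n) * (grad w (y + t *\<^sub>R n) \<bullet> n) \<partial>lborel)
        \<in> borel_measurable (hyperplane_measure n b)"
      by measurable
    show "w \<in> borel_measurable (hyperplane_measure n b)" by measurable
    show "AE y in hyperplane_measure n b.
      (\<integral>t. indicator ?H (y + t *\<^sub>R n) * (grad w (y + t *\<^sub>R n) \<bullet> n) \<partial>lborel) = w y"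
      using AE_hyperplane_measure[OF n, of b]
    proof eventually_elim
      case (elim y)
      then have "indicator ?H (y + t *\<^sub>R n) = (indicator {..0} t :: real)" for t
        by (auto simp: indicator_def inner_add_right nn)
      then show ?case by (simp add: line_integral_test_fun(2)[OF w n])
    qed
  qed
  finally have norm: "(\<integral>x. indicator ?H x * (grad w x \<bullet> n) \<partial>lborel) = (\<integral>y. w y \<partial>hyperplane_measure n b)" .
  have "(\<integral>x. indicator ?H x * (grad w x \<bullet> v) \<partial>lborel) =
      (\<integral>x. indicator ?H x * (grad w x \<bullet> ?v) + (n \<bullet> v) * (indicator ?H x * (grad w x \<bullet> n)) \<partial>lborel)"
    by (rule Bochner_Integration.integral_cong) (auto simp: algebra_simps inner_diff_right)
  also have "\<dots> = (n \<bullet> v) * (\<integral>x. indicator ?H x * (grad w x \<bullet> n) \<partial>lborel)"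
    using tang by (subst Bochner_Integration.integral_add[OF int integrable_mult_right[OF int]]) simp
  finally show ?thesis by (simp add: norm)
qed

section \<open>Square integrable functions\<close>

lemma norm_add_square_le: "(norm (a + b))\<^sup>2 \<le> 2 * (norm a)\<^sup>2 + 2 * (norm (b::'a::real_inner))\<^sup>2"
proof -
  have "0 \<le> (norm (a - b))\<^sup>2" by simp
  then show ?thesis by (simp add: power2_norm_eq_inner inner_simps inner_commute)
qed

lemma L2_borel_measurable: "L2 M f \<Longrightarrow> f \<in> borel_measurable M"
  by (simp add: L2_def)

lemma L2_square_integrable: "L2 M f \<Longrightarrow> integrable M (\<lambda>x. (norm (f x))\<^sup>2)"
  by (simp add: L2_def)

lemma L2norm_nonneg: "0 \<le> L2norm M f"
  by (simp add: L2norm_def integral_nonneg_AE)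

lemma L2norm_square: "(L2norm M f)\<^sup>2 = (\<integral>x. (norm (f x))\<^sup>2 \<partial>M)"
  by (simp add: L2norm_def integral_nonneg_AE)

lemma L2_bound:
  assumes "L2 M f" "g \<in> borel_measurable M" "AE x in M. norm (g x) \<le> K * norm (f x)"
  shows "L2 M g"
proof -
  have "integrable M (\<lambda>x. (norm (g x))\<^sup>2)"
  proof (rule Bochner_Integration.integrable_bound)
    show "integrable M (\<lambda>x. K\<^sup>2 * (norm (f x))\<^sup>2)"
      using L2_square_integrable[OF assms(1)] by simp
    show "(\<lambda>x. (norm (g x))\<^sup>2) \<in> borel_measurable M" using assms(2) by measurable
    show "AE x in M. norm ((norm (g x))\<^sup>2) \<le> norm (K\<^sup>2 * (norm (f x))\<^sup>2)"
      using assms(3)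
    proof eventually_elim
      case (elim x)
      then have "(norm (g x))\<^sup>2 \<le> (K * norm (f x))\<^sup>2" by (intro power_mono) auto
      then show ?case by (simp add: power_mult_distrib)
    qed
  qed
  with assms(2) show ?thesis by (simp add: L2_def)
qed

lemma L2_add:
  fixes f g :: "'a \<Rightarrow> 'b::euclidean_space"
  assumes f: "L2 M f" and g: "L2 M g"
  shows "L2 M (\<lambda>x. f x + g x)"
proof -
  note [measurable] = L2_borel_measurable[OF f] L2_borel_measurable[OF g]
  have "integrable M (\<lambda>x. (norm (f x + g x))\<^sup>2)"
  proof (rule Bochner_Integration.integrable_bound)
    show "integrable M (\<lambda>x. 2 * (norm (f x))\<^sup>2 + 2 * (norm (g x))\<^sup>2)"
      using L2_square_integrable[OF f] L2_square_integrable[OF g] by simp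
    show "AE x in M. norm ((norm (f x + g x))\<^sup>2) \<le> norm (2 * (norm (f x))\<^sup>2 + 2 * (norm (g x))\<^sup>2)"
      using norm_add_square_le by (intro AE_I2) (simp add: abs_of_nonneg)
  qed measurable
  then show ?thesis by (simp add: L2_def)
qed

lemma L2_scaleR: "L2 M f \<Longrightarrow> L2 M (\<lambda>x. r *\<^sub>R f x)"
  by (rule L2_bound[where K = "\<bar>r\<bar>"]) (auto simp: L2_def)

lemma L2_diff:
  fixes f g :: "'a \<Rightarrow> 'b::euclidean_space"
  assumes "L2 M f" "L2 M g" shows "L2 M (\<lambda>x. f x - g x)"
  using L2_add[OF assms(1) L2_scaleR[OF assms(2), of "-1"]] by simp

lemma L2_inner_const:
  assumes "L2 M f" shows "L2 M (\<lambda>x. f x \<bullet> v)"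
proof (rule L2_bound[OF assms, where K = "norm v"])
  show "(\<lambda>x. f x \<bullet> v) \<in> borel_measurable M" using L2_borel_measurable[OF assms] by measurable
  show "AE x in M. norm (f x \<bullet> v) \<le> norm v * norm (f x)"
    by (rule AE_I2) (metis Cauchy_Schwarz_ineq2 mult.commute real_norm_def)
qed

lemma L2_nth: "L2 M (f :: 'a \<Rightarrow> real^'n) \<Longrightarrow> L2 M (\<lambda>x. f x $ i)"
  using L2_inner_const[of M f "axis i 1"] by (simp add: inner_axis)

lemma L2_integrable_inner:
  fixes f g :: "'a \<Rightarrow> 'b::euclidean_space"
  assumes f: "L2 M f" and g: "L2 M g"
  shows "integrable M (\<lambda>x. f x \<bullet> g x)"
proof (rule Bochner_Integration.integrable_bound)
  note [measurable] = L2_borel_measurable[OF f] L2_borel_measurable[OF g]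
  show "integrable M (\<lambda>x. (norm (f x))\<^sup>2 + (norm (g x))\<^sup>2)"
    using L2_square_integrable[OF f] L2_square_integrable[OF g] by simp
  show "(\<lambda>x. f x \<bullet> g x) \<in> borel_measurable M" by measurable
  show "AE x in M. norm (f x \<bullet> g x) \<le> norm ((norm (f x))\<^sup>2 + (norm (g x))\<^sup>2)"
  proof (rule AE_I2)
    fix x
    have "\<bar>f x \<bullet> g x\<bar> \<le> norm (f x) * norm (g x)" by (rule Cauchy_Schwarz_ineq2)
    also have "\<dots> \<le> (norm (f x))\<^sup>2 + (norm (g x))\<^sup>2"
      using sum_squares_bound[of "norm (f x)" "norm (g x)"] mult_nonneg_nonneg[of "norm (f x)" "norm (g x)"]
        norm_ge_zero[of "f x"] norm_ge_zero[of "g x"] by linarith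
    finally show "norm (f x \<bullet> g x) \<le> norm ((norm (f x))\<^sup>2 + (norm (g x))\<^sup>2)" by simp
  qed
qed

lemma L2_integrable_mult:
  "L2 M f \<Longrightarrow> L2 M g \<Longrightarrow> integrable M (\<lambda>x. f x * g x :: real)"
  using L2_integrable_inner[of M f g] by simp

lemma L2_integrable_scaleR:
  fixes f :: "'a \<Rightarrow> real" and g :: "'a \<Rightarrow> 'b::euclidean_space"
  assumes f: "L2 M f" and g: "L2 M g"
  shows "integrable M (\<lambda>x. f x *\<^sub>R g x)"
proof -
  have "integrable M (\<lambda>x. norm (f x) * norm (g x))"
  proof (rule L2_integrable_mult)
    show "L2 M (\<lambda>x. norm (f x))"
      by (rule L2_bound[OF f, where K = 1]) (use L2_borel_measurable[OF f] in auto)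
    show "L2 M (\<lambda>x. norm (g x))"
      by (rule L2_bound[OF g, where K = 1]) (use L2_borel_measurable[OF g] in auto)
  qed
  then show ?thesis
    by (rule Bochner_Integration.integrable_bound)
      (use L2_borel_measurable[OF f] L2_borel_measurable[OF g] in auto)
qed

lemma L2_cong:
  assumes "\<And>x. x \<in> space M \<Longrightarrow> f x = g x"
  shows "L2 M f \<longleftrightarrow> L2 M g"
  unfolding L2_def
  by (intro conj_cong measurable_cong Bochner_Integration.integrable_cong refl) (auto simp: assms)

lemma integral_lebesgue_on_support:
  fixes f :: "'a::euclidean_space \<Rightarrow> 'b::euclidean_space"
  assumes "S \<in> sets lebesgue" "T \<in> sets lebesgue" "S \<subseteq> T" "\<And>x. x \<in> T - S \<Longrightarrow> f x = 0"
  shows "integral\<^sup>L (lebesgue_on T) f = integral\<^sup>L (lebesgue_on S) f"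
proof -
  have "(\<lambda>x. indicator T x *\<^sub>R f x) = (\<lambda>x. indicator S x *\<^sub>R f x)"
  proof
    show "indicator T x *\<^sub>R f x = indicator S x *\<^sub>R f x" for x
      using assms(3) assms(4)[of x] by (cases "x \<in> S"; cases "x \<in> T") auto
  qed
  then show ?thesis
    using assms(1,2) by (simp add: integral_restrict_space)
qed

lemma integrable_lebesgue_on_subset:
  fixes f :: "'a::euclidean_space \<Rightarrow> 'b::euclidean_space"
  assumes S: "S \<in> sets lebesgue" "T \<in> sets lebesgue" "S \<subseteq> T" and f: "integrable (lebesgue_on T) f"
  shows "integrable (lebesgue_on S) f"
proof -
  have "integrable lebesgue (\<lambda>x. indicator S x *\<^sub>R (indicator T x *\<^sub>R f x))"
    by (rule integrable_mult_indicator) (use f S in \<open>simp_all add: integrable_restrict_space\<close>)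
  moreover have eq: "indicator S x *\<^sub>R (indicator T x *\<^sub>R f x) = indicator S x *\<^sub>R f x" for x
    using S(3) by (auto simp: indicator_def)
  ultimately have "integrable lebesgue (\<lambda>x. indicator S x *\<^sub>R f x)" unfolding eq by blast
  then show ?thesis using S by (simp add: integrable_restrict_space)
qed

lemma L2_lebesgue_on_subset:
  fixes f :: "'a::euclidean_space \<Rightarrow> 'b::euclidean_space"
  assumes "S \<in> sets lebesgue" "T \<in> sets lebesgue" "S \<subseteq> T" and "L2 (lebesgue_on T) f"
  shows "L2 (lebesgue_on S) f"
  unfolding L2_def
proof
  show "f \<in> borel_measurable (lebesgue_on S)"
    by (rule measurable_restrict_mono[OF L2_borel_measurable[OF assms(4)] assms(3)])
  show "integrable (lebesgue_on S) (\<lambda>x. (norm (f x))\<^sup>2)"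
    by (rule integrable_lebesgue_on_subset[OF assms(1-3) L2_square_integrable[OF assms(4)]])
qed

text \<open>
  The weak derivatives live on the interior of an element, whereas the norms in the estimator are
  taken over the closed element. Since the Lebesgue measure is complete, the difference is immaterial
  even for measurability.
\<close>
context
  fixes S T :: "'a::euclidean_space set"
  assumes S: "S \<in> sets lebesgue" and T: "T \<in> sets lebesgue" and sub: "S \<subseteq> T"
    and null: "negligible (T - S)"
begin

lemma AE_notin_diff: "AE x in lebesgue. x \<notin> T - S"
  using null by (intro AE_not_in) (simp add: negligible_iff_null_sets)

lemma AE_lebesgue_on_spike: "(AE x in lebesgue_on T. P x) \<longleftrightarrow> (AE x in lebesgue_on S. P x)"
proof
  assume "AE x in lebesgue_on T. P x"
  then have "AE x in lebesgue. x \<in> T \<longrightarrow> P x" using T by (simp add: AE_restrict_space_iff)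
  then have "AE x in lebesgue. x \<in> S \<longrightarrow> P x" by eventually_elim (use sub in auto)
  then show "AE x in lebesgue_on S. P x" using S by (simp add: AE_restrict_space_iff)
next
  assume "AE x in lebesgue_on S. P x"
  then have "AE x in lebesgue. x \<in> S \<longrightarrow> P x" using S by (simp add: AE_restrict_space_iff)
  then have "AE x in lebesgue. x \<in> T \<longrightarrow> P x" using AE_notin_diff by eventually_elim auto
  then show "AE x in lebesgue_on T. P x" using T by (simp add: AE_restrict_space_iff)
qed

lemma borel_measurable_lebesgue_on_spike:
  fixes f :: "'a \<Rightarrow> 'b::euclidean_space"
  assumes "f \<in> borel_measurable (lebesgue_on S)"
  shows "f \<in> borel_measurable (lebesgue_on T)"
proof -
  have "(\<lambda>x. indicator S x *\<^sub>R f x) \<in> borel_measurable lebesgue"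
    using assms S by (simp add: borel_measurable_restrict_space_iff)
  then have "(\<lambda>x. indicator T x *\<^sub>R f x) \<in> borel_measurable lebesgue"
    by (rule borel_measurable_AE)
      (use AE_notin_diff sub in \<open>auto simp: indicator_def elim!: eventually_mono\<close>)
  then show ?thesis using T by (simp add: borel_measurable_restrict_space_iff)
qed

lemma
  fixes f :: "'a \<Rightarrow> 'b::euclidean_space"
  assumes f: "integrable (lebesgue_on S) f"
  shows integrable_lebesgue_on_spike: "integrable (lebesgue_on T) f"
    and integral_lebesgue_on_spike: "integral\<^sup>L (lebesgue_on T) f = integral\<^sup>L (lebesgue_on S) f"
proof -
  have int: "integrable lebesgue (\<lambda>x. indicator S x *\<^sub>R f x)"
    using f S by (simp add: integrable_restrict_space)
  have ae: "AE x in lebesgue. indicator S x *\<^sub>R f x = indicator T x *\<^sub>R f x"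
    using AE_notin_diff by eventually_elim (use sub in \<open>auto simp: indicator_def\<close>)
  have meas: "(\<lambda>x. indicator T x *\<^sub>R f x) \<in> borel_measurable lebesgue"
    by (rule borel_measurable_AE[OF _ ae]) (rule borel_measurable_integrable[OF int])
  show "integrable (lebesgue_on T) f"
    using integrable_cong_AE_imp[OF int meas ae] T by (simp add: integrable_restrict_space)
  show "integral\<^sup>L (lebesgue_on T) f = integral\<^sup>L (lebesgue_on S) f"
    using integral_cong_AE[OF borel_measurable_integrable[OF int] meas ae] S T
    by (simp add: integral_restrict_space)
qed

lemma L2_lebesgue_on_spike:
  fixes f :: "'a \<Rightarrow> 'b::euclidean_space"
  assumes "L2 (lebesgue_on S) f"
  shows "L2 (lebesgue_on T) f"
  unfolding L2_def
  by (intro conjI borel_measurable_lebesgue_on_spike integrable_lebesgue_on_spike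
      L2_borel_measurable[OF assms] L2_square_integrable[OF assms])

end

lemma integral_lebesgue_on_borel:
  fixes f :: "'a::euclidean_space \<Rightarrow> 'b::euclidean_space"
  assumes "S \<in> sets borel" "f \<in> borel_measurable borel"
  shows "integral\<^sup>L (lebesgue_on S) f = (\<integral>x. indicator S x *\<^sub>R f x \<partial>lborel)"
  using assms by (simp add: integral_restrict_space integral_completion)

lemma integrable_lebesgue_on_borel:
  fixes f :: "'a::euclidean_space \<Rightarrow> 'b::euclidean_space"
  assumes "S \<in> sets lebesgue" "integrable lborel f"
  shows "integrable (lebesgue_on S) f"
proof -
  have "integrable lebesgue f"
    using assms(2) by (simp add: integrable_completion)
  then show ?thesis
    using integrable_mult_indicator[OF assms(1)] assms(1) by (simp add: integrable_restrict_space)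
qed

lemma borel_measurable_lebesgue_on_continuous:
  fixes f :: "'a::euclidean_space \<Rightarrow> 'b::euclidean_space"
  assumes "continuous_on UNIV f"
  shows "f \<in> borel_measurable (lebesgue_on S)"
  by (rule measurable_restrict_space1, rule measurable_completion)
    (use borel_measurable_continuous_onI[OF assms] in simp)

lemma L2_continuous_bounded_support:
  fixes f :: "'a::euclidean_space \<Rightarrow> 'b::euclidean_space"
  assumes "S \<in> sets lebesgue" "continuous_on UNIV f" "\<And>x. norm x \<ge> R \<Longrightarrow> f x = 0"
  shows "L2 (lebesgue_on S) f"
proof -
  have "integrable lborel (\<lambda>x. (norm (f x))\<^sup>2)"
    by (rule integrable_continuous_bounded_support[where R = R])
      (use assms in \<open>auto intro!: continuous_intros\<close>)
  then show ?thesis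
    unfolding L2_def
    using assms by (intro conjI borel_measurable_lebesgue_on_continuous integrable_lebesgue_on_borel) auto
qed

lemma
  fixes \<phi> :: "real^'n \<Rightarrow> real"
  assumes "test_fun D \<phi>" "S \<in> sets lebesgue"
  shows L2_test_fun: "L2 (lebesgue_on S) \<phi>" and L2_grad_test_fun: "L2 (lebesgue_on S) (grad \<phi>)"
proof -
  obtain R where R: "R > 0" "\<And>x. norm x \<ge> R \<Longrightarrow> \<phi> x = 0 \<and> grad \<phi> x = 0"
    using test_fun_UNIV_bound[OF assms(1)] by blast
  note sm = test_fun_smooth[OF assms(1)]
  show "L2 (lebesgue_on S) \<phi>"
    by (rule L2_continuous_bounded_support[OF assms(2), where R = R])
      (use R smooth_continuous[OF sm] in auto)
  show "L2 (lebesgue_on S) (grad \<phi>)"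
    by (rule L2_continuous_bounded_support[OF assms(2), where R = R])
      (use R continuous_on_grad[OF sm] in auto)
qed

lemma L2_continuous_bounded_set:
  fixes f :: "'a::euclidean_space \<Rightarrow> 'b::euclidean_space"
  assumes "S \<in> sets lebesgue" "bounded S" "continuous_on UNIV f"
  shows "L2 (lebesgue_on S) f"
proof -
  obtain R where R: "S \<subseteq> cball 0 R"
    using bounded_subset_ballD[OF assms(2), of 0] ball_subset_cball by (meson subset_trans)
  have "continuous_on UNIV (\<lambda>x. (norm (f x))\<^sup>2)"
    using assms(3) by (auto intro!: continuous_intros)
  then have "continuous_on (cball 0 R) (\<lambda>x. (norm (f x))\<^sup>2)"
    by (rule continuous_on_subset) simp
  then have "integrable lborel (\<lambda>x. indicator (cball 0 R) x *\<^sub>R (norm (f x))\<^sup>2)"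
    by (rule borel_integrable_compact[OF compact_cball])
  then have "integrable (lebesgue_on S) (\<lambda>x. indicator (cball 0 R) x *\<^sub>R (norm (f x))\<^sup>2)"
    by (rule integrable_lebesgue_on_borel[OF assms(1)])
  also have "?this \<longleftrightarrow> integrable (lebesgue_on S) (\<lambda>x. (norm (f x))\<^sup>2)"
    by (rule Bochner_Integration.integrable_cong) (use R in \<open>auto simp: indicator_def\<close>)
  finally show ?thesis
    using assms(3) by (simp add: L2_def borel_measurable_lebesgue_on_continuous)
qed

text \<open>
  \<open>fundamental_lemma\<close> applies to a Borel measurable representative.
\<close>
lemma fundamental_lemma_lebesgue:
  fixes h :: "real^'n \<Rightarrow> real"
  assumes D: "open D" and h: "L2 (lebesgue_on D) h"
    and zero: "\<And>\<phi>. test_fun D \<phi> \<Longrightarrow> (\<integral>x. h x * \<phi> x \<partial>lebesgue_on D) = 0"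
  shows "AE x in lebesgue_on D. h x = 0"
proof -
  have D': "D \<in> sets lebesgue" using D by auto
  have meas: "(\<lambda>x. indicator D x *\<^sub>R h x) \<in> borel_measurable lebesgue"
    using L2_borel_measurable[OF h] D' by (simp add: borel_measurable_restrict_space_iff)
  obtain h' where h'[measurable]: "h' \<in> borel_measurable borel"
    and ae: "AE x in lborel. indicator D x *\<^sub>R h x = h' x"
    using completion_ex_borel_measurable_real[OF meas] by auto
  have ae': "AE x in lebesgue. indicator D x *\<^sub>R h x = h' x"
    by (rule AE_completion[OF ae])
  have transfer: "integrable lborel (\<lambda>x. g x * h' x) \<and>
      (\<integral>x. g x * h' x \<partial>lborel) = (\<integral>x. h x * g x \<partial>lebesgue_on D)"
    if g[measurable]: "g \<in> borel_measurable borel" and g2: "L2 (lebesgue_on D) g" for g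
  proof -
    have "integrable (lebesgue_on D) (\<lambda>x. h x * g x)" by (rule L2_integrable_mult[OF h g2])
    then have int: "integrable lebesgue (\<lambda>x. indicator D x *\<^sub>R (h x * g x))"
      using D' by (simp add: integrable_restrict_space)
    have m: "(\<lambda>x. g x * h' x) \<in> borel_measurable lborel" by simp
    have m': "(\<lambda>x. g x * h' x) \<in> borel_measurable lebesgue"
      by (rule measurable_completion[OF m])
    have ae2: "AE x in lebesgue. indicator D x *\<^sub>R (h x * g x) = g x * h' x"
      using ae' by eventually_elim (simp add: indicator_def algebra_simps split: if_splits)
    have "integrable lebesgue (\<lambda>x. g x * h' x)"
      by (rule integrable_cong_AE_imp[OF int m' ae2])
    moreover have "(\<integral>x. indicator D x *\<^sub>R (h x * g x) \<partial>lebesgue) = (\<integral>x. g x * h' x \<partial>lebesgue)"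
      by (rule integral_cong_AE[OF borel_measurable_integrable[OF int] m' ae2])
    ultimately show ?thesis
      using D' by (simp add: integral_restrict_space integrable_completion[OF m] integral_completion[OF m])
  qed
  have "AE x in lborel. x \<in> D \<longrightarrow> h' x = 0"
  proof (rule fundamental_lemma[OF _ D h'])
    fix a b :: "real^'n" assume "cbox a b \<subseteq> D"
    have "L2 (lebesgue_on D) (indicator (cbox a b) :: _ \<Rightarrow> real)"
    proof -
      have "integrable lborel (\<lambda>x. indicator (cbox a b) x :: real)"
        by (rule integrable_real_indicator) (use emeasure_lborel_cbox_finite[of a b] in simp_all)
      moreover have "(\<lambda>x. (norm (indicator (cbox a b) x :: real))\<^sup>2) = indicator (cbox a b)"
        by (auto simp: indicator_def)
      moreover have "(indicator (cbox a b) :: _ \<Rightarrow> real) \<in> borel_measurable (lebesgue_on D)"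
        by (rule measurable_restrict_space1, rule measurable_completion) simp
      ultimately show ?thesis
        using integrable_lebesgue_on_borel[OF D'] by (simp add: L2_def)
    qed
    then show "integrable lborel (\<lambda>x. indicator (cbox a b) x * h' x)"
      by (intro conjunct1[OF transfer]) auto
  next
    fix \<phi> :: "real^'n \<Rightarrow> real" assume \<phi>: "test_fun D \<phi>"
    have "\<phi> \<in> borel_measurable borel"
      using borel_measurable_integrable[OF integrable_test_fun[OF \<phi>]] by simp
    from transfer[OF this L2_test_fun[OF \<phi> D']] zero[OF \<phi>]
    show "(\<integral>x. h' x * \<phi> x \<partial>lborel) = 0" by (simp add: mult.commute)
  qed simp
  then have "AE x in lebesgue. x \<in> D \<longrightarrow> h' x = 0" by (rule AE_completion)
  with ae' have "AE x in lebesgue. x \<in> D \<longrightarrow> h x = 0"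
    by eventually_elim auto
  then show ?thesis using D' by (simp add: AE_restrict_space_iff)
qed

section \<open>Weak gradients and weak divergences\<close>

lemma weak_gradD:
  assumes "weak_grad D v G"
  shows "L2 (lebesgue_on D) v" "L2 (lebesgue_on D) G"
    "test_fun D \<phi> \<Longrightarrow> (\<integral>x. v x *\<^sub>R grad \<phi> x \<partial>lebesgue_on D) = - (\<integral>x. \<phi> x *\<^sub>R G x \<partial>lebesgue_on D)"
  using assms by (auto simp: weak_grad_def)

lemma weak_divD:
  assumes "weak_div D \<sigma> \<delta>"
  shows "L2 (lebesgue_on D) \<sigma>" "L2 (lebesgue_on D) \<delta>"
    "test_fun D \<phi> \<Longrightarrow> (\<integral>x. \<sigma> x \<bullet> grad \<phi> x \<partial>lebesgue_on D) = - (\<integral>x. \<delta> x * \<phi> x \<partial>lebesgue_on D)"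
  using assms by (auto simp: weak_div_def)

lemma weak_grad_wgrad: "weak_grad D v G \<Longrightarrow> weak_grad D v (wgrad D v)"
  unfolding wgrad_def by (rule someI[of "weak_grad D v"])

lemma weak_div_wdiv: "weak_div D \<sigma> \<delta> \<Longrightarrow> weak_div D \<sigma> (wdiv D \<sigma>)"
  unfolding wdiv_def by (rule someI[of "weak_div D \<sigma>"])

lemma integral_nth:
  fixes f :: "'a \<Rightarrow> real^'n"
  assumes "integrable M f"
  shows "(\<integral>x. f x \<partial>M) $ i = (\<integral>x. f x $ i \<partial>M)"
  using Bochner_Integration.integral_inner_left[OF assms, of "axis i 1"] by (simp add: inner_axis)

lemma weak_grad_unique:
  assumes D: "open D" and G: "weak_grad D v G" and H: "weak_grad D v H"
  shows "AE x in lebesgue_on D. G x = H x"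
proof -
  have D': "D \<in> sets lebesgue" using D by auto
  have "AE x in lebesgue_on D. (G x - H x) $ i = 0" for i
  proof (rule fundamental_lemma_lebesgue[OF D])
    show L2: "L2 (lebesgue_on D) (\<lambda>x. (G x - H x) $ i)"
      by (intro L2_nth L2_diff weak_gradD(2)[OF G] weak_gradD(2)[OF H])
    fix \<phi> :: "real^'a \<Rightarrow> real" assume \<phi>: "test_fun D \<phi>"
    note int = L2_integrable_scaleR[OF L2_test_fun[OF \<phi> D'] weak_gradD(2)[OF G]]
      L2_integrable_scaleR[OF L2_test_fun[OF \<phi> D'] weak_gradD(2)[OF H]]
    have "(\<integral>x. \<phi> x *\<^sub>R G x - \<phi> x *\<^sub>R H x \<partial>lebesgue_on D) = 0"
      using int weak_gradD(3)[OF G \<phi>] weak_gradD(3)[OF H \<phi>]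
      by (subst Bochner_Integration.integral_diff) auto
    then have "(\<integral>x. (\<phi> x *\<^sub>R G x - \<phi> x *\<^sub>R H x) $ i \<partial>lebesgue_on D) = 0"
      using int by (subst integral_nth[symmetric]) auto
    also have "(\<lambda>x. (\<phi> x *\<^sub>R G x - \<phi> x *\<^sub>R H x) $ i) = (\<lambda>x. (G x - H x) $ i * \<phi> x)"
      by (simp add: algebra_simps)
    finally show "(\<integral>x. (G x - H x) $ i * \<phi> x \<partial>lebesgue_on D) = 0" .
  qed
  then have "AE x in lebesgue_on D. \<forall>i\<in>UNIV. (G x - H x) $ i = 0"
    by (intro AE_finite_allI) auto
  then show ?thesis by eventually_elim (simp add: vec_eq_iff)
qed

lemma weak_div_unique:
  assumes D: "open D" and G: "weak_div D v G" and H: "weak_div D v H"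
  shows "AE x in lebesgue_on D. G x = H x"
proof -
  have D': "D \<in> sets lebesgue" using D by auto
  have "AE x in lebesgue_on D. G x - H x = 0"
  proof (rule fundamental_lemma_lebesgue[OF D])
    show "L2 (lebesgue_on D) (\<lambda>x. G x - H x)"
      by (intro L2_diff weak_divD(2)[OF G] weak_divD(2)[OF H])
    fix \<phi> :: "real^'a \<Rightarrow> real" assume \<phi>: "test_fun D \<phi>"
    note int = L2_integrable_mult[OF weak_divD(2)[OF G] L2_test_fun[OF \<phi> D']]
      L2_integrable_mult[OF weak_divD(2)[OF H] L2_test_fun[OF \<phi> D']]
    have "(\<integral>x. G x * \<phi> x - H x * \<phi> x \<partial>lebesgue_on D) = 0"
      using int weak_divD(3)[OF G \<phi>] weak_divD(3)[OF H \<phi>]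
      by (subst Bochner_Integration.integral_diff) auto
    then show "(\<integral>x. (G x - H x) * \<phi> x \<partial>lebesgue_on D) = 0" by (simp add: algebra_simps)
  qed
  then show ?thesis by eventually_elim simp
qed

lemma wgrad_AE:
  assumes "open D" "weak_grad D v G" shows "AE x in lebesgue_on D. wgrad D v x = G x"
  by (rule weak_grad_unique[OF assms(1) weak_grad_wgrad[OF assms(2)] assms(2)])

lemma wdiv_AE:
  assumes "open D" "weak_div D \<sigma> \<delta>" shows "AE x in lebesgue_on D. wdiv D \<sigma> x = \<delta> x"
  by (rule weak_div_unique[OF assms(1) weak_div_wdiv[OF assms(2)] assms(2)])

lemma weak_grad_subset:
  assumes D: "open D" "open E" "E \<subseteq> D" and v: "weak_grad D v G"
  shows "weak_grad E v G"
  unfolding weak_grad_def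
proof (intro conjI allI impI)
  have s: "E \<in> sets lebesgue" "D \<in> sets lebesgue" using D by auto
  show "L2 (lebesgue_on E) v" "L2 (lebesgue_on E) G"
    using L2_lebesgue_on_subset[OF s D(3)] weak_gradD(1,2)[OF v] by blast+
  fix \<phi> :: "real^'a \<Rightarrow> real" assume \<phi>: "test_fun E \<phi>"
  have "(\<integral>x. v x *\<^sub>R grad \<phi> x \<partial>lebesgue_on D) = (\<integral>x. v x *\<^sub>R grad \<phi> x \<partial>lebesgue_on E)"
    by (rule integral_lebesgue_on_support[OF s D(3)]) (simp add: test_fun_outside[OF \<phi>])
  moreover have "(\<integral>x. \<phi> x *\<^sub>R G x \<partial>lebesgue_on D) = (\<integral>x. \<phi> x *\<^sub>R G x \<partial>lebesgue_on E)"
    by (rule integral_lebesgue_on_support[OF s D(3)]) (simp add: test_fun_outside[OF \<phi>])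
  ultimately show "(\<integral>x. v x *\<^sub>R grad \<phi> x \<partial>lebesgue_on E) = - (\<integral>x. \<phi> x *\<^sub>R G x \<partial>lebesgue_on E)"
    using weak_gradD(3)[OF v test_fun_mono[OF \<phi> D(3)]] by simp
qed

lemma weak_div_subset:
  assumes D: "open D" "open E" "E \<subseteq> D" and v: "weak_div D \<sigma> \<delta>"
  shows "weak_div E \<sigma> \<delta>"
  unfolding weak_div_def
proof (intro conjI allI impI)
  have s: "E \<in> sets lebesgue" "D \<in> sets lebesgue" using D by auto
  show "L2 (lebesgue_on E) \<sigma>" "L2 (lebesgue_on E) \<delta>"
    using L2_lebesgue_on_subset[OF s D(3)] weak_divD(1,2)[OF v] by blast+
  fix \<phi> :: "real^'a \<Rightarrow> real" assume \<phi>: "test_fun E \<phi>"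
  have "(\<integral>x. \<sigma> x \<bullet> grad \<phi> x \<partial>lebesgue_on D) = (\<integral>x. \<sigma> x \<bullet> grad \<phi> x \<partial>lebesgue_on E)"
    by (rule integral_lebesgue_on_support[OF s D(3)]) (simp add: test_fun_outside[OF \<phi>])
  moreover have "(\<integral>x. \<delta> x * \<phi> x \<partial>lebesgue_on D) = (\<integral>x. \<delta> x * \<phi> x \<partial>lebesgue_on E)"
    by (rule integral_lebesgue_on_support[OF s D(3)]) (simp add: test_fun_outside[OF \<phi>])
  ultimately show "(\<integral>x. \<sigma> x \<bullet> grad \<phi> x \<partial>lebesgue_on E) = - (\<integral>x. \<delta> x * \<phi> x \<partial>lebesgue_on E)"
    using weak_divD(3)[OF v test_fun_mono[OF \<phi> D(3)]] by simp
qed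

lemma weak_grad_diff:
  assumes D: "open D" and v: "weak_grad D v G" and w: "weak_grad D w H"
  shows "weak_grad D (\<lambda>x. v x - w x) (\<lambda>x. G x - H x)"
  unfolding weak_grad_def
proof (intro conjI allI impI)
  have s: "D \<in> sets lebesgue" using D by auto
  note v' = weak_gradD[OF v] and w' = weak_gradD[OF w]
  show "L2 (lebesgue_on D) (\<lambda>x. v x - w x)" "L2 (lebesgue_on D) (\<lambda>x. G x - H x)"
    by (intro L2_diff v' w')+
  fix \<phi> :: "real^'a \<Rightarrow> real" assume \<phi>: "test_fun D \<phi>"
  show "(\<integral>x. (v x - w x) *\<^sub>R grad \<phi> x \<partial>lebesgue_on D) = - (\<integral>x. \<phi> x *\<^sub>R (G x - H x) \<partial>lebesgue_on D)"
    using v'(3)[OF \<phi>] w'(3)[OF \<phi>]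
      L2_integrable_scaleR[OF v'(1) L2_grad_test_fun[OF \<phi> s]]
      L2_integrable_scaleR[OF w'(1) L2_grad_test_fun[OF \<phi> s]]
      L2_integrable_scaleR[OF L2_test_fun[OF \<phi> s] v'(2)]
      L2_integrable_scaleR[OF L2_test_fun[OF \<phi> s] w'(2)]
    by (simp add: scaleR_diff_left scaleR_diff_right Bochner_Integration.integral_diff)
qed

lemma weak_div_diff:
  assumes D: "open D" and v: "weak_div D v G" and w: "weak_div D w H"
  shows "weak_div D (\<lambda>x. v x - w x) (\<lambda>x. G x - H x)"
  unfolding weak_div_def
proof (intro conjI allI impI)
  have s: "D \<in> sets lebesgue" using D by auto
  note v' = weak_divD[OF v] and w' = weak_divD[OF w]
  show "L2 (lebesgue_on D) (\<lambda>x. v x - w x)" "L2 (lebesgue_on D) (\<lambda>x. G x - H x)"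
    by (intro L2_diff v' w')+
  fix \<phi> :: "real^'a \<Rightarrow> real" assume \<phi>: "test_fun D \<phi>"
  show "(\<integral>x. (v x - w x) \<bullet> grad \<phi> x \<partial>lebesgue_on D) = - (\<integral>x. (G x - H x) * \<phi> x \<partial>lebesgue_on D)"
    using v'(3)[OF \<phi>] w'(3)[OF \<phi>]
      L2_integrable_inner[OF v'(1) L2_grad_test_fun[OF \<phi> s]]
      L2_integrable_inner[OF w'(1) L2_grad_test_fun[OF \<phi> s]]
      L2_integrable_mult[OF v'(2) L2_test_fun[OF \<phi> s]]
      L2_integrable_mult[OF w'(2) L2_test_fun[OF \<phi> s]]
    by (simp add: inner_diff_left left_diff_distrib Bochner_Integration.integral_diff)
qed

lemma weak_grad_cong:
  assumes "\<And>x. x \<in> D \<Longrightarrow> v x = w x" "\<And>x. x \<in> D \<Longrightarrow> G x = H x"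
  shows "weak_grad D v G \<longleftrightarrow> weak_grad D w H"
proof -
  have "L2 (lebesgue_on D) v = L2 (lebesgue_on D) w" "L2 (lebesgue_on D) G = L2 (lebesgue_on D) H"
    by (rule L2_cong; simp add: assms)+
  moreover have "(\<integral>x. v x *\<^sub>R grad \<phi> x \<partial>lebesgue_on D) = (\<integral>x. w x *\<^sub>R grad \<phi> x \<partial>lebesgue_on D)"
    "(\<integral>x. \<phi> x *\<^sub>R G x \<partial>lebesgue_on D) = (\<integral>x. \<phi> x *\<^sub>R H x \<partial>lebesgue_on D)" for \<phi>
    by (rule Bochner_Integration.integral_cong; simp add: assms)+
  ultimately show ?thesis unfolding weak_grad_def by simp
qed

lemma weak_div_cong:
  assumes "\<And>x. x \<in> D \<Longrightarrow> v x = w x" "\<And>x. x \<in> D \<Longrightarrow> G x = H x"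
  shows "weak_div D v G \<longleftrightarrow> weak_div D w H"
proof -
  have "L2 (lebesgue_on D) v = L2 (lebesgue_on D) w" "L2 (lebesgue_on D) G = L2 (lebesgue_on D) H"
    by (rule L2_cong; simp add: assms)+
  moreover have "(\<integral>x. v x \<bullet> grad \<phi> x \<partial>lebesgue_on D) = (\<integral>x. w x \<bullet> grad \<phi> x \<partial>lebesgue_on D)"
    "(\<integral>x. G x * \<phi> x \<partial>lebesgue_on D) = (\<integral>x. H x * \<phi> x \<partial>lebesgue_on D)" for \<phi>
    by (rule Bochner_Integration.integral_cong; simp add: assms)+
  ultimately show ?thesis unfolding weak_div_def by simp
qed

lemma smooth_L2:
  fixes P :: "real^'n \<Rightarrow> real"
  assumes "smooth P" "D \<in> sets lebesgue" "bounded D"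
  shows "L2 (lebesgue_on D) P" "L2 (lebesgue_on D) (grad P)"
  by (intro L2_continuous_bounded_set assms smooth_continuous continuous_on_grad)+

lemma integral_test_fun_outside:
  fixes F :: "real^'n \<Rightarrow> real"
  assumes "open D" "\<And>x. x \<notin> D \<Longrightarrow> F x = 0" "F \<in> borel_measurable borel"
  shows "(\<integral>x. F x \<partial>lebesgue_on D) = (\<integral>x. F x \<partial>lborel)"
proof -
  have "(\<lambda>x. indicator D x *\<^sub>R F x) = F" using assms(2) by (auto simp: indicator_def fun_eq_iff)
  then show ?thesis using assms by (simp add: integral_lebesgue_on_borel)
qed

lemma grad_mult_inner:
  assumes "smooth P" "test_fun D \<phi>"
  shows "grad (\<lambda>x. P x * \<phi> x) x \<bullet> v = P x * (grad \<phi> x \<bullet> v) + \<phi> x * (grad P x \<bullet> v)"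
  using grad_mult[OF assms(1) test_fun_smooth[OF assms(2)]] by (simp add: inner_add_left)

text \<open>
  The product is a test function, and the directional derivatives of test functions integrate to
  zero.
\<close>
lemma integral_by_parts_smooth:
  fixes P \<phi> :: "real^'n \<Rightarrow> real"
  assumes D: "open D" and P: "smooth P" and \<phi>: "test_fun D \<phi>"
  shows "(\<integral>x. P x * (grad \<phi> x \<bullet> v) + \<phi> x * (grad P x \<bullet> v) \<partial>lebesgue_on D) = 0"
proof -
  note w = test_fun_mult[OF P \<phi>]
  have "(\<integral>x. grad (\<lambda>x. P x * \<phi> x) x \<bullet> v \<partial>lebesgue_on D) = (\<integral>x. grad (\<lambda>x. P x * \<phi> x) x \<bullet> v \<partial>lborel)"
    using borel_measurable_integrable[OF integrable_grad_test_fun[OF w, of v]] test_fun_outside(2)[OF w]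
    by (intro integral_test_fun_outside[OF D]) auto
  also have "\<dots> = 0" by (rule integral_grad_test_fun[OF w])
  finally show ?thesis by (simp add: grad_mult_inner[OF P \<phi>])
qed

lemma weak_grad_smooth_L2:
  fixes P :: "real^'n \<Rightarrow> real"
  assumes D: "open D" and P: "smooth P" and L2: "L2 (lebesgue_on D) P" "L2 (lebesgue_on D) (grad P)"
  shows "weak_grad D P (grad P)"
  unfolding weak_grad_def
proof (intro conjI allI impI L2)
  have s: "D \<in> sets lebesgue" using D by auto
  fix \<phi> :: "real^'n \<Rightarrow> real" assume \<phi>: "test_fun D \<phi>"
  note int = L2_integrable_scaleR[OF L2(1) L2_grad_test_fun[OF \<phi> s]]
    L2_integrable_scaleR[OF L2_test_fun[OF \<phi> s] L2(2)]
  have "(\<integral>x. P x *\<^sub>R grad \<phi> x + \<phi> x *\<^sub>R grad P x \<partial>lebesgue_on D) $ i = 0" for i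
    using integral_by_parts_smooth[OF D P \<phi>, of "axis i 1"] int
    by (subst integral_nth) (auto simp: inner_axis)
  then have "(\<integral>x. P x *\<^sub>R grad \<phi> x + \<phi> x *\<^sub>R grad P x \<partial>lebesgue_on D) = 0"
    by (simp add: vec_eq_iff)
  then show "(\<integral>x. P x *\<^sub>R grad \<phi> x \<partial>lebesgue_on D) = - (\<integral>x. \<phi> x *\<^sub>R grad P x \<partial>lebesgue_on D)"
    using int by (simp add: eq_neg_iff_add_eq_0)
qed

lemma weak_grad_smooth:
  fixes P :: "real^'n \<Rightarrow> real"
  assumes D: "open D" "bounded D" and P: "smooth P"
  shows "weak_grad D P (grad P)"
  by (rule weak_grad_smooth_L2[OF D(1) P smooth_L2(1)[OF P _ D(2)] smooth_L2(2)[OF P _ D(2)]]) (use D in auto)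

lemma has_derivative_field:
  fixes Q :: "real^'n \<Rightarrow> real^'n"
  assumes "\<And>i. smooth (\<lambda>x. Q x $ i)"
  shows "(Q has_derivative (\<lambda>v. \<chi> i. grad (\<lambda>x. Q x $ i) x \<bullet> v)) (at x)"
proof (subst has_derivative_componentwise_within, rule ballI)
  fix b :: "real^'n" assume "b \<in> Basis"
  then obtain i where "b = axis i 1" by (auto simp: Basis_vec_def)
  then show "((\<lambda>x. Q x \<bullet> b) has_derivative (\<lambda>v. (\<chi> i. grad (\<lambda>x. Q x $ i) x \<bullet> v) \<bullet> b)) (at x)"
    using smooth_has_derivative[OF assms[of i]] by (simp add: inner_axis)
qed

lemma divg_field:
  fixes Q :: "real^'n \<Rightarrow> real^'n"
  assumes "\<And>i. smooth (\<lambda>x. Q x $ i)"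
  shows "divg Q x = (\<Sum>i\<in>UNIV. grad (\<lambda>x. Q x $ i) x \<bullet> axis i 1)"
  using frechet_derivative_at[OF has_derivative_field[OF assms], symmetric]
  by (simp add: divg_def)

lemma smooth_divg:
  fixes Q :: "real^'n \<Rightarrow> real^'n"
  assumes "\<And>i. smooth (\<lambda>x. Q x $ i)" shows "smooth (divg Q)"
proof -
  have "divg Q = (\<lambda>x. \<Sum>i\<in>UNIV. grad (\<lambda>x. Q x $ i) x \<bullet> axis i 1)"
    by (rule ext) (rule divg_field[OF assms])
  then show ?thesis by (simp only:) (intro smooth_sum smooth_grad_inner assms)
qed

lemma continuous_on_field:
  fixes Q :: "real^'n \<Rightarrow> real^'n"
  assumes "\<And>i. smooth (\<lambda>x. Q x $ i)" shows "continuous_on A Q"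
proof -
  have "continuous_on A (\<lambda>x. \<chi> i. Q x $ i)"
    by (intro continuous_on_vec_lambda smooth_continuous assms)
  then show ?thesis by simp
qed

lemma divg_mult_test_fun:
  fixes Q :: "real^'n \<Rightarrow> real^'n"
  assumes Q: "\<And>i. smooth (\<lambda>x. Q x $ i)" and \<phi>: "test_fun D \<phi>"
  shows "Q x \<bullet> grad \<phi> x + divg Q x * \<phi> x = (\<Sum>i\<in>UNIV. grad (\<lambda>x. Q x $ i * \<phi> x) x \<bullet> axis i 1)"
  unfolding grad_mult_inner[OF Q \<phi>]
  by (simp add: divg_field[OF Q] sum.distrib inner_vec_def[of "Q x"] sum_distrib_left inner_axis mult.commute)

lemma weak_div_smooth:
  fixes Q :: "real^'n \<Rightarrow> real^'n"
  assumes D: "open D" "bounded D" and Q: "\<And>i. smooth (\<lambda>x. Q x $ i)"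
  shows "weak_div D Q (divg Q)"
  unfolding weak_div_def
proof (intro conjI allI impI)
  have s: "D \<in> sets lebesgue" using D by auto
  show L2: "L2 (lebesgue_on D) Q" "L2 (lebesgue_on D) (divg Q)"
    by (intro L2_continuous_bounded_set[OF s D(2)] continuous_on_field smooth_continuous smooth_divg Q)+
  fix \<phi> :: "real^'n \<Rightarrow> real" assume \<phi>: "test_fun D \<phi>"
  note int = L2_integrable_inner[OF L2(1) L2_grad_test_fun[OF \<phi> s]]
    L2_integrable_mult[OF L2(2) L2_test_fun[OF \<phi> s]]
  note w = test_fun_mult[OF Q \<phi>]
  have "(\<integral>x. Q x \<bullet> grad \<phi> x + divg Q x * \<phi> x \<partial>lebesgue_on D) =
      (\<integral>x. (\<Sum>i\<in>UNIV. grad (\<lambda>x. Q x $ i * \<phi> x) x \<bullet> axis i 1) \<partial>lebesgue_on D)"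
    by (simp only: divg_mult_test_fun[OF Q \<phi>])
  also have "\<dots> = (\<Sum>i\<in>UNIV. \<integral>x. grad (\<lambda>x. Q x $ i * \<phi> x) x \<bullet> axis i 1 \<partial>lebesgue_on D)"
    by (rule Bochner_Integration.integral_sum)
      (rule integrable_lebesgue_on_borel[OF s integrable_grad_test_fun[OF w]])
  also have "\<dots> = 0"
    using integral_by_parts_smooth[OF D(1) Q \<phi>]
    by (intro sum.neutral ballI) (simp only: grad_mult_inner[OF Q \<phi>])
  finally show "(\<integral>x. Q x \<bullet> grad \<phi> x \<partial>lebesgue_on D) = - (\<integral>x. divg Q x * \<phi> x \<partial>lebesgue_on D)"
    using int by simp
qed

text \<open>
  The constant sequence approximates a test function in \<open>H\<^sup>1\<close>.
\<close>
lemma H10_test_fun: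
  assumes D: "open D" and \<phi>: "test_fun D \<phi>"
  shows "H10 D \<phi>" "AE x in lebesgue_on D. wgrad D \<phi> x = grad \<phi> x"
proof -
  have s: "D \<in> sets lebesgue" using D by auto
  have wg: "weak_grad D \<phi> (grad \<phi>)"
    by (rule weak_grad_smooth_L2[OF D test_fun_smooth[OF \<phi>] L2_test_fun[OF \<phi> s] L2_grad_test_fun[OF \<phi> s]])
  show ae: "AE x in lebesgue_on D. wgrad D \<phi> x = grad \<phi> x"
    by (rule wgrad_AE[OF D wg])
  have "L2norm (lebesgue_on D) (\<lambda>x. grad \<phi> x - wgrad D \<phi> x) = 0"
  proof -
    have "(\<integral>x. (norm (grad \<phi> x - wgrad D \<phi> x))\<^sup>2 \<partial>lebesgue_on D) = 0"
      by (rule integral_eq_zero_AE) (use ae in \<open>auto elim!: eventually_mono\<close>)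
    then show ?thesis by (simp add: L2norm_def)
  qed
  then have "H1_lim D (\<lambda>k. \<phi>) \<phi>" by (simp add: H1_lim_def L2norm_def)
  then show "H10 D \<phi>" using wg \<phi> unfolding H10_def H1_def
    by (intro conjI exI[of _ "\<lambda>k. \<phi>"] exI[of _ "grad \<phi>"]) simp_all
qed

lemma L2_continuous_inner:
  fixes \<beta> g :: "real^'n \<Rightarrow> real^'n"
  assumes \<Omega>: "bounded \<Omega>" and \<beta>: "continuous_on (closure \<Omega>) \<beta>"
    and S: "S \<in> sets lebesgue" "S \<subseteq> closure \<Omega>" and g: "L2 (lebesgue_on S) g"
  shows "L2 (lebesgue_on S) (\<lambda>x. \<beta> x \<bullet> g x)"
proof -
  have \<beta>m: "\<beta> \<in> borel_measurable (lebesgue_on S)"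
    by (rule continuous_imp_measurable_on_sets_lebesgue[OF continuous_on_subset[OF \<beta> S(2)] S(1)])
  have "compact (\<beta> ` closure \<Omega>)"
    using \<Omega> by (intro compact_continuous_image \<beta>) (simp add: compact_closure)
  then obtain B where B: "\<And>x. x \<in> closure \<Omega> \<Longrightarrow> norm (\<beta> x) \<le> B"
    by (meson bounded_iff compact_imp_bounded imageI)
  show ?thesis
  proof (rule L2_bound[OF g])
    show "(\<lambda>x. \<beta> x \<bullet> g x) \<in> borel_measurable (lebesgue_on S)"
      by (rule borel_measurable_inner[OF \<beta>m L2_borel_measurable[OF g]])
    show "AE x in lebesgue_on S. norm (\<beta> x \<bullet> g x) \<le> B * norm (g x)"
    proof (rule AE_I2)
      fix x assume "x \<in> space (lebesgue_on S)"
      then have "x \<in> closure \<Omega>" using S(2) by auto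
      then show "norm (\<beta> x \<bullet> g x) \<le> B * norm (g x)"
        using Cauchy_Schwarz_ineq2[of "\<beta> x" "g x"] mult_right_mono[OF B, of x "norm (g x)"]
        by simp
    qed
  qed
qed

text \<open>
  The weak formulation, tested with test functions only, says that
  \<open>f - \<beta> \<bullet> \<nabla>u - c u\<close> is the weak divergence of the flux.
\<close>
lemma weak_solution_weak_div:
  assumes D: "open \<Omega>" "bounded \<Omega>"
    and \<beta>: "continuous_on (closure \<Omega>) \<beta>" and c: "Linf (lebesgue_on \<Omega>) c"
    and f: "L2 (lebesgue_on \<Omega>) f" and u: "weak_solution \<Omega> \<epsilon> \<beta> c f g u"
  shows "weak_grad \<Omega> u (wgrad \<Omega> u)"
    and "weak_div \<Omega> (\<lambda>x. - \<epsilon> *\<^sub>R wgrad \<Omega> u x) (\<lambda>x. f x - \<beta> x \<bullet> wgrad \<Omega> u x - c x * u x)"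
proof -
  have s: "\<Omega> \<in> sets lebesgue" using D by auto
  show wg: "weak_grad \<Omega> u (wgrad \<Omega> u)"
    using u weak_grad_wgrad unfolding weak_solution_def has_trace_def H1_def by blast
  note u' = weak_gradD[OF wg]
  have L\<beta>: "L2 (lebesgue_on \<Omega>) (\<lambda>x. \<beta> x \<bullet> wgrad \<Omega> u x)"
    by (rule L2_continuous_inner[OF D(2) \<beta> s closure_subset u'(2)])
  obtain K where K: "AE x in lebesgue_on \<Omega>. norm (c x) \<le> K" and cm: "c \<in> borel_measurable (lebesgue_on \<Omega>)"
    using c unfolding Linf_def by blast
  have Lc: "L2 (lebesgue_on \<Omega>) (\<lambda>x. c x * u x)"
  proof (rule L2_bound[OF u'(1)])
    show "(\<lambda>x. c x * u x) \<in> borel_measurable (lebesgue_on \<Omega>)"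
      by (rule borel_measurable_times[OF cm L2_borel_measurable[OF u'(1)]])
    show "AE x in lebesgue_on \<Omega>. norm (c x * u x) \<le> K * norm (u x)"
      using K by eventually_elim (simp add: abs_mult mult_right_mono)
  qed
  show "weak_div \<Omega> (\<lambda>x. - \<epsilon> *\<^sub>R wgrad \<Omega> u x) (\<lambda>x. f x - \<beta> x \<bullet> wgrad \<Omega> u x - c x * u x)"
    unfolding weak_div_def
  proof (intro conjI allI impI)
    show "L2 (lebesgue_on \<Omega>) (\<lambda>x. - \<epsilon> *\<^sub>R wgrad \<Omega> u x)"
      by (rule L2_scaleR[OF u'(2)])
    show "L2 (lebesgue_on \<Omega>) (\<lambda>x. f x - \<beta> x \<bullet> wgrad \<Omega> u x - c x * u x)"
      by (intro L2_diff f L\<beta> Lc)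
    fix \<phi> :: "real^'a \<Rightarrow> real" assume \<phi>: "test_fun \<Omega> \<phi>"
    note T = L2_test_fun[OF \<phi> s] L2_grad_test_fun[OF \<phi> s]
    have wm: "weak_grad \<Omega> \<phi> (wgrad \<Omega> \<phi>)"
      using H10_test_fun(1)[OF D(1) \<phi>] weak_grad_wgrad unfolding H10_def H1_def by blast
    have Lg: "L2 (lebesgue_on \<Omega>) (\<lambda>x. \<beta> x \<bullet> wgrad \<Omega> u x + c x * u x)"
      by (intro L2_add L\<beta> Lc)
    note i1 = L2_integrable_inner[OF u'(2) T(2)] and i2 = L2_integrable_mult[OF Lg T(1)]
      and i3 = L2_integrable_mult[OF f T(1)]
    have "(\<integral>x. f x * \<phi> x \<partial>lebesgue_on \<Omega>) =
        (\<integral>x. \<epsilon> * (wgrad \<Omega> u x \<bullet> wgrad \<Omega> \<phi> x) + (\<beta> x \<bullet> wgrad \<Omega> u x + c x * u x) * \<phi> x \<partial>lebesgue_on \<Omega>)"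
      using u H10_test_fun(1)[OF D(1) \<phi>] unfolding weak_solution_def by simp
    also have "\<dots> = (\<integral>x. \<epsilon> * (wgrad \<Omega> u x \<bullet> grad \<phi> x) + (\<beta> x \<bullet> wgrad \<Omega> u x + c x * u x) * \<phi> x \<partial>lebesgue_on \<Omega>)"
    proof (rule integral_cong_AE)
      show "(\<lambda>x. \<epsilon> * (wgrad \<Omega> u x \<bullet> wgrad \<Omega> \<phi> x) + (\<beta> x \<bullet> wgrad \<Omega> u x + c x * u x) * \<phi> x) \<in> borel_measurable (lebesgue_on \<Omega>)"
        using L2_integrable_inner[OF u'(2) weak_gradD(2)[OF wm]] i2
        by (intro borel_measurable_integrable) simp
      show "(\<lambda>x. \<epsilon> * (wgrad \<Omega> u x \<bullet> grad \<phi> x) + (\<beta> x \<bullet> wgrad \<Omega> u x + c x * u x) * \<phi> x) \<in> borel_measurable (lebesgue_on \<Omega>)"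
        using i1 i2 by (intro borel_measurable_integrable) simp
      show "AE x in lebesgue_on \<Omega>. \<epsilon> * (wgrad \<Omega> u x \<bullet> wgrad \<Omega> \<phi> x) + (\<beta> x \<bullet> wgrad \<Omega> u x + c x * u x) * \<phi> x =
          \<epsilon> * (wgrad \<Omega> u x \<bullet> grad \<phi> x) + (\<beta> x \<bullet> wgrad \<Omega> u x + c x * u x) * \<phi> x"
        using H10_test_fun(2)[OF D(1) \<phi>] by eventually_elim simp
    qed
    also have "\<dots> = \<epsilon> * (\<integral>x. wgrad \<Omega> u x \<bullet> grad \<phi> x \<partial>lebesgue_on \<Omega>) +
        (\<integral>x. (\<beta> x \<bullet> wgrad \<Omega> u x + c x * u x) * \<phi> x \<partial>lebesgue_on \<Omega>)"
      using i1 i2 by simp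
    finally have eq: "(\<integral>x. f x * \<phi> x \<partial>lebesgue_on \<Omega>) = \<epsilon> * (\<integral>x. wgrad \<Omega> u x \<bullet> grad \<phi> x \<partial>lebesgue_on \<Omega>) +
        (\<integral>x. (\<beta> x \<bullet> wgrad \<Omega> u x + c x * u x) * \<phi> x \<partial>lebesgue_on \<Omega>)" .
    have "(\<integral>x. (f x - \<beta> x \<bullet> wgrad \<Omega> u x - c x * u x) * \<phi> x \<partial>lebesgue_on \<Omega>) =
      (\<integral>x. f x * \<phi> x - (\<beta> x \<bullet> wgrad \<Omega> u x + c x * u x) * \<phi> x \<partial>lebesgue_on \<Omega>)"
      by (simp add: algebra_simps)
    also have "\<dots> = \<epsilon> * (\<integral>x. wgrad \<Omega> u x \<bullet> grad \<phi> x \<partial>lebesgue_on \<Omega>)"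
      using i2 i3 eq by simp
    finally show "(\<integral>x. - \<epsilon> *\<^sub>R wgrad \<Omega> u x \<bullet> grad \<phi> x \<partial>lebesgue_on \<Omega>) =
        - (\<integral>x. (f x - \<beta> x \<bullet> wgrad \<Omega> u x - c x * u x) * \<phi> x \<partial>lebesgue_on \<Omega>)"
      by simp
  qed
qed

section \<open>The surface measure on a hyperplane\<close>

lemma borel_measurable_foot [measurable]:
  "(\<lambda>x::'a::euclidean_space. x - (n \<bullet> x - b) *\<^sub>R n) \<in> borel_measurable borel"
  by measurable

lemma emeasure_hyperplane_measure:
  fixes n :: "'a::euclidean_space"
  assumes A[measurable]: "A \<in> sets borel"
  shows "emeasure (hyperplane_measure n b) A =
    emeasure lborel {x. b \<le> n \<bullet> x \<and> n \<bullet> x \<le> b + 1 \<and> x - (n \<bullet> x - b) *\<^sub>R n \<in> A}"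
proof -
  let ?S = "{x. b \<le> n \<bullet> x \<and> n \<bullet> x \<le> b + 1}"
  have [measurable]: "(\<lambda>x. x - (n \<bullet> x - b) *\<^sub>R n) \<in> measurable (restrict_space lborel ?S) borel"
    by (rule measurable_restrict_space1) simp
  have "emeasure (hyperplane_measure n b) A =
      emeasure (restrict_space lborel ?S) ((\<lambda>x. x - (n \<bullet> x - b) *\<^sub>R n) -` A \<inter> ?S)"
    unfolding hyperplane_measure_def by (subst emeasure_distr) (auto simp: space_restrict_space)
  also have "\<dots> = emeasure lborel ((\<lambda>x. x - (n \<bullet> x - b) *\<^sub>R n) -` A \<inter> ?S)"
    by (rule emeasure_restrict_space) auto
  also have "(\<lambda>x. x - (n \<bullet> x - b) *\<^sub>R n) -` A \<inter> ?S =
      {x. b \<le> n \<bullet> x \<and> n \<bullet> x \<le> b + 1 \<and> x - (n \<bullet> x - b) *\<^sub>R n \<in> A}" by auto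
  finally show ?thesis .
qed

text \<open>
  The two slabs lie on either side of the hyperplane, and the translation by \<open>n\<close> maps one
  to the other without changing the foot of a point.
\<close>
lemma hyperplane_measure_flip:
  fixes n :: "'a::euclidean_space"
  assumes n: "norm n = 1" and A[measurable]: "A \<in> sets borel"
  shows "emeasure (hyperplane_measure (- n) (- b)) A = emeasure (hyperplane_measure n b) A"
proof -
  have nn: "n \<bullet> n = 1" using n by (simp add: dot_square_norm)
  let ?Z = "{x. b \<le> n \<bullet> x \<and> n \<bullet> x \<le> b + 1 \<and> x - (n \<bullet> x - b) *\<^sub>R n \<in> A}"
  have "emeasure (hyperplane_measure n b) A = emeasure (distr lborel borel ((+) n)) ?Z"
    by (simp add: emeasure_hyperplane_measure lborel_distr_plus)
  also have "\<dots> = emeasure lborel ((+) n -` ?Z)"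
    by (subst emeasure_distr) auto
  also have "(+) n -` ?Z =
      {x. - b \<le> - n \<bullet> x \<and> - n \<bullet> x \<le> - b + 1 \<and> x - (- n \<bullet> x - - b) *\<^sub>R - n \<in> A}"
    by (auto simp: inner_add_right nn algebra_simps)
  finally show ?thesis by (simp add: emeasure_hyperplane_measure)
qed

text \<open>
  The points of the slab of \<open>(m, c)\<close> whose foot lies in the hyperplane \<open>(n, b)\<close> satisfy a linear
  equation, which is not trivial unless the hyperplanes coincide.
\<close>
lemma hyperplane_measure_other_hyperplane:
  fixes n m :: "'a::euclidean_space"
  assumes n: "norm n = 1" and m: "norm m = 1" and A: "A \<in> sets borel" "A \<subseteq> {x. n \<bullet> x = b}"
    and neq: "(m, c) \<noteq> (n, b)" "(m, c) \<noteq> (- n, - b)"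
  shows "emeasure (hyperplane_measure m c) A = 0"
proof -
  let ?Z = "{x. (n - (n \<bullet> m) *\<^sub>R m) \<bullet> x = b - (n \<bullet> m) * c}"
  have mm: "m \<bullet> m = 1" using m by (simp add: dot_square_norm)
  have "negligible ?Z"
  proof (rule negligible_hyperplane, rule ccontr)
    assume *: "\<not> (n - (n \<bullet> m) *\<^sub>R m \<noteq> 0 \<or> b - (n \<bullet> m) * c \<noteq> 0)"
    then have nm: "n = (n \<bullet> m) *\<^sub>R m" "b = (n \<bullet> m) * c" by auto
    from nm(1) have "\<bar>n \<bullet> m\<bar> = 1" using n m by (metis mult.right_neutral norm_scaleR)
    then consider "n \<bullet> m = 1" | "n \<bullet> m = - 1" by linarith
    then show False using nm neq by cases auto
  qed
  then have "?Z \<in> null_sets lborel"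
    by (subst null_sets_completion_iff[symmetric]) (auto simp: negligible_iff_null_sets)
  moreover have "{x. c \<le> m \<bullet> x \<and> m \<bullet> x \<le> c + 1 \<and> x - (m \<bullet> x - c) *\<^sub>R m \<in> A} \<subseteq> ?Z"
    using A(2) by (auto simp: inner_diff_left inner_diff_right algebra_simps)
  ultimately have "emeasure lborel {x. c \<le> m \<bullet> x \<and> m \<bullet> x \<le> c + 1 \<and> x - (m \<bullet> x - c) *\<^sub>R m \<in> A} = 0"
    using emeasure_mono[of _ ?Z lborel] by (auto simp: null_sets_def)
  then show ?thesis using A by (simp add: emeasure_hyperplane_measure)
qed

text \<open>
  Of the sum over all hyperplanes only the two representations of the given one remain, and the factor
  \<open>1/2\<close> in the definition accounts for counting it twice.
\<close>
lemma emeasure_surface_measure_hyperplane: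
  fixes n :: "'a::euclidean_space"
  assumes n: "norm n = 1" and A: "A \<in> sets borel" "A \<subseteq> {x. n \<bullet> x = b}"
  shows "emeasure surface_measure A = emeasure (hyperplane_measure n b) A"
proof -
  have n0: "n \<noteq> - n"
  proof
    assume "n = - n"
    then have "n \<bullet> n = - (n \<bullet> n)" by (metis inner_minus_left)
    then show False using n by (simp add: dot_square_norm)
  qed
  have "(\<integral>\<^sup>+ (m, c). emeasure (hyperplane_measure m c) A \<partial>count_space {(m, c). norm m = 1}) =
      (\<Sum>(m, c)\<in>{(n, b), (- n, - b)}. emeasure (hyperplane_measure m c) A)"
  proof (rule nn_integral_count_space')
    fix x :: "'a \<times> real" assume "x \<in> {(m, c). norm m = 1}" "x \<notin> {(n, b), (- n, - b)}"
    then show "(case x of (m, c) \<Rightarrow> emeasure (hyperplane_measure m c) A) = 0"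
      by (cases x) (auto intro!: hyperplane_measure_other_hyperplane[OF n _ A])
  qed (use n in auto)
  also have "\<dots> = 2 * emeasure (hyperplane_measure n b) A"
    using n0 by (simp add: hyperplane_measure_flip[OF n A(1)] mult_2)
  finally show ?thesis
    using A(1) mult_divide_eq_ennreal[of 2 "emeasure (hyperplane_measure n b) A"]
    by (simp add: emeasure_surface_measure mult.commute)
qed

lemma surface_on_eq_hyperplane:
  fixes n :: "'a::euclidean_space"
  assumes n: "norm n = 1" and F: "F \<in> sets borel" "F \<subseteq> {x. n \<bullet> x = b}"
  shows "surface_on F = restrict_space (hyperplane_measure n b) F"
proof (rule measure_eqI)
  have s: "sets (surface_measure :: 'a measure) = sets borel"
    by (simp add: surface_measure_def sets_measure_of_conv sigma_algebra.sigma_sets_eq[OF sets.sigma_algebra_axioms[of borel, simplified]])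
  show "sets (surface_on F) = sets (restrict_space (hyperplane_measure n b) F)"
    by (simp add: sets_restrict_space s)
  fix A assume "A \<in> sets (surface_on F)"
  then have A: "A \<in> sets borel" "A \<subseteq> F"
    using F(1) by (auto simp: sets_restrict_space s)
  have sp: "space (surface_measure :: 'a measure) = UNIV"
    using sets_eq_imp_space_eq[OF s] by simp
  show "emeasure (surface_on F) A = emeasure (restrict_space (hyperplane_measure n b) F) A"
    using A F by (simp add: emeasure_restrict_space s sp emeasure_surface_measure_hyperplane[OF n])
qed

lemma emeasure_hyperplane_bounded_finite:
  fixes n :: "'a::euclidean_space"
  assumes n: "norm n = 1" and A: "A \<in> sets borel" "bounded A"
  shows "emeasure (hyperplane_measure n b) A < \<infinity>"
proof -
  obtain R where R: "\<And>x. x \<in> A \<Longrightarrow> norm x \<le> R" using A(2) bounded_iff by blast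
  have "bounded {x. b \<le> n \<bullet> x \<and> n \<bullet> x \<le> b + 1 \<and> x - (n \<bullet> x - b) *\<^sub>R n \<in> A}"
  proof (rule boundedI[of _ "R + 1"])
    fix x assume "x \<in> {x. b \<le> n \<bullet> x \<and> n \<bullet> x \<le> b + 1 \<and> x - (n \<bullet> x - b) *\<^sub>R n \<in> A}"
    then have "norm (x - (n \<bullet> x - b) *\<^sub>R n) \<le> R" "norm ((n \<bullet> x - b) *\<^sub>R n) \<le> 1"
      using R n by auto
    then show "norm x \<le> R + 1"
      using norm_triangle_ineq[of "x - (n \<bullet> x - b) *\<^sub>R n" "(n \<bullet> x - b) *\<^sub>R n"] by simp
  qed
  from emeasure_bounded_finite[OF this] show ?thesis
    using A(1) by (simp add: emeasure_hyperplane_measure)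
qed

text \<open>
  The points whose foot lies in \<open>F\<close> form a convex set, a cylinder over \<open>F\<close>. Those with foot in the
  relative boundary lie on the frontier of the cylinder, and frontiers of convex sets are
  negligible.
\<close>
lemma AE_hyperplane_rel_interior:
  fixes n :: "'a::euclidean_space"
  assumes n: "norm n = 1" and F: "convex F" "closed F" "affine hull F = {x. n \<bullet> x = b}"
  shows "AE x in hyperplane_measure n b. x \<in> F \<longrightarrow> x \<in> rel_interior F"
proof -
  let ?p = "\<lambda>x. x - (n \<bullet> x - b) *\<^sub>R n"
  have cont: "continuous_on UNIV ?p" by (intro continuous_intros)
  obtain U where U: "open U" "rel_interior F = U \<inter> affine hull F"
    using openin_rel_interior[of F] by (auto simp: openin_open)
  have riF: "rel_interior F \<in> sets borel"
    unfolding U(2) using U(1) by (intro sets.Int borel_open borel_closed affine_closed) auto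
  have N: "F - rel_interior F \<in> sets borel"
    by (intro sets.Diff borel_closed F(2) riF)
  have "convex (?p -` F)"
  proof -
    have "linear (\<lambda>x. x - (n \<bullet> x) *\<^sub>R n)"
      by (auto intro!: linearI simp: inner_add_right algebra_simps)
    then have "convex ((\<lambda>x. x - (n \<bullet> x) *\<^sub>R n) -` ((+) (- b *\<^sub>R n) ` F))"
      by (rule convex_linear_vimage) (intro convex_translation F(1))
    also have "(\<lambda>x. x - (n \<bullet> x) *\<^sub>R n) -` ((+) (- b *\<^sub>R n) ` F) = ?p -` F"
      by (auto simp: image_iff algebra_simps intro!: bexI[of _ "?p _"])
    finally show ?thesis .
  qed
  then have "negligible (frontier (?p -` F))" by (rule negligible_convex_frontier)
  moreover have "?p -` (F - rel_interior F) \<subseteq> frontier (?p -` F)"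
  proof
    fix x assume x: "x \<in> ?p -` (F - rel_interior F)"
    have "x \<notin> interior (?p -` F)"
    proof
      assume "x \<in> interior (?p -` F)"
      then obtain e where e: "e > 0" "ball x e \<subseteq> ?p -` F"
        by (meson mem_interior)
      have "ball (?p x) e \<inter> affine hull F \<subseteq> F"
      proof
        fix h assume h: "h \<in> ball (?p x) e \<inter> affine hull F"
        let ?y = "x + (h - ?p x)"
        have "n \<bullet> (h - ?p x) = 0"
          using h foot_in_hyperplane[OF n, of x b] by (simp add: F(3) inner_diff_right)
        then have "n \<bullet> ?y = n \<bullet> x" by (simp only: inner_add_right add_0_right)
        then have "?p ?y = h" by (simp only:) simp
        moreover have "?y \<in> ball x e" using h by (simp add: dist_norm algebra_simps)
        ultimately show "h \<in> F" using e(2) by (metis (no_types, lifting) subsetD vimageD)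
      qed
      then have "?p x \<in> rel_interior F"
        using x e(1) by (auto simp: mem_rel_interior_ball)
      then show False using x by simp
    qed
    then show "x \<in> frontier (?p -` F)"
      using x closure_subset[of "?p -` F"] by (auto simp: frontier_def)
  qed
  ultimately have "negligible (?p -` (F - rel_interior F))" by (auto intro: negligible_subset)
  then have "?p -` (F - rel_interior F) \<in> null_sets lborel"
    using N by (subst null_sets_completion_iff[symmetric])
      (auto simp: negligible_iff_null_sets intro!: measurable_sets_borel[OF borel_measurable_foot])
  moreover have "{x. b \<le> n \<bullet> x \<and> n \<bullet> x \<le> b + 1 \<and> ?p x \<in> F - rel_interior F} =
      ?p -` (F - rel_interior F) \<inter> {x. b \<le> n \<bullet> x \<and> n \<bullet> x \<le> b + 1}" by auto
  ultimately have "{x. b \<le> n \<bullet> x \<and> n \<bullet> x \<le> b + 1 \<and> ?p x \<in> F - rel_interior F} \<in> null_sets lborel"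
    by (simp only:) (rule null_set_Int2, simp_all)
  then have "emeasure lborel {x. b \<le> n \<bullet> x \<and> n \<bullet> x \<le> b + 1 \<and> ?p x \<in> F - rel_interior F} = 0"
    by (rule null_setsD1)
  then have "F - rel_interior F \<in> null_sets (hyperplane_measure n b)"
    using N by (simp add: emeasure_hyperplane_measure null_sets_def)
  then show ?thesis by (rule AE_I'[of "F - rel_interior F"]) auto
qed

section \<open>Facets of simplices\<close>

lemma unit_normal_unique:
  fixes n m :: "'a::euclidean_space"
  assumes n: "norm n = 1" and m: "norm m = 1" and ne: "{x. n \<bullet> x = b} \<noteq> {}"
    and sub: "{x. n \<bullet> x = b} \<subseteq> {x. m \<bullet> x = c}"
  shows "(m, c) = (n, b) \<or> (m, c) = (- n, - b)"
proof -
  have nn: "n \<bullet> n = 1" using n by (simp add: dot_square_norm)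
  obtain x where x: "n \<bullet> x = b" using ne by auto
  \<comment> \<open>the component of \<open>m\<close> tangential to the hyperplane vanishes, as both hyperplanes contain \<open>x + ?w\<close>\<close>
  let ?w = "m - (m \<bullet> n) *\<^sub>R n"
  have nw: "n \<bullet> ?w = 0" by (simp add: inner_diff_right nn inner_commute)
  then have "x + ?w \<in> {x. n \<bullet> x = b}" using x by (simp only: mem_Collect_eq inner_add_right add_0_right)
  then have "m \<bullet> (x + ?w) = m \<bullet> x" using sub x by auto
  then have "m \<bullet> ?w = 0" by (simp only: inner_add_right)
  then have "?w \<bullet> ?w = 0" using nw by (simp only: inner_diff_left inner_scaleR_left mult_zero_right diff_zero)
  then have mn: "m = (m \<bullet> n) *\<^sub>R n" by simp
  then have "\<bar>m \<bullet> n\<bar> = 1" using n m by (metis mult.right_neutral norm_scaleR)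
  then consider "m \<bullet> n = 1" | "m \<bullet> n = - 1" by linarith
  then have "m = n \<or> m = - n" using mn by cases auto
  moreover have "m \<bullet> x = c" using sub x by auto
  ultimately show ?thesis using x by auto
qed

lemma facet_hyperplane:
  fixes T :: "(real^'n) set"
  assumes T: "int CARD('n) simplex T" and F: "F facet_of T"
  obtains n b where "norm n = 1" "T \<subseteq> {x. n \<bullet> x \<le> b}" "F = T \<inter> {x. n \<bullet> x = b}"
    "affine hull F = {x. n \<bullet> x = b}" "outer_normal T F = n"
proof -
  have Fne: "F \<noteq> {}" and Ff: "F face_of T" and dimF: "aff_dim F = int CARD('n) - 1"
    using F aff_dim_simplex[OF T] by (auto simp: facet_of_def)
  have FT: "F \<noteq> T" using dimF aff_dim_simplex[OF T] by auto
  have "F exposed_face_of T"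
    using Ff simplex_imp_polyhedron[OF T] by (simp add: exposed_face_of_polyhedron)
  then obtain a c where ac: "T \<subseteq> {x. a \<bullet> x \<le> c}" "F = T \<inter> {x. a \<bullet> x = c}"
    unfolding exposed_face_of_def by blast
  have a0: "a \<noteq> 0" using ac Fne FT by auto
  define n b where "n = a /\<^sub>R norm a" and "b = c / norm a"
  have n: "norm n = 1" using a0 by (simp add: n_def)
  have half: "T \<subseteq> {x. n \<bullet> x \<le> b}" using ac(1) a0 by (auto simp: n_def b_def field_simps)
  have face: "F = T \<inter> {x. n \<bullet> x = b}" using ac(2) a0 by (auto simp: n_def b_def field_simps)
  have n0: "n \<noteq> 0" using n by auto
  have hull: "affine hull F = {x. n \<bullet> x = b}"
  proof (rule affine_dim_equal)
    show "affine hull F \<subseteq> {x. n \<bullet> x = b}"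
      by (rule hull_minimal) (auto simp: face affine_hyperplane)
    show "aff_dim (affine hull F) = aff_dim {x. n \<bullet> x = b}"
      using n0 dimF by (simp add: aff_dim_affine_hull)
  qed (use Fne in \<open>auto simp: affine_hyperplane\<close>)
  have "outer_normal T F = n"
    unfolding outer_normal_def
  proof (rule the_equality)
    show "norm n = 1 \<and> (\<exists>b. F \<subseteq> {x. n \<bullet> x = b} \<and> T \<subseteq> {x. n \<bullet> x \<le> b})"
      using n half face by blast
    fix m assume "norm m = 1 \<and> (\<exists>b. F \<subseteq> {x. m \<bullet> x = b} \<and> T \<subseteq> {x. m \<bullet> x \<le> b})"
    then obtain c where m: "norm m = 1" "F \<subseteq> {x. m \<bullet> x = c}" "T \<subseteq> {x. m \<bullet> x \<le> c}" by blast
    have "affine hull F \<subseteq> {x. m \<bullet> x = c}"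
      by (rule hull_minimal[where S = affine]) (auto simp: m affine_hyperplane)
    then have "(m, c) = (n, b) \<or> (m, c) = (- n, - b)"
      unfolding hull by (intro unit_normal_unique[OF n m(1)]) (use Fne face in auto)
    moreover have "(m, c) \<noteq> (- n, - b)"
    proof
      assume "(m, c) = (- n, - b)"
      then have "T \<subseteq> {x. n \<bullet> x = b}" using m(3) half by force
      then show False using face FT by auto
    qed
    ultimately show "m = n" by auto
  qed
  with n half face hull show thesis by (rule that)
qed

lemma simplex_interior:
  fixes T :: "(real^'n) set"
  assumes T: "int CARD('n) simplex T"
  shows "interior T \<noteq> {}"
proof -
  have "aff_dim T = int DIM(real^'n)" using aff_dim_simplex[OF T] by simp
  then have "interior T = rel_interior T" by (rule interior_rel_interior[symmetric])
  moreover have "convex T" by (rule polytope_imp_convex[OF simplex_imp_polytope[OF T]])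
  moreover have "T \<noteq> {}" using aff_dim_simplex[OF T] by auto
  ultimately show ?thesis by (simp add: rel_interior_eq_empty)
qed

text \<open>
  Every \<open>y\<close> below the hyperplane is \<open>(1 - s) w + s z\<close> with \<open>w\<close> in the hyperplane, where \<open>w \<rightarrow> x\<close> and
  \<open>s \<rightarrow> 0\<close> as \<open>y \<rightarrow> x\<close>; for \<open>y\<close> near \<open>x\<close> therefore \<open>w \<in> F\<close>, and \<open>y \<in> T\<close> by convexity.
\<close>
lemma half_ball_at_face:
  fixes T :: "(real^'n) set"
  assumes T: "convex T" and z: "z \<in> T" "n \<bullet> z < b"
    and F: "F \<subseteq> T" "affine hull F = {x. n \<bullet> x = b}" and x: "x \<in> rel_interior F"
  shows "\<exists>e>0. \<forall>y\<in>ball x e. n \<bullet> y \<le> b \<longrightarrow> y \<in> T"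
proof -
  have xF: "x \<in> F" using x rel_interior_subset by blast
  then have nx: "n \<bullet> x = b" using F(2) hull_subset[of F affine] by blast
  obtain r where r: "r > 0" "ball x r \<inter> affine hull F \<subseteq> F"
    using x by (auto simp: mem_rel_interior_ball)
  \<comment> \<open>\<open>y = (1 - s y) w y + s y z\<close> with \<open>w y\<close> in the hyperplane\<close>
  define s where "s = (\<lambda>y. (b - n \<bullet> y) / (b - n \<bullet> z))"
  define w where "w = (\<lambda>y. (y - s y *\<^sub>R z) /\<^sub>R (1 - s y))"
  have s: "(s \<longlongrightarrow> s x) (nhds x)" unfolding s_def using z by (auto intro!: tendsto_eq_intros filterlim_ident)
  have sx: "s x = 0" by (simp add: s_def nx)
  have w: "(w \<longlongrightarrow> w x) (nhds x)"
    unfolding w_def by (intro tendsto_intros s filterlim_ident) (simp add: sx)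
  have wx: "w x = x" by (simp add: w_def sx)
  have "\<forall>\<^sub>F y in nhds x. s y < 1"
    using order_tendstoD(2)[OF s, of 1] by (simp add: sx)
  moreover have "\<forall>\<^sub>F y in nhds x. dist (w y) x < r"
    using tendstoD[OF w r(1)] by (simp add: wx)
  ultimately have "\<forall>\<^sub>F y in nhds x. s y < 1 \<and> dist (w y) x < r"
    by eventually_elim simp
  then obtain e where e: "e > 0" "\<And>y. dist y x < e \<Longrightarrow> s y < 1 \<and> dist (w y) x < r"
    by (auto simp: eventually_nhds_metric)
  have "y \<in> T" if y: "y \<in> ball x e" "n \<bullet> y \<le> b" for y
  proof -
    have sy: "s y < 1" "dist (w y) x < r" using e(2)[of y] y by (auto simp: dist_commute)
    have s0: "0 \<le> s y" using y(2) z by (simp add: s_def)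
    have eq: "s y * (b - n \<bullet> z) = b - n \<bullet> y" using z by (simp add: s_def)
    have "n \<bullet> (y - s y *\<^sub>R z) = (1 - s y) * b"
      using eq by (simp add: inner_diff_right algebra_simps)
    then have "n \<bullet> w y = b" using sy by (simp add: w_def)
    then have "w y \<in> F" using r(2) sy F(2) by (auto simp: dist_commute)
    then have "(1 - s y) *\<^sub>R w y + s y *\<^sub>R z \<in> T"
      using F(1) z sy s0 by (intro convexD[OF T]) auto
    moreover have "(1 - s y) *\<^sub>R w y + s y *\<^sub>R z = y" using sy by (simp add: w_def)
    ultimately show ?thesis by simp
  qed
  with e(1) show ?thesis by blast
qed

text \<open>
  All that Green's formula needs to know about an element \<open>T\<close> with face \<open>F\<close> and outward normal \<open>n\<close>:
  inside the open set \<open>D\<close>, which supports the test functions, \<open>T\<close> is a half space, and \<open>D\<close> contains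
  almost all of \<open>F\<close>. With \<open>D\<close> the interior of the union of two elements, both of them are instances, with
  opposite normals.
\<close>
locale face_side =
  fixes T F D :: "(real^'n) set" and n :: "real^'n" and b :: real
  assumes unit: "norm n = 1"
    and open_D: "open D"
    and convex_T: "convex T" and compact_T: "compact T" and interior_T: "interior T \<noteq> {}"
    and below: "T \<subseteq> {x. n \<bullet> x \<le> b}"
    and face: "F = T \<inter> {x. n \<bullet> x = b}"
    and hull: "affine hull F = {x. n \<bullet> x = b}"
    and inside: "\<And>x. x \<in> D \<Longrightarrow> n \<bullet> x \<le> b \<Longrightarrow> x \<in> T"
    and rel_interior_sub: "rel_interior F \<subseteq> D"

text \<open>
  If the two elements lay on the same side of the common face, their intersection would have interior
  points; but in a conforming mesh it is a face of both, and a proper face has none.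
\<close>
lemma shared_facet:
  fixes Tp Tm F :: "(real^'n) set"
  assumes Tp: "int CARD('n) simplex Tp" and Tm: "int CARD('n) simplex Tm"
    and faces: "(Tp \<inter> Tm) face_of Tp" "(Tp \<inter> Tm) face_of Tm" "Tp \<noteq> Tm"
    and F: "F facet_of Tp" "F facet_of Tm"
  obtains n b where "face_side Tp F (interior (Tp \<union> Tm)) n b"
    "face_side Tm F (interior (Tp \<union> Tm)) (- n) (- b)"
    "outer_normal Tp F = n" "outer_normal Tm F = - n"
proof -
  obtain n b where p: "norm n = 1" "Tp \<subseteq> {x. n \<bullet> x \<le> b}" "F = Tp \<inter> {x. n \<bullet> x = b}"
    "affine hull F = {x. n \<bullet> x = b}" "outer_normal Tp F = n"
    by (rule facet_hyperplane[OF Tp F(1)])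
  obtain m c where m: "norm m = 1" "Tm \<subseteq> {x. m \<bullet> x \<le> c}" "F = Tm \<inter> {x. m \<bullet> x = c}"
    "affine hull F = {x. m \<bullet> x = c}" "outer_normal Tm F = m"
    by (rule facet_hyperplane[OF Tm F(2)])
  have Fne: "F \<noteq> {}" using F(1) by (simp add: facet_of_def)
  have conv: "convex Tp" "convex Tm" "compact Tp" "compact Tm"
    using simplex_imp_polytope[OF Tp] simplex_imp_polytope[OF Tm]
    by (auto simp: polytope_imp_convex polytope_imp_compact)
  have intp: "interior Tp \<noteq> {}" "interior Tm \<noteq> {}" using simplex_interior[OF Tp] simplex_interior[OF Tm] by auto
  have below: "\<exists>z\<in>T. n \<bullet> z < b"
    if "interior T \<noteq> {}" "T \<subseteq> {x. n \<bullet> x \<le> b}" "norm n = 1" for T :: "(real^'n) set" and n b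
  proof (rule ccontr)
    assume "\<not> (\<exists>z\<in>T. n \<bullet> z < b)"
    then have "T \<subseteq> {x. n \<bullet> x = b}" using that(2) by force
    then have "interior T \<subseteq> interior {x. n \<bullet> x = b}" by (rule interior_mono)
    moreover have "n \<noteq> 0" using that(3) by auto
    ultimately show False using that(1) by (simp add: interior_hyperplane)
  qed
  obtain x where x: "x \<in> rel_interior F"
    using Fne p(3) conv by (metis all_not_in_conv convex_Int convex_hyperplane rel_interior_eq_empty)
  have half: "\<exists>e>0. \<forall>y\<in>ball x e. n \<bullet> y \<le> b \<longrightarrow> y \<in> Tp" if "x \<in> rel_interior F" for x
    using below[OF intp(1) p(2) p(1)] half_ball_at_face[OF conv(1) _ _ _ p(4) that] p(3) by blast
  have half': "\<exists>e>0. \<forall>y\<in>ball x e. m \<bullet> y \<le> c \<longrightarrow> y \<in> Tm" if "x \<in> rel_interior F" for x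
    using below[OF intp(2) m(2) m(1)] half_ball_at_face[OF conv(2) _ _ _ m(4) that] m(3) by blast
  have "(m, c) = (n, b) \<or> (m, c) = (- n, - b)"
    by (rule unit_normal_unique[OF p(1) m(1)]) (use Fne p(3,4) m(4) in auto)
  moreover have "(m, c) \<noteq> (n, b)"
  proof
    assume same: "(m, c) = (n, b)"
    obtain e e' where e: "e > 0" "e' > 0" "\<forall>y\<in>ball x e. n \<bullet> y \<le> b \<longrightarrow> y \<in> Tp"
      "\<forall>y\<in>ball x e'. n \<bullet> y \<le> b \<longrightarrow> y \<in> Tm" using half[OF x] half'[OF x] same by auto
    define r where "r = min e e'"
    have r: "r > 0" "r \<le> e" "r \<le> e'" using e by (auto simp: r_def)
    let ?U = "ball x r \<inter> {y. n \<bullet> y < b}"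
    have "open ?U" by (intro open_Int open_ball open_halfspace_lt)
    moreover have "?U \<subseteq> Tp \<inter> Tm" using e r by (auto simp: less_imp_le)
    ultimately have sub: "?U \<subseteq> interior (Tp \<inter> Tm)" by (simp add: interior_maximal)
    have "n \<bullet> x = b" using x rel_interior_subset p(3) by blast
    then have "x - (r / 2) *\<^sub>R n \<in> ?U"
      using r p(1) by (simp add: dist_norm inner_diff_right dot_square_norm)
    then have ne: "interior (Tp \<inter> Tm) \<noteq> {}" using sub by blast
    then have "(Tp \<inter> Tm) \<inter> interior Tp \<noteq> {}" "(Tp \<inter> Tm) \<inter> interior Tm \<noteq> {}"
      using interior_subset[of "Tp \<inter> Tm"] by (auto simp: interior_Int)
    then have "Tp \<inter> Tm = Tp" "Tp \<inter> Tm = Tm"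
      using face_of_disjoint_interior faces by blast+
    then show False using faces(3) by auto
  qed
  ultimately have mc: "m = - n" "c = - b" by auto
  have ri: "rel_interior F \<subseteq> interior (Tp \<union> Tm)"
  proof
    fix y assume y: "y \<in> rel_interior F"
    obtain e e' where e: "e > 0" "e' > 0" "\<forall>z\<in>ball y e. n \<bullet> z \<le> b \<longrightarrow> z \<in> Tp"
      "\<forall>z\<in>ball y e'. - n \<bullet> z \<le> - b \<longrightarrow> z \<in> Tm" using half[OF y] half'[OF y] mc by auto
    have "ball y (min e e') \<subseteq> Tp \<union> Tm"
    proof
      fix z assume "z \<in> ball y (min e e')"
      then show "z \<in> Tp \<union> Tm" using e(3,4) by (cases "n \<bullet> z \<le> b") auto
    qed
    then show "y \<in> interior (Tp \<union> Tm)" using e(1,2) by (auto simp: mem_interior intro!: exI[of _ "min e e'"])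
  qed
  have Fm: "F = Tm \<inter> {x. n \<bullet> x = b}" using m(3) mc by auto
  have "face_side Tp F (interior (Tp \<union> Tm)) n b"
  proof
    fix x assume "x \<in> interior (Tp \<union> Tm)" "n \<bullet> x \<le> b"
    moreover then have "x \<in> Tp \<union> Tm" using interior_subset by blast
    moreover have "x \<in> Tp" if "x \<in> Tm"
    proof -
      have "n \<bullet> x = b" using that m(2) mc \<open>n \<bullet> x \<le> b\<close> by force
      then show ?thesis using that Fm p(3) by blast
    qed
    ultimately show "x \<in> Tp" by blast
  qed (use p conv intp ri in auto)
  moreover have "face_side Tm F (interior (Tp \<union> Tm)) (- n) (- b)"
  proof
    fix x assume "x \<in> interior (Tp \<union> Tm)" "- n \<bullet> x \<le> - b"
    moreover then have "x \<in> Tp \<union> Tm" using interior_subset by blast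
    moreover have "x \<in> Tm" if "x \<in> Tp"
    proof -
      have "n \<bullet> x = b" using that p(2) \<open>- n \<bullet> x \<le> - b\<close> by force
      then show ?thesis using that Fm p(3) by blast
    qed
    ultimately show "x \<in> Tm" by blast
  qed (use m mc conv intp ri in auto)
  ultimately show thesis using p(5) m(5) mc(1) by (intro that) auto
qed

section \<open>Green's formula at a face of an element\<close>

lemma L2_Cauchy_Schwarz:
  fixes f g :: "'a \<Rightarrow> 'b::euclidean_space"
  assumes f: "L2 M f" and g: "L2 M g"
  shows "\<bar>\<integral>x. f x \<bullet> g x \<partial>M\<bar> \<le> L2norm M f * L2norm M g"
proof -
  let ?I = "\<integral>x. f x \<bullet> g x \<partial>M"
  let ?A = "(L2norm M f)\<^sup>2" and ?C = "(L2norm M g)\<^sup>2"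
  \<comment> \<open>the classical argument: this quadratic polynomial in \<open>s\<close> is nonnegative\<close>
  have quad: "0 \<le> s\<^sup>2 * ?A + 2 * s * ?I + ?C" for s
  proof -
    have "0 \<le> (\<integral>x. (norm (s *\<^sub>R f x + g x))\<^sup>2 \<partial>M)" by (simp add: integral_nonneg_AE)
    also have "(\<lambda>x. (norm (s *\<^sub>R f x + g x))\<^sup>2) =
        (\<lambda>x. s\<^sup>2 * (norm (f x))\<^sup>2 + 2 * s * (f x \<bullet> g x) + (norm (g x))\<^sup>2)"
      unfolding power2_norm_eq_inner inner_add_left inner_add_right inner_scaleR_left inner_scaleR_right
      by (rule ext) (simp only: inner_commute[of "g _" "f _"] power2_eq_square distrib_left
          distrib_right mult.assoc mult_2 add.assoc)
    also have "(\<integral>x. s\<^sup>2 * (norm (f x))\<^sup>2 + 2 * s * (f x \<bullet> g x) + (norm (g x))\<^sup>2 \<partial>M) =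
        s\<^sup>2 * ?A + 2 * s * ?I + ?C"
      using L2_square_integrable[OF f] L2_square_integrable[OF g] L2_integrable_inner[OF f g]
      by (simp add: L2norm_square)
    finally show ?thesis .
  qed
  have "?I\<^sup>2 \<le> ?A * ?C"
  proof (cases "?A = 0")
    case True
    have "?I = 0"
    proof (rule ccontr)
      assume "?I \<noteq> 0"
      then show False using quad[of "- (?C + 1) / (2 * ?I)"] True by (simp add: field_simps)
    qed
    then show ?thesis by (simp add: True)
  next
    case False
    then have "?A > 0" by simp
    have "(- I / A)\<^sup>2 * A + 2 * (- I / A) * I + C = C - I\<^sup>2 / A" if "A > 0" for I A C :: real
      using that by (simp add: field_simps power2_eq_square)
    \<comment> \<open>the minimum is attained at \<open>s = - ?I / ?A\<close>\<close>
    from this[OF \<open>?A > 0\<close>, of ?I ?C] have "?I\<^sup>2 / ?A \<le> ?C"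
      using quad[of "- ?I / ?A"] by linarith
    then show ?thesis using \<open>?A > 0\<close> by (simp only: pos_divide_le_eq mult.commute)
  qed
  then have "\<bar>?I\<bar> \<le> \<bar>L2norm M f * L2norm M g\<bar>"
    by (simp only: abs_le_square_iff power_mult_distrib)
  then show ?thesis by (simp add: L2norm_nonneg)
qed

lemma L2_limit_integral:
  fixes f :: "nat \<Rightarrow> 'a \<Rightarrow> 'b::euclidean_space"
  assumes f: "\<And>k. L2 M (f k)" and h: "L2 M h" and g: "L2 M g"
    and lim: "(\<lambda>k. L2norm M (\<lambda>x. f k x - h x)) \<longlonglongrightarrow> 0"
  shows "(\<lambda>k. \<integral>x. f k x \<bullet> g x \<partial>M) \<longlonglongrightarrow> (\<integral>x. h x \<bullet> g x \<partial>M)"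
proof (rule LIM_zero_cancel, rule Lim_null_comparison)
  show "(\<lambda>k. L2norm M (\<lambda>x. f k x - h x) * L2norm M g) \<longlonglongrightarrow> 0"
    using tendsto_mult_left_zero[OF lim] .
  show "\<forall>\<^sub>F k in sequentially. norm ((\<integral>x. f k x \<bullet> g x \<partial>M) - (\<integral>x. h x \<bullet> g x \<partial>M))
      \<le> L2norm M (\<lambda>x. f k x - h x) * L2norm M g"
  proof (rule always_eventually, rule allI)
    fix k
    have "(\<integral>x. f k x \<bullet> g x \<partial>M) - (\<integral>x. h x \<bullet> g x \<partial>M) = (\<integral>x. (f k x - h x) \<bullet> g x \<partial>M)"
      using L2_integrable_inner[OF f g] L2_integrable_inner[OF h g]
      by (simp add: inner_diff_left)
    then show "norm ((\<integral>x. f k x \<bullet> g x \<partial>M) - (\<integral>x. h x \<bullet> g x \<partial>M))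
        \<le> L2norm M (\<lambda>x. f k x - h x) * L2norm M g"
      using L2_Cauchy_Schwarz[OF L2_diff[OF f h] g] by simp
  qed
qed

context face_side
begin

lemma sets_T [simp]: "T \<in> sets borel" "interior T \<in> sets borel"
  using compact_T by (auto simp: borel_compact)

lemma sets_lebesgue_T [simp]: "T \<in> sets lebesgue" "interior T \<in> sets lebesgue"
  using sets_T by auto

lemma null_boundary: "negligible (T - interior T)"
  using negligible_convex_frontier[OF convex_T] compact_T
  by (simp add: frontier_def compact_imp_closed)

lemmas spike = sets_lebesgue_T(2,1) interior_subset null_boundary

lemma face_subset: "F \<subseteq> {x. n \<bullet> x = b}" "F \<subseteq> T"
  using face by auto

lemma compact_face: "compact F" and convex_face: "convex F"
  unfolding face using compact_T convex_T
  by (auto intro: compact_Int_closed closed_hyperplane convex_Int convex_hyperplane)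

lemma sets_face [simp]: "F \<in> sets borel"
  using compact_face by (rule borel_compact)

lemma surface_on_face: "surface_on F = restrict_space (hyperplane_measure n b) F"
  by (rule surface_on_eq_hyperplane[OF unit sets_face face_subset(1)])

lemma AE_surface_on_face: "AE x in surface_on F. x \<in> D"
  unfolding surface_on_face
  using AE_hyperplane_rel_interior[OF unit convex_face compact_imp_closed[OF compact_face] hull]
    rel_interior_sub
  by (auto simp: AE_restrict_space_iff elim!: eventually_mono)

lemma L2_surface_continuous:
  fixes g :: "real^'n \<Rightarrow> real"
  assumes "continuous_on UNIV g" shows "L2 (surface_on F) g"
proof -
  have "compact (g ` F)"
    by (rule compact_continuous_image[OF continuous_on_subset[OF assms] compact_face]) simp
  then obtain B where B: "\<And>x. x \<in> F \<Longrightarrow> \<bar>g x\<bar> \<le> B"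
    by (meson bounded_real compact_imp_bounded imageI)
  interpret finite_measure "surface_on F"
  proof (rule finite_measureI)
    have "emeasure (surface_on F) (space (surface_on F)) = emeasure (hyperplane_measure n b) F"
      unfolding surface_on_face by (simp add: space_restrict_space emeasure_restrict_space)
    then show "emeasure (surface_on F) (space (surface_on F)) \<noteq> \<infinity>"
      using emeasure_hyperplane_bounded_finite[OF unit sets_face compact_imp_bounded[OF compact_face], of b]
      by simp
  qed
  have m: "g \<in> borel_measurable (surface_on F)"
    unfolding surface_on_face
    by (rule measurable_restrict_space1) (use borel_measurable_continuous_onI[OF assms] in simp)
  have "integrable (surface_on F) (\<lambda>x. (norm (g x))\<^sup>2)"
  proof (rule integrable_const_bound[where B = "B\<^sup>2"])
    show "AE x in surface_on F. norm ((norm (g x))\<^sup>2) \<le> B\<^sup>2"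
    proof (rule AE_I2)
      fix x assume "x \<in> space (surface_on F)"
      then have "x \<in> F" unfolding surface_on_face by (simp add: space_restrict_space)
      then show "norm ((norm (g x))\<^sup>2) \<le> B\<^sup>2" using power_mono[OF B, of x 2] by simp
    qed
  qed (use m in measurable)
  with m show ?thesis by (simp add: L2_def)
qed

text \<open>
  The relative boundary of the face, which test functions supported in \<open>D\<close> do not reach, is a null
  set.
\<close>
lemma fundamental_lemma_surface:
  fixes h :: "real^'n \<Rightarrow> real"
  assumes h: "L2 (surface_on F) h"
    and zero: "\<And>\<theta>. test_fun D \<theta> \<Longrightarrow> (\<integral>x. h x * \<theta> x \<partial>surface_on F) = 0"
  shows "AE x in surface_on F. h x = 0"
proof -
  let ?H = "hyperplane_measure n b"
  have m: "(\<lambda>x. indicator F x * h x) \<in> borel_measurable borel"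
    using L2_borel_measurable[OF h] unfolding surface_on_face
    by (simp add: borel_measurable_restrict_space_iff)
  have "integrable (surface_on F) (\<lambda>x. h x * 1)"
    by (rule L2_integrable_mult[OF h L2_surface_continuous]) simp
  then have int: "integrable ?H (\<lambda>x. indicator F x * h x)"
    unfolding surface_on_face by (simp add: integrable_restrict_space)
  have "AE x in ?H. x \<in> D \<longrightarrow> indicator F x * h x = 0"
  proof (rule fundamental_lemma[OF _ open_D m])
    show "integrable ?H (\<lambda>x. indicator (cbox c d) x * (indicator F x * h x))" for c d
      using integrable_mult_indicator[OF _ int, of "cbox c d"] by simp
    fix \<theta> assume "test_fun D \<theta>"
    from zero[OF this] show "(\<integral>x. indicator F x * h x * \<theta> x \<partial>?H) = 0"
      unfolding surface_on_face by (simp add: integral_restrict_space mult.assoc)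
  qed simp
  then have "AE x in surface_on F. x \<in> D \<longrightarrow> h x = 0"
    unfolding surface_on_face by (simp add: AE_restrict_space_iff) (auto elim!: eventually_mono)
  with AE_surface_on_face show ?thesis by eventually_elim simp
qed

text \<open>
  The product of \<open>w\<close> and \<open>\<theta>\<close> vanishes outside \<open>D\<close>, and inside \<open>D\<close> the element agrees with the half
  space and the face with the hyperplane.
\<close>
lemma green_smooth:
  assumes w: "smooth w" and \<theta>: "test_fun D \<theta>"
  shows "(\<integral>x. w x * (grad \<theta> x \<bullet> v) + \<theta> x * (grad w x \<bullet> v) \<partial>lebesgue_on T) =
    (n \<bullet> v) * (\<integral>x. w x * \<theta> x \<partial>surface_on F)"
proof -
  note t = test_fun_mult[OF w \<theta>]
  let ?f = "\<lambda>x. grad (\<lambda>x. w x * \<theta> x) x \<bullet> v"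
  have "(\<integral>x. ?f x \<partial>lebesgue_on T) = (\<integral>x. indicator T x *\<^sub>R ?f x \<partial>lborel)"
    using borel_measurable_integrable[OF integrable_grad_test_fun[OF t, of v]]
    by (intro integral_lebesgue_on_borel) auto
  also have "\<dots> = (\<integral>x. indicator {x. n \<bullet> x \<le> b} x * ?f x \<partial>lborel)"
  proof (rule Bochner_Integration.integral_cong)
    fix x
    show "indicator T x *\<^sub>R ?f x = indicator {x. n \<bullet> x \<le> b} x * ?f x"
    proof (cases "x \<in> D")
      case True
      then have "x \<in> T \<longleftrightarrow> n \<bullet> x \<le> b" using below inside by auto
      then show ?thesis by (simp add: indicator_def)
    qed (simp add: test_fun_outside(2)[OF t])
  qed simp
  also have "\<dots> = (n \<bullet> v) * (\<integral>x. w x * \<theta> x \<partial>hyperplane_measure n b)"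
    by (rule integral_grad_halfspace[OF t unit])
  also have "(\<integral>x. w x * \<theta> x \<partial>hyperplane_measure n b) =
      (\<integral>x. indicator F x *\<^sub>R (w x * \<theta> x) \<partial>hyperplane_measure n b)"
  proof (rule integral_cong_AE)
    have m: "(\<lambda>x. w x * \<theta> x) \<in> borel_measurable borel"
      using borel_measurable_integrable[OF integrable_test_fun[OF t]] by simp
    then show "(\<lambda>x. w x * \<theta> x) \<in> borel_measurable (hyperplane_measure n b)" by simp
    show "(\<lambda>x. indicator F x *\<^sub>R (w x * \<theta> x)) \<in> borel_measurable (hyperplane_measure n b)"
      by (rule borel_measurable_scaleR[OF borel_measurable_indicator]) (use m in simp_all)
    show "AE x in hyperplane_measure n b. w x * \<theta> x = indicator F x *\<^sub>R (w x * \<theta> x)"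
      using AE_hyperplane_measure[OF unit, of b]
    proof eventually_elim
      case (elim x)
      show ?case
      proof (cases "x \<in> D")
        case True
        then have "x \<in> F" using inside[of x] elim by (simp add: face)
        then show ?thesis by simp
      qed (simp add: test_fun_outside(1)[OF \<theta>])
    qed
  qed
  also have "\<dots> = (\<integral>x. w x * \<theta> x \<partial>surface_on F)"
    unfolding surface_on_face by (subst integral_restrict_space) auto
  finally show ?thesis by (simp add: grad_mult_inner[OF w \<theta>])
qed

text \<open>
  Traces are limits of boundary values of smooth functions, and both sides of Green's formula are
  continuous with respect to the convergences in the definition of the trace.
\<close>
lemma green_trace:
  assumes u: "has_trace (interior T) F u t" and \<theta>: "test_fun D \<theta>"
  shows "(\<integral>x. u x * (grad \<theta> x \<bullet> v) + \<theta> x * (wgrad (interior T) u x \<bullet> v) \<partial>lebesgue_on (interior T)) =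
    (n \<bullet> v) * (\<integral>x. t x * \<theta> x \<partial>surface_on F)"
proof -
  let ?M = "lebesgue_on (interior T)" and ?G = "wgrad (interior T) u"
  have s: "interior T \<in> sets lebesgue" and bd: "bounded (interior T)"
    using compact_imp_bounded[OF compact_T] bounded_subset interior_subset by auto
  have wg: "weak_grad (interior T) u ?G" and t: "L2 (surface_on F) t"
    using u weak_grad_wgrad unfolding has_trace_def H1_def by blast+
  obtain \<phi> where \<phi>: "\<And>k. smooth (\<phi> k)"
    and lim: "(\<lambda>k. L2norm ?M (\<lambda>x. \<phi> k x - u x)) \<longlonglongrightarrow> 0"
      "(\<lambda>k. L2norm ?M (\<lambda>x. grad (\<phi> k) x - ?G x)) \<longlonglongrightarrow> 0"
      "(\<lambda>k. L2norm (surface_on F) (\<lambda>x. \<phi> k x - t x)) \<longlonglongrightarrow> 0"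
    using u unfolding has_trace_def H1_lim_def by blast
  note \<theta>2 = L2_test_fun[OF \<theta> s] and g\<theta>2 = L2_inner_const[OF L2_grad_test_fun[OF \<theta> s], of v]
  have \<theta>v: "L2 ?M (\<lambda>x. \<theta> x *\<^sub>R v)"
  proof (rule L2_bound[OF \<theta>2, where K = "norm v"])
    show "(\<lambda>x. \<theta> x *\<^sub>R v) \<in> borel_measurable ?M" using L2_borel_measurable[OF \<theta>2] by measurable
  qed simp
  note k2 = smooth_L2[OF \<phi> s bd]
  have "(\<lambda>k. (\<integral>x. \<phi> k x \<bullet> (grad \<theta> x \<bullet> v) \<partial>?M) + (\<integral>x. grad (\<phi> k) x \<bullet> (\<theta> x *\<^sub>R v) \<partial>?M)) \<longlonglongrightarrow>
      (\<integral>x. u x \<bullet> (grad \<theta> x \<bullet> v) \<partial>?M) + (\<integral>x. ?G x \<bullet> (\<theta> x *\<^sub>R v) \<partial>?M)"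
    by (intro tendsto_add L2_limit_integral k2 weak_gradD(1,2)[OF wg] g\<theta>2 \<theta>v lim)
  moreover have "(\<integral>x. \<phi> k x \<bullet> (grad \<theta> x \<bullet> v) \<partial>?M) + (\<integral>x. grad (\<phi> k) x \<bullet> (\<theta> x *\<^sub>R v) \<partial>?M) =
      (n \<bullet> v) * (\<integral>x. \<phi> k x * \<theta> x \<partial>surface_on F)" for k
  proof -
    note i1 = L2_integrable_inner[OF k2(1)[of k] g\<theta>2] and i2 = L2_integrable_inner[OF k2(2)[of k] \<theta>v]
    have "(\<integral>x. \<phi> k x \<bullet> (grad \<theta> x \<bullet> v) \<partial>?M) + (\<integral>x. grad (\<phi> k) x \<bullet> (\<theta> x *\<^sub>R v) \<partial>?M) =
        (\<integral>x. \<phi> k x \<bullet> (grad \<theta> x \<bullet> v) + grad (\<phi> k) x \<bullet> (\<theta> x *\<^sub>R v) \<partial>?M)"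
      using i1 i2 by simp
    also have "\<dots> = (\<integral>x. \<phi> k x \<bullet> (grad \<theta> x \<bullet> v) + grad (\<phi> k) x \<bullet> (\<theta> x *\<^sub>R v) \<partial>lebesgue_on T)"
      by (rule integral_lebesgue_on_spike[OF spike, symmetric]) (use i1 i2 in simp)
    also have "\<dots> = (n \<bullet> v) * (\<integral>x. \<phi> k x * \<theta> x \<partial>surface_on F)"
      using green_smooth[OF \<phi> \<theta>, of k v] by simp
    finally show ?thesis .
  qed
  moreover have "(\<lambda>k. (n \<bullet> v) * (\<integral>x. \<phi> k x \<bullet> \<theta> x \<partial>surface_on F)) \<longlonglongrightarrow>
      (n \<bullet> v) * (\<integral>x. t x \<bullet> \<theta> x \<partial>surface_on F)"
    by (intro tendsto_mult tendsto_const L2_limit_integral t lim L2_surface_continuous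
        smooth_continuous \<phi> test_fun_smooth[OF \<theta>])
  ultimately have "(\<integral>x. u x \<bullet> (grad \<theta> x \<bullet> v) \<partial>?M) + (\<integral>x. ?G x \<bullet> (\<theta> x *\<^sub>R v) \<partial>?M) =
      (n \<bullet> v) * (\<integral>x. t x \<bullet> \<theta> x \<partial>surface_on F)"
    by (auto intro: LIMSEQ_unique)
  then show ?thesis
    using L2_integrable_inner[OF weak_gradD(1)[OF wg] g\<theta>2] L2_integrable_inner[OF weak_gradD(2)[OF wg] \<theta>v]
    by simp
qed

text \<open>
  On \<open>T\<close> the discrete function is smooth up to the boundary, so \<open>t + P\<close> acts as the trace of \<open>u\<close>
  itself. This formulation has the advantage that the left-hand side contains the global function
  \<open>u\<close> alone, and that the contributions of two elements can be added.
\<close>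
lemma green_trace_smooth_correction:
  assumes D: "interior T \<subseteq> \<Omega>" "open \<Omega>" and u: "weak_grad \<Omega> u G" and P: "smooth P"
    and uh: "\<And>x. x \<in> interior T \<Longrightarrow> uh x = P x"
    and t: "has_trace (interior T) F (\<lambda>x. u x - uh x) t" and \<theta>: "test_fun D \<theta>"
  shows "(\<integral>x. u x * (grad \<theta> x \<bullet> v) + \<theta> x * (G x \<bullet> v) \<partial>lebesgue_on T) =
    (n \<bullet> v) * (\<integral>x. (t x + P x) * \<theta> x \<partial>surface_on F)"
proof -
  let ?M = "lebesgue_on (interior T)"
  have s: "interior T \<in> sets lebesgue" and bd: "bounded (interior T)"
    using compact_imp_bounded[OF compact_T] bounded_subset interior_subset by auto
  have uT: "weak_grad (interior T) u G"
    by (rule weak_grad_subset[OF D(2) open_interior D(1) u])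
  have "weak_grad (interior T) (\<lambda>x. u x - P x) (\<lambda>x. G x - grad P x)"
    by (rule weak_grad_diff[OF open_interior uT weak_grad_smooth[OF open_interior bd P]])
  then have e: "weak_grad (interior T) (\<lambda>x. u x - uh x) (\<lambda>x. G x - grad P x)"
    by (rule weak_grad_cong[THEN iffD1, rotated -1]) (simp_all add: uh)
  note \<theta>2 = L2_test_fun[OF \<theta> s] and g\<theta>2 = L2_inner_const[OF L2_grad_test_fun[OF \<theta> s], of v]
  note P2 = smooth_L2[OF P s bd]
  have i1: "integrable ?M (\<lambda>x. (u x - uh x) * (grad \<theta> x \<bullet> v) + \<theta> x * ((G x - grad P x) \<bullet> v))"
    by (intro Bochner_Integration.integrable_add L2_integrable_mult weak_gradD(1)[OF e] g\<theta>2 \<theta>2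
        L2_inner_const weak_gradD(2)[OF e])
  have i2: "integrable ?M (\<lambda>x. P x * (grad \<theta> x \<bullet> v) + \<theta> x * (grad P x \<bullet> v))"
    by (intro Bochner_Integration.integrable_add L2_integrable_mult P2 g\<theta>2 \<theta>2 L2_inner_const)
  have i3: "integrable ?M (\<lambda>x. u x * (grad \<theta> x \<bullet> v) + \<theta> x * (G x \<bullet> v))"
    by (intro Bochner_Integration.integrable_add L2_integrable_mult weak_gradD(1)[OF uT] g\<theta>2 \<theta>2
        L2_inner_const weak_gradD(2)[OF uT])
  have i4: "integrable ?M (\<lambda>x. (u x - uh x) * (grad \<theta> x \<bullet> v) +
      \<theta> x * (wgrad (interior T) (\<lambda>x. u x - uh x) x \<bullet> v))"
    by (intro Bochner_Integration.integrable_add L2_integrable_mult weak_gradD(1)[OF e] g\<theta>2 \<theta>2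
        L2_inner_const weak_gradD(2)[OF weak_grad_wgrad[OF e]])
  have "(\<integral>x. (u x - uh x) * (grad \<theta> x \<bullet> v) + \<theta> x * ((G x - grad P x) \<bullet> v) \<partial>?M) =
      (\<integral>x. (u x - uh x) * (grad \<theta> x \<bullet> v) + \<theta> x * (wgrad (interior T) (\<lambda>x. u x - uh x) x \<bullet> v) \<partial>?M)"
    by (rule integral_cong_AE[OF borel_measurable_integrable[OF i1] borel_measurable_integrable[OF i4]])
      (use wgrad_AE[OF open_interior e] in \<open>auto elim!: eventually_mono\<close>)
  also have "\<dots> = (n \<bullet> v) * (\<integral>x. t x * \<theta> x \<partial>surface_on F)"
    by (rule green_trace[OF t \<theta>])
  finally have g1: "(\<integral>x. (u x - uh x) * (grad \<theta> x \<bullet> v) + \<theta> x * ((G x - grad P x) \<bullet> v) \<partial>?M) =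
      (n \<bullet> v) * (\<integral>x. t x * \<theta> x \<partial>surface_on F)" .
  have g2: "(\<integral>x. P x * (grad \<theta> x \<bullet> v) + \<theta> x * (grad P x \<bullet> v) \<partial>?M) =
      (n \<bullet> v) * (\<integral>x. P x * \<theta> x \<partial>surface_on F)"
    using integral_lebesgue_on_spike[OF spike i2] green_smooth[OF P \<theta>, of v] by simp
  have "L2 (surface_on F) t" using t by (simp add: has_trace_def)
  then have "(\<integral>x. (t x + P x) * \<theta> x \<partial>surface_on F) =
      (\<integral>x. t x * \<theta> x \<partial>surface_on F) + (\<integral>x. P x * \<theta> x \<partial>surface_on F)"
    using L2_integrable_mult[OF _ L2_surface_continuous[OF smooth_continuous[OF test_fun_smooth[OF \<theta>]]]]
      L2_surface_continuous[OF smooth_continuous[OF P]]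
    by (simp add: distrib_right)
  then have "(n \<bullet> v) * (\<integral>x. (t x + P x) * \<theta> x \<partial>surface_on F) =
      (\<integral>x. ((u x - uh x) * (grad \<theta> x \<bullet> v) + \<theta> x * ((G x - grad P x) \<bullet> v)) +
        (P x * (grad \<theta> x \<bullet> v) + \<theta> x * (grad P x \<bullet> v)) \<partial>?M)"
    using g1 g2 by (simp only: Bochner_Integration.integral_add[OF i1 i2] distrib_left)
  also have "\<dots> = (\<integral>x. u x * (grad \<theta> x \<bullet> v) + \<theta> x * (G x \<bullet> v) \<partial>?M)"
    by (rule Bochner_Integration.integral_cong) (auto simp: uh algebra_simps inner_diff_left)
  also have "\<dots> = (\<integral>x. u x * (grad \<theta> x \<bullet> v) + \<theta> x * (G x \<bullet> v) \<partial>lebesgue_on T)"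
    by (rule integral_lebesgue_on_spike[OF spike i3, symmetric])
  finally show ?thesis by simp
qed

lemma green_field:
  assumes Q: "\<And>i. smooth (\<lambda>x. Q x $ i)" and \<theta>: "test_fun D \<theta>"
  shows "(\<integral>x. Q x \<bullet> grad \<theta> x + divg Q x * \<theta> x \<partial>lebesgue_on T) = (\<integral>x. (Q x \<bullet> n) * \<theta> x \<partial>surface_on F)"
proof -
  have s: "T \<in> sets lebesgue" by simp
  note w = test_fun_mult[OF Q \<theta>]
  have "(\<integral>x. Q x \<bullet> grad \<theta> x + divg Q x * \<theta> x \<partial>lebesgue_on T) =
      (\<integral>x. (\<Sum>i\<in>UNIV. grad (\<lambda>x. Q x $ i * \<theta> x) x \<bullet> axis i 1) \<partial>lebesgue_on T)"
    by (simp only: divg_mult_test_fun[OF Q \<theta>])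
  also have "\<dots> = (\<Sum>i\<in>UNIV. \<integral>x. grad (\<lambda>x. Q x $ i * \<theta> x) x \<bullet> axis i 1 \<partial>lebesgue_on T)"
    by (rule Bochner_Integration.integral_sum)
      (rule integrable_lebesgue_on_borel[OF s integrable_grad_test_fun[OF w]])
  also have "\<dots> = (\<Sum>i\<in>UNIV. n $ i * (\<integral>x. Q x $ i * \<theta> x \<partial>surface_on F))"
    unfolding grad_mult_inner[OF Q \<theta>] green_smooth[OF Q \<theta>] by (simp add: inner_axis)
  also have "\<dots> = (\<integral>x. (\<Sum>i\<in>UNIV. n $ i * (Q x $ i * \<theta> x)) \<partial>surface_on F)"
    using L2_integrable_mult[OF L2_surface_continuous[OF smooth_continuous[OF Q]]
        L2_surface_continuous[OF smooth_continuous[OF test_fun_smooth[OF \<theta>]]]]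
    by (subst Bochner_Integration.integral_sum) auto
  also have "(\<lambda>x. \<Sum>i\<in>UNIV. n $ i * (Q x $ i * \<theta> x)) = (\<lambda>x. (Q x \<bullet> n) * \<theta> x)"
    by (simp add: inner_vec_def sum_distrib_left mult_ac fun_eq_iff)
  finally show ?thesis .
qed

end

section \<open>Jumps of the errors\<close>

text \<open>
  A convex set with interior points is the closure of its interior, so every point of \<open>T\<close> is a limit
  point of the interior and the limit that defines the one-sided value is unique.
\<close>
lemma trace_from_eq:
  fixes v P :: "real^'n \<Rightarrow> 'b::t2_space"
  assumes T: "convex T" "closed T" "interior T \<noteq> {}" and P: "continuous_on UNIV P"
    and v: "\<And>x. x \<in> interior T \<Longrightarrow> v x = P x" and x: "x \<in> T"
  shows "trace_from T v x = P x"
  unfolding trace_from_def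
proof (rule tendsto_Lim)
  have "x \<in> closure (interior T)"
    using convex_closure_interior[OF T(1,3)] closure_subset x by blast
  then have "x islimpt interior T"
    using interior_limit_point[of x "interior T"] by (auto simp: closure_def)
  then show "at x within interior T \<noteq> bot" by (simp add: trivial_limit_within)
  have "(P \<longlongrightarrow> P x) (at x within interior T)"
    using P by (auto simp: continuous_on_eq_continuous_at continuous_at intro: tendsto_within_subset)
  then show "(v \<longlongrightarrow> P x) (at x within interior T)"
    by (rule Lim_transform_eventually) (simp add: eventually_at_filter v)
qed

lemma integral_two_sides:
  fixes f :: "real^'n \<Rightarrow> real"
  assumes p: "face_side Tp F (interior (Tp \<union> Tm)) n b"
    and m: "face_side Tm F (interior (Tp \<union> Tm)) (- n) (- b)"
    and f: "integrable (lebesgue_on (interior (Tp \<union> Tm))) f"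
    and f0: "\<And>x. x \<notin> interior (Tp \<union> Tm) \<Longrightarrow> f x = 0"
  shows "(\<integral>x. f x \<partial>lebesgue_on Tp) + (\<integral>x. f x \<partial>lebesgue_on Tm) =
    (\<integral>x. f x \<partial>lebesgue_on (interior (Tp \<union> Tm)))"
proof -
  interpret p: face_side Tp F "interior (Tp \<union> Tm)" n b by fact
  interpret m: face_side Tm F "interior (Tp \<union> Tm)" "- n" "- b" by fact
  let ?D = "interior (Tp \<union> Tm)"
  have D: "?D \<in> sets lebesgue" by simp
  have "(\<lambda>x. indicator ?D x *\<^sub>R f x) = f" using f0 by (auto simp: indicator_def fun_eq_iff)
  then have int: "integrable lebesgue f" and eqD: "(\<integral>x. f x \<partial>lebesgue_on ?D) = (\<integral>x. f x \<partial>lebesgue)"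
    using f D by (simp_all add: integrable_restrict_space integral_restrict_space)
  have ip: "integrable lebesgue (\<lambda>x. indicator Tp x *\<^sub>R f x)" and im: "integrable lebesgue (\<lambda>x. indicator Tm x *\<^sub>R f x)"
    by (intro integrable_mult_indicator int; simp)+
  have "n \<noteq> 0" using p.unit by auto
  then have "{x. n \<bullet> x = b} \<in> null_sets lebesgue"
    by (simp add: negligible_hyperplane flip: negligible_iff_null_sets)
  then have off: "AE x in lebesgue. x \<notin> {x. n \<bullet> x = b}" by (rule AE_not_in)
  have "(\<integral>x. f x \<partial>lebesgue_on Tp) + (\<integral>x. f x \<partial>lebesgue_on Tm) =
      (\<integral>x. indicator Tp x *\<^sub>R f x + indicator Tm x *\<^sub>R f x \<partial>lebesgue)"
    using ip im by (simp add: integral_restrict_space)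
  also have "\<dots> = (\<integral>x. f x \<partial>lebesgue)"
  proof (rule integral_cong_AE)
    show "AE x in lebesgue. indicator Tp x *\<^sub>R f x + indicator Tm x *\<^sub>R f x = f x"
      using off
    proof eventually_elim
      case (elim x)
      show ?case
      proof (cases "x \<in> ?D")
        case True
        then consider "x \<in> Tp" "x \<notin> Tm" | "x \<in> Tm" "x \<notin> Tp"
          using elim p.inside[of x] p.below m.inside[of x] m.below by force
        then show ?thesis by cases auto
      qed (simp add: f0)
    qed
  qed (use int ip im in auto)
  finally show ?thesis by (simp add: eqD)
qed

text \<open>
  Adding Green's formula for the two sides gives on the left the integral that defines the weak
  gradient of \<open>u\<close> on \<open>D\<close>, namely zero, and on the right \<open>\<integral>\<^sub>F (tp + Pp - tm - Pm) \<theta>\<close> because the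
  normals are opposite; here Green's formula is used in the direction of the normal.
\<close>
lemma jump_of_error:
  fixes u uh :: "real^'n \<Rightarrow> real"
  assumes p: "face_side Tp F (interior (Tp \<union> Tm)) n b"
    and m: "face_side Tm F (interior (Tp \<union> Tm)) (- n) (- b)"
    and \<Omega>: "open \<Omega>" "interior (Tp \<union> Tm) \<subseteq> \<Omega>" and u: "weak_grad \<Omega> u G"
    and P: "smooth Pp" "smooth Pm"
    and uh: "\<And>x. x \<in> interior Tp \<Longrightarrow> uh x = Pp x" "\<And>x. x \<in> interior Tm \<Longrightarrow> uh x = Pm x"
    and j: "has_jump Tp Tm F (\<lambda>x. u x - uh x) j"
  shows "AE x in surface_on F. j x = - (Pp x - Pm x)"
proof -
  interpret p: face_side Tp F "interior (Tp \<union> Tm)" n b by fact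
  interpret m: face_side Tm F "interior (Tp \<union> Tm)" "- n" "- b" by fact
  let ?D = "interior (Tp \<union> Tm)"
  have D: "?D \<in> sets lebesgue" by simp
  have Tp\<Omega>: "interior Tp \<subseteq> \<Omega>" and Tm\<Omega>: "interior Tm \<subseteq> \<Omega>"
    using \<Omega>(2) interior_mono[of Tp "Tp \<union> Tm"] interior_mono[of Tm "Tp \<union> Tm"] by auto
  obtain tp tm where t: "has_trace (interior Tp) F (\<lambda>x. u x - uh x) tp"
    "has_trace (interior Tm) F (\<lambda>x. u x - uh x) tm" "j = (\<lambda>x. tp x - tm x)"
    using j unfolding has_jump_def by blast
  have L: "L2 (surface_on F) tp" "L2 (surface_on F) tm" using t unfolding has_trace_def by auto
  note P2 = p.L2_surface_continuous[OF smooth_continuous[OF P(1)]]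
    p.L2_surface_continuous[OF smooth_continuous[OF P(2)]]
  have Lp: "L2 (surface_on F) (\<lambda>x. tp x + Pp x)" and Lm: "L2 (surface_on F) (\<lambda>x. tm x + Pm x)"
    by (intro L2_add L P2)+
  have uD: "weak_grad ?D u G" by (rule weak_grad_subset[OF \<Omega>(1) open_interior \<Omega>(2) u])
  have "AE x in surface_on F. (tp x + Pp x) - (tm x + Pm x) = 0"
  proof (rule p.fundamental_lemma_surface)
    show "L2 (surface_on F) (\<lambda>x. (tp x + Pp x) - (tm x + Pm x))"
      by (rule L2_diff[OF Lp Lm])
    fix \<theta> assume \<theta>: "test_fun ?D \<theta>"
    let ?f = "\<lambda>x. u x * (grad \<theta> x \<bullet> n) + \<theta> x * (G x \<bullet> n)"
    note \<theta>2 = L2_test_fun[OF \<theta> D] L2_grad_test_fun[OF \<theta> D]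
    note \<theta>F = p.L2_surface_continuous[OF smooth_continuous[OF test_fun_smooth[OF \<theta>]]]
    have f: "integrable (lebesgue_on ?D) ?f"
      by (intro Bochner_Integration.integrable_add L2_integrable_mult L2_inner_const \<theta>2
          weak_gradD(1,2)[OF uD])
    have nn: "n \<bullet> n = 1" using p.unit by (simp add: dot_square_norm)
    have i: "integrable (lebesgue_on ?D) (\<lambda>x. u x *\<^sub>R grad \<theta> x)" "integrable (lebesgue_on ?D) (\<lambda>x. \<theta> x *\<^sub>R G x)"
      by (intro L2_integrable_scaleR \<theta>2 weak_gradD(1,2)[OF uD])+
    have "(\<integral>x. u x *\<^sub>R grad \<theta> x + \<theta> x *\<^sub>R G x \<partial>lebesgue_on ?D) = 0"
      using weak_gradD(3)[OF uD \<theta>] i by simp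
    then have "(\<integral>x. (u x *\<^sub>R grad \<theta> x + \<theta> x *\<^sub>R G x) \<bullet> n \<partial>lebesgue_on ?D) = 0"
      using i by (subst Bochner_Integration.integral_inner_left) simp_all
    then have "(\<integral>x. ?f x \<partial>lebesgue_on ?D) = 0" by (simp add: inner_add_left)
    moreover have "(\<integral>x. ?f x \<partial>lebesgue_on Tp) + (\<integral>x. ?f x \<partial>lebesgue_on Tm) = (\<integral>x. ?f x \<partial>lebesgue_on ?D)"
      by (rule integral_two_sides[OF p m f]) (simp add: test_fun_outside[OF \<theta>])
    moreover have "(\<integral>x. ?f x \<partial>lebesgue_on Tp) = (\<integral>x. (tp x + Pp x) * \<theta> x \<partial>surface_on F)"
      using p.green_trace_smooth_correction[OF Tp\<Omega> \<Omega>(1) u P(1) uh(1) t(1) \<theta>, of n] by (simp add: nn)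
    moreover have "(\<integral>x. ?f x \<partial>lebesgue_on Tm) = - (\<integral>x. (tm x + Pm x) * \<theta> x \<partial>surface_on F)"
      using m.green_trace_smooth_correction[OF Tm\<Omega> \<Omega>(1) u P(2) uh(2) t(2) \<theta>, of n] by (simp add: nn)
    ultimately show "(\<integral>x. (tp x + Pp x - (tm x + Pm x)) * \<theta> x \<partial>surface_on F) = 0"
      using L2_integrable_mult[OF Lp \<theta>F] L2_integrable_mult[OF Lm \<theta>F]
      by (simp add: left_diff_distrib)
  qed
  then show ?thesis by eventually_elim (simp add: t(3))
qed

lemma (in face_side) normal_trace_error:
  assumes \<Omega>: "open \<Omega>" "interior T \<subseteq> \<Omega>" and q: "weak_div \<Omega> q \<delta>"
    and Q: "\<And>i. smooth (\<lambda>x. Q x $ i)" and qh: "\<And>x. x \<in> interior T \<Longrightarrow> qh x = Q x"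
    and \<theta>: "test_fun D \<theta>"
  shows "normal_trace T (\<lambda>x. q x - qh x) \<theta> =
    (\<integral>x. q x \<bullet> grad \<theta> x + \<delta> x * \<theta> x \<partial>lebesgue_on T) - (\<integral>x. (Q x \<bullet> n) * \<theta> x \<partial>surface_on F)"
proof -
  let ?M = "lebesgue_on (interior T)"
  have s: "interior T \<in> sets lebesgue" and bd: "bounded (interior T)"
    using compact_imp_bounded[OF compact_T] bounded_subset interior_subset by auto
  have qT: "weak_div (interior T) q \<delta>"
    by (rule weak_div_subset[OF \<Omega>(1) open_interior \<Omega>(2) q])
  have QT: "weak_div (interior T) Q (divg Q)"
    by (rule weak_div_smooth[OF open_interior bd Q])
  have "weak_div (interior T) (\<lambda>x. q x - Q x) (\<lambda>x. \<delta> x - divg Q x)"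
    by (rule weak_div_diff[OF open_interior qT QT])
  then have e: "weak_div (interior T) (\<lambda>x. q x - qh x) (\<lambda>x. \<delta> x - divg Q x)"
    by (rule weak_div_cong[THEN iffD1, rotated -1]) (simp_all add: qh)
  note \<theta>2 = L2_test_fun[OF \<theta> s] L2_grad_test_fun[OF \<theta> s]
  have i1: "integrable ?M (\<lambda>x. q x \<bullet> grad \<theta> x + \<delta> x * \<theta> x)"
    by (intro Bochner_Integration.integrable_add L2_integrable_inner L2_integrable_mult weak_divD(1,2)[OF qT] \<theta>2)
  have i2: "integrable ?M (\<lambda>x. Q x \<bullet> grad \<theta> x + divg Q x * \<theta> x)"
    by (intro Bochner_Integration.integrable_add L2_integrable_inner L2_integrable_mult weak_divD(1,2)[OF QT] \<theta>2)
  have i3: "integrable ?M (\<lambda>x. (q x - qh x) \<bullet> grad \<theta> x + wdiv (interior T) (\<lambda>x. q x - qh x) x * \<theta> x)"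
    by (intro Bochner_Integration.integrable_add L2_integrable_inner L2_integrable_mult
        weak_divD(1,2)[OF weak_div_wdiv[OF e]] \<theta>2)
  have ae: "AE x in ?M. (q x - qh x) \<bullet> grad \<theta> x + wdiv (interior T) (\<lambda>x. q x - qh x) x * \<theta> x =
      (q x \<bullet> grad \<theta> x + \<delta> x * \<theta> x) - (Q x \<bullet> grad \<theta> x + divg Q x * \<theta> x)"
  proof -
    have "AE x in ?M. x \<in> interior T" by (rule AE_I2) simp
    then show ?thesis using wdiv_AE[OF open_interior e]
      by eventually_elim (simp add: qh inner_diff_left left_diff_distrib)
  qed
  have "normal_trace T (\<lambda>x. q x - qh x) \<theta> =
      (\<integral>x. (q x - qh x) \<bullet> grad \<theta> x + wdiv (interior T) (\<lambda>x. q x - qh x) x * \<theta> x \<partial>?M)"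
    unfolding normal_trace_def by (rule integral_lebesgue_on_spike[OF spike i3])
  also have "\<dots> = (\<integral>x. (q x \<bullet> grad \<theta> x + \<delta> x * \<theta> x) - (Q x \<bullet> grad \<theta> x + divg Q x * \<theta> x) \<partial>?M)"
    by (rule integral_cong_AE[OF borel_measurable_integrable[OF i3] _ ae])
      (rule borel_measurable_integrable[OF Bochner_Integration.integrable_diff[OF i1 i2]])
  also have "\<dots> = (\<integral>x. q x \<bullet> grad \<theta> x + \<delta> x * \<theta> x \<partial>?M) - (\<integral>x. Q x \<bullet> grad \<theta> x + divg Q x * \<theta> x \<partial>?M)"
    by (rule Bochner_Integration.integral_diff[OF i1 i2])
  also have "(\<integral>x. q x \<bullet> grad \<theta> x + \<delta> x * \<theta> x \<partial>?M) = (\<integral>x. q x \<bullet> grad \<theta> x + \<delta> x * \<theta> x \<partial>lebesgue_on T)"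
    by (rule integral_lebesgue_on_spike[OF spike i1, symmetric])
  also have "(\<integral>x. Q x \<bullet> grad \<theta> x + divg Q x * \<theta> x \<partial>?M) = (\<integral>x. Q x \<bullet> grad \<theta> x + divg Q x * \<theta> x \<partial>lebesgue_on T)"
    by (rule integral_lebesgue_on_spike[OF spike i2, symmetric])
  finally show ?thesis by (simp only: green_field[OF Q \<theta>])
qed

text \<open>
  As in \<open>jump_of_error\<close>, with the weak divergence of \<open>q\<close> on \<open>D\<close>: the normal traces of \<open>q\<close> on the two
  sides cancel.
\<close>
lemma normal_jump_of_error:
  fixes q qh :: "real^'n \<Rightarrow> real^'n"
  assumes p: "face_side Tp F (interior (Tp \<union> Tm)) n b"
    and m: "face_side Tm F (interior (Tp \<union> Tm)) (- n) (- b)"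
    and \<Omega>: "open \<Omega>" "interior (Tp \<union> Tm) \<subseteq> \<Omega>" and q: "weak_div \<Omega> q \<delta>"
    and Q: "\<And>i. smooth (\<lambda>x. Qp x $ i)" "\<And>i. smooth (\<lambda>x. Qm x $ i)"
    and qh: "\<And>x. x \<in> interior Tp \<Longrightarrow> qh x = Qp x" "\<And>x. x \<in> interior Tm \<Longrightarrow> qh x = Qm x"
    and j: "has_normal_jump Tp Tm F (\<lambda>x. q x - qh x) j"
  shows "AE x in surface_on F. j x = - (Qp x \<bullet> n + Qm x \<bullet> (- n))"
proof -
  interpret p: face_side Tp F "interior (Tp \<union> Tm)" n b by fact
  interpret m: face_side Tm F "interior (Tp \<union> Tm)" "- n" "- b" by fact
  let ?D = "interior (Tp \<union> Tm)"
  have D: "?D \<in> sets lebesgue" by simp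
  have Tp\<Omega>: "interior Tp \<subseteq> \<Omega>" and Tm\<Omega>: "interior Tm \<subseteq> \<Omega>"
    using \<Omega>(2) interior_mono[of Tp "Tp \<union> Tm"] interior_mono[of Tm "Tp \<union> Tm"] by auto
  have Lj: "L2 (surface_on F) j" using j unfolding has_normal_jump_def by blast
  have Lp: "L2 (surface_on F) (\<lambda>x. Qp x \<bullet> n)" and Lm: "L2 (surface_on F) (\<lambda>x. Qm x \<bullet> (- n))"
    by (intro p.L2_surface_continuous continuous_on_inner continuous_on_const continuous_on_field Q)+
  have qD: "weak_div ?D q \<delta>" by (rule weak_div_subset[OF \<Omega>(1) open_interior \<Omega>(2) q])
  have "AE x in surface_on F. j x + (Qp x \<bullet> n + Qm x \<bullet> (- n)) = 0"
  proof (rule p.fundamental_lemma_surface)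
    show "L2 (surface_on F) (\<lambda>x. j x + (Qp x \<bullet> n + Qm x \<bullet> (- n)))"
      by (intro L2_add Lj Lp Lm)
    fix \<theta> assume \<theta>: "test_fun ?D \<theta>"
    let ?f = "\<lambda>x. q x \<bullet> grad \<theta> x + \<delta> x * \<theta> x"
    note \<theta>2 = L2_test_fun[OF \<theta> D] L2_grad_test_fun[OF \<theta> D]
    note \<theta>F = p.L2_surface_continuous[OF smooth_continuous[OF test_fun_smooth[OF \<theta>]]]
    have i: "integrable (lebesgue_on ?D) (\<lambda>x. q x \<bullet> grad \<theta> x)" "integrable (lebesgue_on ?D) (\<lambda>x. \<delta> x * \<theta> x)"
      by (intro L2_integrable_inner L2_integrable_mult weak_divD(1,2)[OF qD] \<theta>2)+
    have f: "integrable (lebesgue_on ?D) ?f" using i by simp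
    have "(\<integral>x. ?f x \<partial>lebesgue_on ?D) = 0" using weak_divD(3)[OF qD \<theta>] i by simp
    moreover have "(\<integral>x. ?f x \<partial>lebesgue_on Tp) + (\<integral>x. ?f x \<partial>lebesgue_on Tm) = (\<integral>x. ?f x \<partial>lebesgue_on ?D)"
      by (rule integral_two_sides[OF p m f]) (simp add: test_fun_outside[OF \<theta>])
    moreover have "normal_trace Tp (\<lambda>x. q x - qh x) \<theta> + normal_trace Tm (\<lambda>x. q x - qh x) \<theta> =
        (\<integral>x. j x * \<theta> x \<partial>surface_on F)"
      using j \<theta> unfolding has_normal_jump_def by blast
    ultimately have "(\<integral>x. j x * \<theta> x \<partial>surface_on F) + (\<integral>x. (Qp x \<bullet> n) * \<theta> x \<partial>surface_on F) +
        (\<integral>x. (Qm x \<bullet> (- n)) * \<theta> x \<partial>surface_on F) = 0"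
      using p.normal_trace_error[OF \<Omega>(1) Tp\<Omega> q Q(1) qh(1) \<theta>]
        m.normal_trace_error[OF \<Omega>(1) Tm\<Omega> q Q(2) qh(2) \<theta>] by linarith
    then show "(\<integral>x. (j x + (Qp x \<bullet> n + Qm x \<bullet> (- n))) * \<theta> x \<partial>surface_on F) = 0"
      using L2_integrable_mult[OF Lj \<theta>F] L2_integrable_mult[OF Lp \<theta>F] L2_integrable_mult[OF Lm \<theta>F]
      by (simp only: distrib_right Bochner_Integration.integral_add Bochner_Integration.integrable_add)
  qed
  then show ?thesis by eventually_elim linarith
qed

section \<open>The estimator\<close>

lemma L2norm_cong_AE:
  assumes "L2 M f" "AE x in M. norm (g x) = norm (f x)" "g \<in> borel_measurable M"
  shows "L2norm M g = L2norm M f"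
proof -
  have "(\<integral>x. (norm (g x))\<^sup>2 \<partial>M) = (\<integral>x. (norm (f x))\<^sup>2 \<partial>M)"
  proof (rule integral_cong_AE)
    show "(\<lambda>x. (norm (g x))\<^sup>2) \<in> borel_measurable M" using assms(3) by measurable
    show "(\<lambda>x. (norm (f x))\<^sup>2) \<in> borel_measurable M" using L2_borel_measurable[OF assms(1)] by measurable
    show "AE x in M. (norm (g x))\<^sup>2 = (norm (f x))\<^sup>2" using assms(2) by eventually_elim simp
  qed
  then show ?thesis by (simp add: L2norm_def)
qed

lemma L2norm_square_add_le:
  fixes f :: "'a \<Rightarrow> 'b::euclidean_space" and g :: "'a \<Rightarrow> 'c::euclidean_space" and h :: "'a \<Rightarrow> 'd::euclidean_space"
  assumes f: "L2 M f" and g: "L2 M g"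
    and h: "AE x in M. norm (h x) \<le> norm (f x) + K * norm (g x)"
  shows "(L2norm M h)\<^sup>2 \<le> 2 * (L2norm M f)\<^sup>2 + 2 * K\<^sup>2 * (L2norm M g)\<^sup>2"
proof -
  have "(\<integral>x. (norm (h x))\<^sup>2 \<partial>M) \<le> (\<integral>x. 2 * (norm (f x))\<^sup>2 + 2 * K\<^sup>2 * (norm (g x))\<^sup>2 \<partial>M)"
  proof (rule integral_mono_AE')
    show "AE x in M. (norm (h x))\<^sup>2 \<le> 2 * (norm (f x))\<^sup>2 + 2 * K\<^sup>2 * (norm (g x))\<^sup>2"
      using h
    proof eventually_elim
      case (elim x)
      then have "(norm (h x))\<^sup>2 \<le> (norm (f x) + K * norm (g x))\<^sup>2" by (intro power_mono) auto
      also have "\<dots> \<le> 2 * (norm (f x))\<^sup>2 + 2 * (K * norm (g x))\<^sup>2"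
        using norm_add_square_le[of "norm (f x)" "K * norm (g x)"] by simp
      finally show ?case by (simp add: power_mult_distrib)
    qed
  qed (use L2_square_integrable[OF f] L2_square_integrable[OF g] in auto)
  also have "\<dots> = 2 * (L2norm M f)\<^sup>2 + 2 * K\<^sup>2 * (L2norm M g)\<^sup>2"
    using L2_square_integrable[OF f] L2_square_integrable[OF g] by (simp add: L2norm_square)
  finally show ?thesis by (simp add: L2norm_square)
qed

lemma grad_cong_open:
  assumes "open S" "x \<in> S" "smooth P" "\<And>y. y \<in> S \<Longrightarrow> v y = P y"
  shows "grad v x = grad P x"
  by (rule grad_eqI, rule has_derivative_transform_within_open[OF smooth_has_derivative[OF assms(3)] assms(1,2)])
    (simp add: assms(4))

lemma divg_cong_open:
  fixes Q :: "real^'n \<Rightarrow> real^'n"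
  assumes "open S" "x \<in> S" "\<And>i. smooth (\<lambda>x. Q x $ i)" "\<And>y. y \<in> S \<Longrightarrow> v y = Q y"
  shows "divg v x = divg Q x"
proof -
  have "(v has_derivative (\<lambda>v. \<chi> i. grad (\<lambda>x. Q x $ i) x \<bullet> v)) (at x)"
    by (rule has_derivative_transform_within_open[OF has_derivative_field[OF assms(3)] assms(1,2)])
      (simp add: assms(4))
  from frechet_derivative_at[OF this, symmetric] show ?thesis
    by (simp add: divg_def[of v] divg_field[OF assms(3)])
qed

lemma Wh_local:
  assumes "w \<in> Wh \<Omega> \<T> p" "T \<in> \<T>"
  obtains P where "smooth P" "\<And>x. x \<in> interior T \<Longrightarrow> w x = P x"
  using assms poly_le_smooth unfolding Wh_def by blast

lemma Vh_local:
  assumes "v \<in> Vh \<Omega> \<T> p" "T \<in> \<T>"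
  obtains Q where "\<And>i. smooth (\<lambda>x. Q x $ i)" "\<And>x. x \<in> interior T \<Longrightarrow> v x = Q x"
proof -
  have "\<forall>i. \<exists>P. poly_le p P \<and> (\<forall>x\<in>interior T. v x $ i = P x)"
    using assms unfolding Vh_def by blast
  then obtain P where P: "\<And>i. poly_le p (P i)" "\<And>i x. x \<in> interior T \<Longrightarrow> v x $ i = P i x"
    by metis
  show thesis
    by (rule that[of "\<lambda>x. \<chi> i. P i x"]) (auto simp: poly_le_smooth[OF P(1)] P(2) vec_eq_iff)
qed

lemma alpha_nonneg: "bounded S \<Longrightarrow> 0 \<le> alpha \<epsilon> S"
  using diameter_ge_0[of S] by (simp add: alpha_def)

text \<open>
  Together with \<open>alpha_nonneg\<close>, this makes the expressions under the roots in the face estimates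
  nonnegative, so that equality of both sides implies the inequality with any constant \<open>\<ge> 1\<close>.
\<close>
lemma gamma_nonneg:
  assumes \<epsilon>: "\<epsilon> > 0" and \<beta>: "continuous_on (closure \<Omega>) \<beta>" and \<Omega>: "bounded \<Omega>"
    and F: "F \<subseteq> closure \<Omega>" "F \<noteq> {}"
  shows "0 \<le> gamma \<epsilon> \<beta> F"
proof -
  obtain x where x: "x \<in> F" using F(2) by blast
  have "compact (\<beta> ` closure \<Omega>)"
    using \<Omega> by (intro compact_continuous_image \<beta>) (simp add: compact_closure)
  then obtain B where B: "\<And>x. x \<in> closure \<Omega> \<Longrightarrow> norm (\<beta> x) \<le> B"
    by (meson bounded_iff compact_imp_bounded imageI)
  have "0 \<le> norm (\<beta> x)" by simp
  also have "\<dots> \<le> (SUP x\<in>F. norm (\<beta> x))"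
    by (rule cSUP_upper[OF x]) (rule bdd_aboveI2[of _ _ B], use B F in auto)
  finally have S: "0 \<le> (SUP x\<in>F. norm (\<beta> x))" .
  have "bounded F" by (rule bounded_subset[OF bounded_closure[OF \<Omega>] F(1)])
  then have d: "0 \<le> diameter F" and "0 \<le> alpha \<epsilon> F"
    by (simp_all add: diameter_ge_0 alpha_nonneg)
  then show ?thesis
    using S d \<epsilon> unfolding gamma_def Let_def
    by (intro min.boundedI add_nonneg_nonneg mult_nonneg_nonneg divide_nonneg_nonneg) auto
qed

lemma mesh_face:
  assumes "conforming_mesh \<Omega> \<T>" "T \<in> \<T>" "F facet_of T"
  shows "F \<noteq> {}" "F \<subseteq> closure \<Omega>"
proof -
  show "F \<noteq> {}" using assms(3) by (simp add: facet_of_def)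
  show "F \<subseteq> closure \<Omega>"
    using assms facet_of_imp_subset[OF assms(3)] unfolding conforming_mesh_def by blast
qed

text \<open>
  On the face the one-sided values of the discrete functions are those of smooth functions on the
  whole space, so that the jumps in the estimator are, up to the sign, the jumps of the errors.
\<close>
lemma eta_int_eq_error_jumps:
  fixes \<Omega> :: "(real^'n) set"
  assumes \<Omega>: "open \<Omega>" "bounded \<Omega>" "interior (closure \<Omega>) = \<Omega>"
    and \<beta>: "continuous_on (closure \<Omega>) \<beta>" and \<epsilon>: "\<epsilon> > 0"
    and u: "weak_grad \<Omega> u G" and q: "weak_div \<Omega> q \<delta>"
    and mesh: "conforming_mesh \<Omega> \<T>" and qh: "qh \<in> Vh \<Omega> \<T> p" and uh: "uh \<in> Wh \<Omega> \<T> p"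
    and T: "Tp \<in> \<T>" "Tm \<in> \<T>" "Tp \<noteq> Tm" "F facet_of Tp" "F facet_of Tm"
    and jq: "has_normal_jump Tp Tm F (\<lambda>x. q x - qh x) jq" and ju: "has_jump Tp Tm F (\<lambda>x. u x - uh x) ju"
  shows "eta_int \<epsilon> \<beta> qh uh Tp Tm F = sqrt (
     \<epsilon> powr (-1/2) * alpha \<epsilon> F * (L2norm (surface_on F) jq)\<^sup>2
     + gamma \<epsilon> \<beta> F * (L2norm (surface_on F) ju)\<^sup>2)"
proof -
  have simplex: "int CARD('n) simplex Tp" "int CARD('n) simplex Tm"
    using mesh T unfolding conforming_mesh_def by blast+
  have face_of: "(Tp \<inter> Tm) face_of Tp" "(Tp \<inter> Tm) face_of Tm"
    using mesh T unfolding conforming_mesh_def triangulation_def by (blast, metis Int_commute)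
  have sub: "Tp \<union> Tm \<subseteq> closure \<Omega>" using mesh T unfolding conforming_mesh_def by blast
  then have D\<Omega>: "interior (Tp \<union> Tm) \<subseteq> \<Omega>" using interior_mono[OF sub] \<Omega>(3) by simp
  obtain n b where fs: "face_side Tp F (interior (Tp \<union> Tm)) n b"
    "face_side Tm F (interior (Tp \<union> Tm)) (- n) (- b)"
    and on: "outer_normal Tp F = n" "outer_normal Tm F = - n"
    by (rule shared_facet[OF simplex face_of T(3-5)])
  interpret p: face_side Tp F "interior (Tp \<union> Tm)" n b by fact
  interpret m: face_side Tm F "interior (Tp \<union> Tm)" "- n" "- b" by fact
  obtain Pp where Pp: "smooth Pp" "\<And>x. x \<in> interior Tp \<Longrightarrow> uh x = Pp x" using Wh_local[OF uh T(1)] by blast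
  obtain Pm where Pm: "smooth Pm" "\<And>x. x \<in> interior Tm \<Longrightarrow> uh x = Pm x" using Wh_local[OF uh T(2)] by blast
  obtain Qp where Qp: "\<And>i. smooth (\<lambda>x. Qp x $ i)" "\<And>x. x \<in> interior Tp \<Longrightarrow> qh x = Qp x"
    using Vh_local[OF qh T(1)] by blast
  obtain Qm where Qm: "\<And>i. smooth (\<lambda>x. Qm x $ i)" "\<And>x. x \<in> interior Tm \<Longrightarrow> qh x = Qm x"
    using Vh_local[OF qh T(2)] by blast
  have cl: "closed Tp" "closed Tm" using p.compact_T m.compact_T by (auto simp: compact_imp_closed)
  have sp: "space (surface_on F) = F"
    unfolding p.surface_on_face by (simp add: space_restrict_space)
  have tr: "jump Tp Tm uh x = Pp x - Pm x" "normal_jump Tp Tm F qh x = Qp x \<bullet> n + Qm x \<bullet> (- n)"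
    if "x \<in> F" for x
  proof -
    have x: "x \<in> Tp" "x \<in> Tm" using that p.face_subset m.face_subset by auto
    show "jump Tp Tm uh x = Pp x - Pm x"
      unfolding jump_def
      by (simp only: trace_from_eq[OF p.convex_T cl(1) p.interior_T smooth_continuous[OF Pp(1)] Pp(2) x(1)]
          trace_from_eq[OF m.convex_T cl(2) m.interior_T smooth_continuous[OF Pm(1)] Pm(2) x(2)])
    show "normal_jump Tp Tm F qh x = Qp x \<bullet> n + Qm x \<bullet> (- n)"
      unfolding normal_jump_def on
      by (simp only: trace_from_eq[OF p.convex_T cl(1) p.interior_T continuous_on_field[OF Qp(1)] Qp(2) x(1)]
          trace_from_eq[OF m.convex_T cl(2) m.interior_T continuous_on_field[OF Qm(1)] Qm(2) x(2)])
  qed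
  have "L2norm (surface_on F) (jump Tp Tm uh) = L2norm (surface_on F) (\<lambda>x. Pp x - Pm x)"
    unfolding L2norm_def by (intro arg_cong[where f = sqrt] Bochner_Integration.integral_cong) (auto simp: sp tr)
  also have "\<dots> = L2norm (surface_on F) ju"
  proof (rule L2norm_cong_AE)
    show "L2 (surface_on F) ju"
      using ju L2_diff unfolding has_jump_def has_trace_def by blast
    show "AE x in surface_on F. norm (Pp x - Pm x) = norm (ju x)"
    proof -
      have "AE x in surface_on F. ju x = - (Pp x - Pm x)"
        by (rule jump_of_error[OF fs \<Omega>(1) D\<Omega> u Pp(1) Pm(1) _ _ ju]) (simp_all add: Pp(2) Pm(2))
      then show ?thesis by eventually_elim auto
    qed
    show "(\<lambda>x. Pp x - Pm x) \<in> borel_measurable (surface_on F)"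
      by (intro L2_borel_measurable L2_diff p.L2_surface_continuous smooth_continuous Pp Pm)
  qed
  finally have 1: "L2norm (surface_on F) (jump Tp Tm uh) = L2norm (surface_on F) ju" .
  have "L2norm (surface_on F) (normal_jump Tp Tm F qh) = L2norm (surface_on F) (\<lambda>x. Qp x \<bullet> n + Qm x \<bullet> (- n))"
    unfolding L2norm_def by (intro arg_cong[where f = sqrt] Bochner_Integration.integral_cong) (auto simp: sp tr)
  also have "\<dots> = L2norm (surface_on F) jq"
  proof (rule L2norm_cong_AE)
    show "L2 (surface_on F) jq" using jq unfolding has_normal_jump_def by blast
    show "AE x in surface_on F. norm (Qp x \<bullet> n + Qm x \<bullet> (- n)) = norm (jq x)"
    proof -
      have "AE x in surface_on F. jq x = - (Qp x \<bullet> n + Qm x \<bullet> (- n))"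
        by (rule normal_jump_of_error[OF fs \<Omega>(1) D\<Omega> q Qp(1) Qm(1) _ _ jq]) (simp_all add: Qp(2) Qm(2))
      then show ?thesis by eventually_elim (simp only: norm_minus_cancel)
    qed
    show "(\<lambda>x. Qp x \<bullet> n + Qm x \<bullet> (- n)) \<in> borel_measurable (surface_on F)"
      by (intro L2_borel_measurable L2_add p.L2_surface_continuous continuous_on_inner continuous_on_const
          continuous_on_field Qp Qm)
  qed
  finally have 2: "L2norm (surface_on F) (normal_jump Tp Tm F qh) = L2norm (surface_on F) jq" .
  show ?thesis unfolding eta_int_def 1 2 ..
qed

text \<open>
  The two residuals are combinations of the errors almost everywhere on \<open>T\<close>. The factor \<open>2\<close> comes
  from squaring a sum of two terms, and \<open>K\<^sup>2\<close> from the reaction term \<open>c (u - u\<^sub>h)\<close>. The number \<open>Z\<close>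
  stands for the oscillation.
\<close>
lemma eta_elem_le_error:
  fixes \<Omega> :: "(real^'n) set"
  assumes \<Omega>: "open \<Omega>" "bounded \<Omega>" "interior (closure \<Omega>) = \<Omega>"
    and \<beta>: "continuous_on (closure \<Omega>) \<beta>" and \<epsilon>: "\<epsilon> > 0"
    and c: "AE x in lebesgue_on \<Omega>. norm (c x) \<le> K"
    and u: "weak_grad \<Omega> u G" and q: "weak_div \<Omega> q (\<lambda>x. f x - \<beta> x \<bullet> G x - c x * u x)"
    and qG: "q = (\<lambda>x. - \<epsilon> *\<^sub>R G x)"
    and mesh: "conforming_mesh \<Omega> \<T>" and qh: "qh \<in> Vh \<Omega> \<T> p" and uh: "uh \<in> Wh \<Omega> \<T> p" and T: "T \<in> \<T>"
  shows "eta_elem \<epsilon> \<beta> c f qh uh T \<le> sqrt (2 * (1 + K\<^sup>2)) * sqrt (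
         inverse \<epsilon> * (L2norm (lebesgue_on T) (\<lambda>x. q x - qh x))\<^sup>2
         + (L2norm (lebesgue_on T) (\<lambda>x. u x - uh x))\<^sup>2
         + \<epsilon> * (L2norm (lebesgue_on T) (wgrad (interior T) (\<lambda>x. u x - uh x)))\<^sup>2
         + (alpha \<epsilon> T)\<^sup>2 * (L2norm (lebesgue_on T) (\<lambda>x.
              wdiv (interior T) (\<lambda>x. q x - qh x) x
              + \<beta> x \<bullet> wgrad (interior T) (\<lambda>x. u x - uh x) x))\<^sup>2
         + Z\<^sup>2)"
proof -
  let ?I = "interior T" and ?e = "\<lambda>x. u x - uh x" and ?s = "\<lambda>x. q x - qh x"
  let ?M = "lebesgue_on ?I"
  have simplex: "int CARD('n) simplex T" using mesh T unfolding conforming_mesh_def by blast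
  have poly: "polytope T" by (rule simplex_imp_polytope[OF simplex])
  have conv: "convex T" and comp: "compact T"
    using poly by (auto simp: polytope_imp_convex polytope_imp_compact)
  have sub: "T \<subseteq> closure \<Omega>" using mesh T unfolding conforming_mesh_def by blast
  then have I\<Omega>: "?I \<subseteq> \<Omega>" using interior_mono[OF sub] \<Omega>(3) by simp
  have s: "?I \<in> sets lebesgue" "T \<in> sets lebesgue"
    using comp by (auto simp: borel_compact intro: lmeasurable_compact fmeasurableD)
  have bd: "bounded ?I" using compact_imp_bounded[OF comp] bounded_subset interior_subset by blast
  have null: "negligible (T - ?I)"
    using negligible_convex_frontier[OF conv] comp by (simp add: frontier_def compact_imp_closed)
  note spike = s interior_subset null
  obtain P where P: "smooth P" "\<And>x. x \<in> ?I \<Longrightarrow> uh x = P x" using Wh_local[OF uh T] by blast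
  obtain Q where Q: "\<And>i. smooth (\<lambda>x. Q x $ i)" "\<And>x. x \<in> ?I \<Longrightarrow> qh x = Q x" using Vh_local[OF qh T] by blast
  have "weak_grad ?I (\<lambda>x. u x - P x) (\<lambda>x. G x - grad P x)"
    by (intro weak_grad_diff weak_grad_subset[OF \<Omega>(1) _ I\<Omega> u] weak_grad_smooth open_interior bd P(1))
  then have e: "weak_grad ?I ?e (\<lambda>x. G x - grad P x)"
    by (rule weak_grad_cong[THEN iffD1, rotated -1]) (simp_all add: P)
  have "weak_div ?I (\<lambda>x. q x - Q x) (\<lambda>x. (f x - \<beta> x \<bullet> G x - c x * u x) - divg Q x)"
    by (intro weak_div_diff weak_div_subset[OF \<Omega>(1) _ I\<Omega> q] weak_div_smooth open_interior bd Q(1))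
  then have d: "weak_div ?I ?s (\<lambda>x. (f x - \<beta> x \<bullet> G x - c x * u x) - divg Q x)"
    by (rule weak_div_cong[THEN iffD1, rotated -1]) (simp_all add: Q)
  note we = weak_grad_wgrad[OF e] and wd = weak_div_wdiv[OF d]
  let ?A = "\<lambda>x. wdiv ?I ?s x + \<beta> x \<bullet> wgrad ?I ?e x"
  have A2: "L2 (lebesgue_on T) ?A"
  proof (rule L2_lebesgue_on_spike[OF spike], rule L2_add)
    show "L2 ?M (wdiv ?I ?s)" by (rule weak_divD(2)[OF wd])
    show "L2 ?M (\<lambda>x. \<beta> x \<bullet> wgrad ?I ?e x)"
      by (rule L2_continuous_inner[OF \<Omega>(2) \<beta> s(1) _ weak_gradD(2)[OF we]]) (use interior_subset sub in blast)
  qed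
  have e2: "L2 (lebesgue_on T) ?e" and s2: "L2 (lebesgue_on T) ?s" and w2: "L2 (lebesgue_on T) (wgrad ?I ?e)"
    by (intro L2_lebesgue_on_spike[OF spike] weak_gradD[OF we] weak_divD[OF wd])+
  have inI: "AE x in ?M. x \<in> ?I" by (rule AE_I2) simp
  have cI: "AE x in ?M. norm (c x) \<le> K"
    using c s(1) \<Omega>(1) I\<Omega> by (auto simp: AE_restrict_space_iff elim!: eventually_mono)
  have "AE x in ?M. norm (residual \<beta> c f qh uh x) \<le> norm (?A x) + K * norm (?e x)"
    using inI cI wgrad_AE[OF open_interior e] wdiv_AE[OF open_interior d]
  proof eventually_elim
    case (elim x)
    have "residual \<beta> c f qh uh x = ?A x + c x * ?e x"
      using elim(1) unfolding elim(3,4)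
      by (simp add: residual_def grad_cong_open[OF open_interior _ P] divg_cong_open[OF open_interior _ Q]
          inner_diff_right algebra_simps)
    then have "norm (residual \<beta> c f qh uh x) \<le> norm (?A x) + norm (c x * ?e x)"
      by (simp only: norm_triangle_ineq)
    also have "norm (c x * ?e x) \<le> K * norm (?e x)"
      using elim(2) by (simp add: abs_mult mult_right_mono)
    finally show ?case by simp
  qed
  then have r: "(L2norm (lebesgue_on T) (residual \<beta> c f qh uh))\<^sup>2 \<le>
      2 * (L2norm (lebesgue_on T) ?A)\<^sup>2 + 2 * K\<^sup>2 * (L2norm (lebesgue_on T) ?e)\<^sup>2"
    by (intro L2norm_square_add_le A2 e2) (simp only: AE_lebesgue_on_spike[OF spike])
  have "AE x in ?M. norm (qh x + \<epsilon> *\<^sub>R grad uh x) \<le> norm (?s x) + \<epsilon> * norm (wgrad ?I ?e x)"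
    using inI wgrad_AE[OF open_interior e]
  proof eventually_elim
    case (elim x)
    have "qh x + \<epsilon> *\<^sub>R grad uh x = - (?s x + \<epsilon> *\<^sub>R wgrad ?I ?e x)"
      using elim(1) unfolding elim(2) by (simp add: qG grad_cong_open[OF open_interior _ P] algebra_simps)
    then have "norm (qh x + \<epsilon> *\<^sub>R grad uh x) = norm (?s x + \<epsilon> *\<^sub>R wgrad ?I ?e x)"
      by (simp only: norm_minus_cancel)
    also have "\<dots> \<le> norm (?s x) + norm (\<epsilon> *\<^sub>R wgrad ?I ?e x)" by (rule norm_triangle_ineq)
    finally show ?case using \<epsilon> by simp
  qed
  then have g: "(L2norm (lebesgue_on T) (\<lambda>x. qh x + \<epsilon> *\<^sub>R grad uh x))\<^sup>2 \<le>
      2 * (L2norm (lebesgue_on T) ?s)\<^sup>2 + 2 * \<epsilon>\<^sup>2 * (L2norm (lebesgue_on T) (wgrad ?I ?e))\<^sup>2"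
    by (intro L2norm_square_add_le s2 w2) (simp only: AE_lebesgue_on_spike[OF spike])
  define a A U S W where "a = (alpha \<epsilon> T)\<^sup>2" and "A = (L2norm (lebesgue_on T) ?A)\<^sup>2"
    and "U = (L2norm (lebesgue_on T) ?e)\<^sup>2" and "S = (L2norm (lebesgue_on T) ?s)\<^sup>2"
    and "W = (L2norm (lebesgue_on T) (wgrad ?I ?e))\<^sup>2"
  have nonneg: "0 \<le> a" "0 \<le> A" "0 \<le> U" "0 \<le> S" "0 \<le> W"
    by (simp_all add: a_def A_def U_def S_def W_def)
  have "0 \<le> alpha \<epsilon> T"
    using diameter_ge_0[OF compact_imp_bounded[OF comp]] by (simp add: alpha_def)
  then have a1: "a \<le> 1" unfolding a_def by (intro power_le_one) (simp_all add: alpha_def)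
  have "a * (L2norm (lebesgue_on T) (residual \<beta> c f qh uh))\<^sup>2 \<le> a * (2 * A + 2 * K\<^sup>2 * U)"
    using r nonneg(1) by (intro mult_left_mono) (simp_all add: A_def U_def)
  also have "\<dots> \<le> 2 * (a * A) + 2 * K\<^sup>2 * U"
    using mult_right_mono[OF a1, of "2 * K\<^sup>2 * U"] nonneg by (simp add: algebra_simps)
  finally have 1: "a * (L2norm (lebesgue_on T) (residual \<beta> c f qh uh))\<^sup>2 \<le> 2 * (a * A) + 2 * K\<^sup>2 * U" .
  have "inverse \<epsilon> * (L2norm (lebesgue_on T) (\<lambda>x. qh x + \<epsilon> *\<^sub>R grad uh x))\<^sup>2 \<le> inverse \<epsilon> * (2 * S + 2 * \<epsilon>\<^sup>2 * W)"
    using g \<epsilon> by (intro mult_left_mono) (simp_all add: S_def W_def)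
  also have "\<dots> = 2 * (inverse \<epsilon> * S) + 2 * (\<epsilon> * W)"
    using \<epsilon> by (simp add: field_simps power2_eq_square)
  finally have 2: "inverse \<epsilon> * (L2norm (lebesgue_on T) (\<lambda>x. qh x + \<epsilon> *\<^sub>R grad uh x))\<^sup>2 \<le>
    2 * (inverse \<epsilon> * S) + 2 * (\<epsilon> * W)" .
  \<comment> \<open>the sum under the root on the right-hand side\<close>
  define X where "X = inverse \<epsilon> * S + U + \<epsilon> * W + a * A + Z\<^sup>2"
  have t: "0 \<le> inverse \<epsilon> * S" "0 \<le> \<epsilon> * W" "0 \<le> a * A" "0 \<le> Z\<^sup>2" using nonneg \<epsilon> by auto
  have "K\<^sup>2 * U \<le> K\<^sup>2 * X" using t by (intro mult_left_mono) (simp_all add: X_def)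
  moreover have "2 * (inverse \<epsilon> * S) + 2 * (\<epsilon> * W) + 2 * (a * A) \<le> 2 * X"
    using t nonneg(3) by (simp add: X_def)
  ultimately have "a * (L2norm (lebesgue_on T) (residual \<beta> c f qh uh))\<^sup>2 +
      inverse \<epsilon> * (L2norm (lebesgue_on T) (\<lambda>x. qh x + \<epsilon> *\<^sub>R grad uh x))\<^sup>2 \<le> 2 * X + 2 * (K\<^sup>2 * X)"
    using 1 2 by linarith
  also have "\<dots> = 2 * (1 + K\<^sup>2) * X" by (simp add: algebra_simps)
  finally show ?thesis
    unfolding eta_elem_def real_sqrt_mult[symmetric]
    by (simp add: a_def A_def U_def S_def W_def X_def)
qed

theorem theorem2p3:
  fixes \<Omega> :: "(real^'n) set"
    and \<beta> :: "real^'n \<Rightarrow> real^'n" and c \<psi> :: "real^'n \<Rightarrow> real"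
    and b\<^sub>0 \<rho>\<^sub>0 \<kappa> :: real and p :: nat
  assumes "CARD('n) = 2 \<or> CARD('n) = 3"
    and "polyhedral_domain \<Omega>"
    and "\<And>i. W1inf \<Omega> (\<lambda>x. \<beta> x $ i)" and "continuous_on (closure \<Omega>) \<beta>"
    and "Linf (lebesgue_on \<Omega>) c"
    and "AE x in lebesgue_on \<Omega>. c x - wdiv \<Omega> \<beta> x / 2 \<ge> 0"
    and "W1inf \<Omega> \<psi>" and "b\<^sub>0 > 0" and "AE x in lebesgue_on \<Omega>. \<beta> x \<bullet> wgrad \<Omega> \<psi> x \<ge> b\<^sub>0"
    and "p \<ge> 1" and "0 < \<rho>\<^sub>0" and "\<rho>\<^sub>0 \<le> 1"
  shows "\<exists>C\<^sub>1>0. \<forall>\<epsilon> f g u \<T> q\<^sub>h u\<^sub>h uhat q.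
    0 < \<epsilon> \<and> \<epsilon> \<le> 1 \<and>
    L2 (lebesgue_on \<Omega>) f \<and> Hhalf (frontier \<Omega>) g \<and> weak_solution \<Omega> \<epsilon> \<beta> c f g u \<and>
    q = (\<lambda>x. - \<epsilon> *\<^sub>R wgrad \<Omega> u x) \<and>
    conforming_mesh \<Omega> \<T> \<and> shape_regular \<kappa> \<T> \<and>
    hdg_solution \<Omega> \<T> p \<rho>\<^sub>0 \<epsilon> \<beta> c f g q\<^sub>h u\<^sub>h uhat \<longrightarrow>
    (\<forall>F\<in>interior_faces \<Omega> \<T>. \<forall>Tp\<in>\<T>. \<forall>Tm\<in>\<T>. \<forall>jq ju.
       Tp \<noteq> Tm \<and> F facet_of Tp \<and> F facet_of Tm \<and>
       has_normal_jump Tp Tm F (\<lambda>x. q x - q\<^sub>h x) jq \<and> has_jump Tp Tm F (\<lambda>x. u x - u\<^sub>h x) ju \<longrightarrow>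
       eta_int \<epsilon> \<beta> q\<^sub>h u\<^sub>h Tp Tm F \<le> C\<^sub>1 * sqrt (
         \<epsilon> powr (-1/2) * alpha \<epsilon> F * (L2norm (surface_on F) jq)\<^sup>2
         + gamma \<epsilon> \<beta> F * (L2norm (surface_on F) ju)\<^sup>2)) \<and>
    (\<forall>F\<in>boundary_faces \<Omega> \<T>. \<forall>T\<in>\<T>. F facet_of T \<longrightarrow>
       eta_bdry \<epsilon> \<beta> g u\<^sub>h T F \<le> C\<^sub>1 * sqrt (
         gamma \<epsilon> \<beta> F * (L2norm (surface_on F) (\<lambda>x. g x - trace_from T u\<^sub>h x))\<^sup>2)) \<and>
    (\<forall>T\<in>\<T>.
       eta_elem \<epsilon> \<beta> c f q\<^sub>h u\<^sub>h T \<le> C\<^sub>1 * sqrt (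
         inverse \<epsilon> * (L2norm (lebesgue_on T) (\<lambda>x. q x - q\<^sub>h x))\<^sup>2
         + (L2norm (lebesgue_on T) (\<lambda>x. u x - u\<^sub>h x))\<^sup>2
         + \<epsilon> * (L2norm (lebesgue_on T) (wgrad (interior T) (\<lambda>x. u x - u\<^sub>h x)))\<^sup>2
         + (alpha \<epsilon> T)\<^sup>2 * (L2norm (lebesgue_on T) (\<lambda>x.
              wdiv (interior T) (\<lambda>x. q x - q\<^sub>h x) x
              + \<beta> x \<bullet> wgrad (interior T) (\<lambda>x. u x - u\<^sub>h x) x))\<^sup>2
         + (osc \<Omega> \<T> p \<epsilon> (residual \<beta> c f q\<^sub>h u\<^sub>h) T)\<^sup>2))"
proof -
  have \<Omega>: "open \<Omega>" "bounded \<Omega>" "interior (closure \<Omega>) = \<Omega>"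
    using assms(2) by (auto simp: polyhedral_domain_def)
  obtain K where K: "AE x in lebesgue_on \<Omega>. norm (c x) \<le> K"
    using assms(5) unfolding Linf_def by blast
  \<comment> \<open>at least \<open>1\<close>, as the equalities on the faces require\<close>
  let ?C = "sqrt (2 * (1 + K\<^sup>2))"
  have C: "?C \<ge> 1" by simp
  have C_mono: "sqrt X \<le> ?C * sqrt X" if "0 \<le> X" for X
    using mult_right_mono[OF C, of "sqrt X"] that by simp
  show ?thesis
  proof (rule exI[of _ ?C], intro conjI allI impI ballI; (elim conjE)?)
    show "0 < ?C" using C by linarith
  next
    fix \<epsilon> f g u \<T> q\<^sub>h u\<^sub>h uhat q F Tp Tm jq ju
    assume a: "0 < \<epsilon>" "L2 (lebesgue_on \<Omega>) f" "weak_solution \<Omega> \<epsilon> \<beta> c f g u"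
      "q = (\<lambda>x. - \<epsilon> *\<^sub>R wgrad \<Omega> u x)" "conforming_mesh \<Omega> \<T>" "hdg_solution \<Omega> \<T> p \<rho>\<^sub>0 \<epsilon> \<beta> c f g q\<^sub>h u\<^sub>h uhat"
      and T: "Tp \<in> \<T>" "Tm \<in> \<T>" "Tp \<noteq> Tm" "F facet_of Tp" "F facet_of Tm"
      and j: "has_normal_jump Tp Tm F (\<lambda>x. q x - q\<^sub>h x) jq" "has_jump Tp Tm F (\<lambda>x. u x - u\<^sub>h x) ju"
    have h: "q\<^sub>h \<in> Vh \<Omega> \<T> p" "u\<^sub>h \<in> Wh \<Omega> \<T> p" using a(6) unfolding hdg_solution_def by blast+
    note w = weak_solution_weak_div[OF \<Omega>(1,2) assms(4,5) a(2,3)]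
    have eq: "eta_int \<epsilon> \<beta> q\<^sub>h u\<^sub>h Tp Tm F = sqrt (
         \<epsilon> powr (-1/2) * alpha \<epsilon> F * (L2norm (surface_on F) jq)\<^sup>2
         + gamma \<epsilon> \<beta> F * (L2norm (surface_on F) ju)\<^sup>2)"
      by (rule eta_int_eq_error_jumps[OF \<Omega> assms(4) a(1) w(1) w(2)[folded a(4)] a(5) h T j])
    note F = mesh_face[OF a(5) T(1,4)]
    have "0 \<le> alpha \<epsilon> F" by (rule alpha_nonneg[OF bounded_subset[OF bounded_closure[OF \<Omega>(2)] F(2)]])
    then have "0 \<le> \<epsilon> powr (-1/2) * alpha \<epsilon> F * (L2norm (surface_on F) jq)\<^sup>2
         + gamma \<epsilon> \<beta> F * (L2norm (surface_on F) ju)\<^sup>2"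
      using gamma_nonneg[OF a(1) assms(4) \<Omega>(2) F(2,1)] by simp
    then show "eta_int \<epsilon> \<beta> q\<^sub>h u\<^sub>h Tp Tm F \<le> ?C * sqrt (
         \<epsilon> powr (-1/2) * alpha \<epsilon> F * (L2norm (surface_on F) jq)\<^sup>2
         + gamma \<epsilon> \<beta> F * (L2norm (surface_on F) ju)\<^sup>2)"
      unfolding eq by (rule C_mono)
  next
    fix \<epsilon> :: real and g u\<^sub>h :: "real^'n \<Rightarrow> real" and \<T> :: "(real^'n) set set" and F T :: "(real^'n) set"
    assume \<epsilon>: "0 < \<epsilon>" and mesh: "conforming_mesh \<Omega> \<T>" "T \<in> \<T>" "F facet_of T"
    note F = mesh_face[OF mesh]
    have "L2norm (surface_on F) (\<lambda>x. trace_from T u\<^sub>h x - g x) = L2norm (surface_on F) (\<lambda>x. g x - trace_from T u\<^sub>h x)"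
      by (simp only: L2norm_def norm_minus_commute)
    then have eq: "eta_bdry \<epsilon> \<beta> g u\<^sub>h T F =
        sqrt (gamma \<epsilon> \<beta> F * (L2norm (surface_on F) (\<lambda>x. g x - trace_from T u\<^sub>h x))\<^sup>2)"
      by (simp add: eta_bdry_def real_sqrt_mult L2norm_nonneg)
    have "0 \<le> gamma \<epsilon> \<beta> F * (L2norm (surface_on F) (\<lambda>x. g x - trace_from T u\<^sub>h x))\<^sup>2"
      using gamma_nonneg[OF \<epsilon> assms(4) \<Omega>(2) F(2,1)] by simp
    then    show "eta_bdry \<epsilon> \<beta> g u\<^sub>h T F \<le> ?C * sqrt (
         gamma \<epsilon> \<beta> F * (L2norm (surface_on F) (\<lambda>x. g x - trace_from T u\<^sub>h x))\<^sup>2)"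
      unfolding eq by (rule C_mono)
  next
    fix \<epsilon> f g u \<T> q\<^sub>h u\<^sub>h uhat q T
    assume a: "0 < \<epsilon>" "L2 (lebesgue_on \<Omega>) f" "weak_solution \<Omega> \<epsilon> \<beta> c f g u"
      "q = (\<lambda>x. - \<epsilon> *\<^sub>R wgrad \<Omega> u x)" "conforming_mesh \<Omega> \<T>" "hdg_solution \<Omega> \<T> p \<rho>\<^sub>0 \<epsilon> \<beta> c f g q\<^sub>h u\<^sub>h uhat"
      and T: "T \<in> \<T>"
    have h: "q\<^sub>h \<in> Vh \<Omega> \<T> p" "u\<^sub>h \<in> Wh \<Omega> \<T> p" using a(6) unfolding hdg_solution_def by blast+
    note w = weak_solution_weak_div[OF \<Omega>(1,2) assms(4,5) a(2,3)]
    show "eta_elem \<epsilon> \<beta> c f q\<^sub>h u\<^sub>h T \<le> ?C * sqrt (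
         inverse \<epsilon> * (L2norm (lebesgue_on T) (\<lambda>x. q x - q\<^sub>h x))\<^sup>2
         + (L2norm (lebesgue_on T) (\<lambda>x. u x - u\<^sub>h x))\<^sup>2
         + \<epsilon> * (L2norm (lebesgue_on T) (wgrad (interior T) (\<lambda>x. u x - u\<^sub>h x)))\<^sup>2
         + (alpha \<epsilon> T)\<^sup>2 * (L2norm (lebesgue_on T) (\<lambda>x.
              wdiv (interior T) (\<lambda>x. q x - q\<^sub>h x) x
              + \<beta> x \<bullet> wgrad (interior T) (\<lambda>x. u x - u\<^sub>h x) x))\<^sup>2
         + (osc \<Omega> \<T> p \<epsilon> (residual \<beta> c f q\<^sub>h u\<^sub>h) T)\<^sup>2)"
      by (rule eta_elem_le_error[OF \<Omega> assms(4) a(1) K w(1) w(2)[folded a(4)] a(4,5) h T])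
  qed
qed

end
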